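(* Suppose that Assumptions (P) and (R) stated in the context hold, and let $\{x^k\}_{k\ge1}$ denote the iterates of the inexact power augmented Lagrangian method described in the context. If the inexact proximal point method (iPPM) described in the context is used to solve the subproblems in step (1), and if the inexact proximal point updates in iPPM are computed using the fast gradient method (FGM) described in the context, then for any $\varepsilon_\varphi>0$, $\varepsilon_A>0$ an $(\varepsilon_\varphi,\varepsilon_A)$-stationary point of $\min_{x\in\mathcal X}f(x)$ s.t. $A(x)=0$ is obtained after at most $T=\max\{T_\varphi,T_A\}$ FGM iterations, where $$T_\varphi=\widetilde O\left(\varepsilon_\varphi^{-3-\frac{1-\nu}{1+3\nu}\left(1+\frac{2(1+\nu)}{\nu}\right)}\right),\qquad T_A=\widetilde O\left(\varepsilon_A^{-3\nu-\frac{1-\nu}{1+3\nu}(3\nu+2)}\right).$$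
   Context: Problem: minimize $f(x)+g(x)$ over $x\in\mathbb R^n$ subject to $A(x)=0$, where $f:\mathbb R^n\to\mathbb R$ and $A:\mathbb R^n\to\mathbb R^m$ are continuously differentiable, $J_A(x)$ is the Jacobian of $A$, and $g=\delta_{\mathcal X}$ is the indicator of a set $\mathcal X$. Norms are Euclidean/spectral; $N_{\mathcal X}$ is the normal cone. Assumption (P): $\mathcal X\subseteq\mathbb R^n$ is nonempty, convex and compact with diameter $D>0$ (with nonempty interior), and there are positive constants $L_f,L_A,A_{\max},J_{A\max},\nabla f_{\max}$ such that, for all $x,x'\in\mathcal X$, $\|\nabla f(x')-\nabla f(x)\|\le L_f\|x'-x\|$, $\|J_A(x')-J_A(x)\|\le L_A\|x'-x\|$, $\|\nabla f(x)\|\le\nabla f_{\max}$, $\|A(x)\|\le A_{\max}$, $\|J_A(x)\|\le J_{A\max}$. Assumption (R): for any nonempty compact $\mathcal S\subseteq\mathcal X$ there is $R>0$ such that $\operatorname{dist}(-J_A^\top(x)A(x),N_{\mathcal X}(x))\ge R\|A(x)\|$ for all $x\in\mathcal S$. $x$ is an $(\varepsilon_\varphi,\varepsilon_A)$-stationary point if there is $y\in\mathbb R^m$ with $\|A(x)\|\le\varepsilon_A$ and $\operatorname{dist}(-\nabla f(x)-J_A^\top(x)y,N_{\mathcal X}(x))\le\varepsilon_\varphi$. The notation $\widetilde O$ suppresses logarithmic factors and constants independent of $\varepsilon_\varphi,\varepsilon_A$. Fix $\nu\in(0,1]$ and $\phi(z)=\frac1{\nu+1}\|z\|^{\nu+1}$,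 so $\nabla\phi(z)=\|z\|^{\nu-1}z$ for $z\neq0$, $\nabla\phi(0)=0$. For $\beta>0$ let $\psi_\beta(x,y):=f(x)+\langle A(x),y\rangle+\frac{\beta}{\nu+1}\|A(x)\|^{\nu+1}$. Inexact power augmented Lagrangian method: given $x^1\in\mathcal X$, $y^1\in\mathbb R^m$, $\lambda>0$, $\omega>1$, $\sigma_1>0$, $\beta_1>0$, $\nu\in(0,1]$, for $k=1,2,\dots$: (1) set $\varepsilon_{k+1}=\lambda/\beta_k$ and obtain $x^{k+1}\in\mathcal X$ with $\operatorname{dist}(-\nabla_x\psi_{\beta_k}(x^{k+1},y^k),N_{\mathcal X}(x^{k+1}))\le\varepsilon_{k+1}$; (2) set $\sigma_{k+1}=\sigma_1\min\left(1,\frac{\|A(x^1)\|^\nu\log^2(2)}{\|A(x^{k+1})\|^\nu(k+1)\log^2(k+2)}\right)$ (the minimum is read as $1$ if $A(x^{k+1})=0$); (3) set $y^{k+1}=y^k+\sigma_{k+1}\nabla\phi(A(x^{k+1}))$; (4) set $\beta_{k+1}=\omega\beta_k$. iPPM (inexact proximal point method) for $\min_{x\in\mathcal X}\psi(x)$ with $\psi(x)=\psi_\beta(x,y)$, tolerance $\varepsilon>0$ and $\rho:=L_f+L_A(\|y\|+\beta A_{\max}^\nu)$: starting from $x_1$, for $t=1,2,\dots$: let $F(\cdot)=\psi(\cdot)+\rho\|\cdot-x_t\|^2$ and obtain $x_{t+1}\in\mathcal X$ with $\operatorname{dist}(-\nabla F(x_{t+1}),N_{\mathcal X}(x_{t+1}))\le\varepsilon/4$;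 if $2\rho\|x_{t+1}-x_t\|\le\varepsilon/2$, return $x_{t+1}$. In step (1) of outer iteration $k$, iPPM is run with $\beta=\beta_k$, $y=y^k$, $\varepsilon=\varepsilon_{k+1}$, started at $x^k$. FGM (fast gradient method) for $\min_{x\in\mathcal X}F(x)$ with $F$ $\rho$-strongly convex and $(H_F,\nu)$-Hölder smooth on $\mathcal X$ (i.e. $\|\nabla F(x)-\nabla F(x')\|\le H_F\|x-x'\|^\nu$): given $x_0\in\mathcal X$ and accuracy parameter $\delta>0$, set $\mu=\rho$, $L=H_F\left(\frac{H_F}{2\delta}\frac{1-\nu}{1+\nu}\right)^{\frac{1-\nu}{1+\nu}}$ (equal to $H_F$ if $\nu=1$), $\alpha_0=1$ and $L+\mu\sum_{i=0}^k\alpha_i=\frac{L\alpha_{k+1}^2}{\sum_{i=0}^{k+1}\alpha_i}$; for $k=0,1,\dots$: $y_k=\arg\min_{x\in\mathcal X}\{\langle\nabla F(x_k),x-x_k\rangle+\frac L2\|x-x_k\|^2\}$, $z_k=\arg\min_{x\in\mathcal X}\{\frac L2\|x-x_0\|^2+\sum_{i=0}^k\alpha_i[\langle\nabla F(x_i),x-x_i\rangle+\frac\mu2\|x-x_i\|^2]\}$, $x_{k+1}=\tau_kz_k+(1-\tau_k)y_k$ with $\tau_k=\alpha_{k+1}/\sum_{i=0}^{k+1}\alpha_i$. For the functions $F$ arising here, $H_F=H_\beta+2\rho\max\{1,D^{1-\nu}\}$ with $H_\beta=[L_f+L_A\|y\|+\beta(2^{1-\nu}J_{A\max}^{1+\nu}+A_{\max}^\nu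 L_A)]\max\{1,D^{1-\nu}\}$. To return a point satisfying the required inequality, FGM is followed by a single projected gradient step. *)

theory Defs
  imports "HOL-Analysis.Analysis" "HOL-Library.Landau_Symbols"
begin

definition gradient :: "('a::real_inner \<Rightarrow> real) \<Rightarrow> 'a \<Rightarrow> 'a" where
  "gradient F x = (THE D. GDERIV F x :> D)"

definition normal_cone :: "'a::real_inner set \<Rightarrow> 'a \<Rightarrow> 'a set" where
  "normal_cone X x = {v. x \<in> X \<and> (\<forall>z\<in>X. v \<bullet> (z - x) \<le> 0)}"

text \<open>Soft-O. The logarithm is taken of the comparison function itself; for a comparison function
  that is a negative power of its argument this agrees, up to constants, with powers of the
  logarithm of the argument.\<close>

definition soft_O :: "'a filter \<Rightarrow> ('a \<Rightarrow> real) \<Rightarrow> ('a \<Rightarrow> real) set" where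
  "soft_O F g = {h. \<exists>p::nat. h \<in> O[F](\<lambda>x. g x * ln (g x) ^ p)}"


subsection \<open>The problem\<close>

text \<open>The matrix norm is the spectral norm, i.e. the operator norm \<^const>\<open>onorm\<close>;
  \<^const>\<open>norm\<close> on the matrix type would be the Frobenius norm.\<close>

definition assumption_P ::
  "(real^'n \<Rightarrow> real) \<Rightarrow> (real^'n \<Rightarrow> real^'m) \<Rightarrow> (real^'n) set \<Rightarrow>
   real \<Rightarrow> real \<Rightarrow> real \<Rightarrow> real \<Rightarrow> real \<Rightarrow> real \<Rightarrow> bool" where
  "assumption_P f A X D Lf LA Amax JAmax gfmax \<longleftrightarrow>
     X \<noteq> {} \<and> convex X \<and> compact X \<and> interior X \<noteq> {} \<and> diameter X = D \<and> 0 < D \<and>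
     0 < Lf \<and> 0 < LA \<and> 0 < Amax \<and> 0 < JAmax \<and> 0 < gfmax \<and>
     (\<forall>x\<in>X. \<forall>x'\<in>X. norm (gradient f x' - gradient f x) \<le> Lf * norm (x' - x)) \<and>
     (\<forall>x\<in>X. \<forall>x'\<in>X. onorm ((*v) (jacobian A (at x') - jacobian A (at x))) \<le> LA * norm (x' - x)) \<and>
     (\<forall>x\<in>X. norm (gradient f x) \<le> gfmax) \<and>
     (\<forall>x\<in>X. norm (A x) \<le> Amax) \<and>
     (\<forall>x\<in>X. onorm ((*v) (jacobian A (at x))) \<le> JAmax)"

definition assumption_R :: "(real^'n \<Rightarrow> real^'m) \<Rightarrow> (real^'n) set \<Rightarrow> bool" where
  "assumption_R A X \<longleftrightarrow>
     (\<forall>S. S \<noteq> {} \<and> compact S \<and> S \<subseteq> X \<longrightarrow>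
       (\<exists>R>0. \<forall>x\<in>S.
          infdist (- (transpose (jacobian A (at x)) *v A x)) (normal_cone X x) \<ge> R * norm (A x)))"

text \<open>The explicit requirement \<open>x \<in> X\<close> is needed because \<^const>\<open>infdist\<close> to the empty set is
  \<open>0\<close> (rather than infinite), and the normal cone is empty outside \<open>X\<close>.\<close>

definition stationary_point ::
  "(real^'n \<Rightarrow> real) \<Rightarrow> (real^'n \<Rightarrow> real^'m) \<Rightarrow> (real^'n) set \<Rightarrow> real \<Rightarrow> real \<Rightarrow> real^'n \<Rightarrow> bool" where
  "stationary_point f A X eps_phi eps_A x \<longleftrightarrow>
     x \<in> X \<and>
     (\<exists>y. norm (A x) \<le> eps_A \<and>
          infdist (- gradient f x - transpose (jacobian A (at x)) *v y) (normal_cone X x) \<le> eps_phi)"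

definition approx_solution :: "'a::real_inner set \<Rightarrow> ('a \<Rightarrow> real) \<Rightarrow> real \<Rightarrow> 'a \<Rightarrow> bool" where
  "approx_solution X F eps x \<longleftrightarrow> x \<in> X \<and> infdist (- gradient F x) (normal_cone X x) \<le> eps"

definition phi :: "real \<Rightarrow> 'a::real_inner \<Rightarrow> real" where
  "phi \<nu> z = 1 / (\<nu> + 1) * norm z powr (\<nu> + 1)"

definition psi ::
  "('a \<Rightarrow> real) \<Rightarrow> ('a \<Rightarrow> 'b::real_inner) \<Rightarrow> real \<Rightarrow> real \<Rightarrow> 'b \<Rightarrow> 'a \<Rightarrow> real" where
  "psi f A \<nu> \<beta> y x = f x + A x \<bullet> y + \<beta> / (\<nu> + 1) * norm (A x) powr (\<nu> + 1)"


subsection \<open>Fast gradient method\<close>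

text \<open>The case \<open>\<nu> = 1\<close> is separate since \<open>0 powr 0 = 0\<close>.\<close>

definition fgm_L :: "real \<Rightarrow> real \<Rightarrow> real \<Rightarrow> real" where
  "fgm_L \<nu> H \<delta> =
     (if \<nu> = 1 then H
      else H * (H / (2 * \<delta>) * ((1 - \<nu>) / (1 + \<nu>))) powr ((1 - \<nu>) / (1 + \<nu>)))"

text \<open>The recursion for the weights is a quadratic equation with one positive and one negative
  root; the weights are the positive ones.\<close>

fun fgm_alpha :: "real \<Rightarrow> real \<Rightarrow> nat \<Rightarrow> real" where
  "fgm_alpha L \<mu> 0 = 1"
| "fgm_alpha L \<mu> (Suc k) =
     (THE a. 0 < a \<and>
        L + \<mu> * (\<Sum>i\<le>k. fgm_alpha L \<mu> i) = L * a\<^sup>2 / ((\<Sum>i\<le>k. fgm_alpha L \<mu> i) + a))"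

definition gradient_step :: "'a::real_inner set \<Rightarrow> ('a \<Rightarrow> real) \<Rightarrow> real \<Rightarrow> 'a \<Rightarrow> 'a" where
  "gradient_step X F L v =
     arg_min (\<lambda>x. gradient F v \<bullet> (x - v) + L / 2 * (norm (x - v))\<^sup>2) (\<lambda>x. x \<in> X)"

text \<open>In the recursion for \<open>x\<^bsub>k+1\<^esub>\<close> the local \<open>z\<close> is \<open>z\<^bsub>k\<^esub>\<close>, and
  \<open>gradient_step X F L x\<^bsub>k\<^esub>\<close> is \<open>y\<^bsub>k\<^esub>\<close>. All minimised
  functions are strongly convex, so the minimisers are unique.\<close>

fun fgm_x ::
  "'a::real_inner set \<Rightarrow> ('a \<Rightarrow> real) \<Rightarrow> real \<Rightarrow> real \<Rightarrow> 'a \<Rightarrow> nat \<Rightarrow> 'a" where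
  "fgm_x X F L \<mu> x0 0 = x0"
| "fgm_x X F L \<mu> x0 (Suc k) =
     (let \<tau> = fgm_alpha L \<mu> (Suc k) / (\<Sum>i\<le>Suc k. fgm_alpha L \<mu> i);
          z = arg_min
                (\<lambda>x. L / 2 * (norm (x - x0))\<^sup>2 +
                  (\<Sum>i\<le>k. fgm_alpha L \<mu> i *
                     (gradient F (fgm_x X F L \<mu> x0 i) \<bullet> (x - fgm_x X F L \<mu> x0 i) +
                      \<mu> / 2 * (norm (x - fgm_x X F L \<mu> x0 i))\<^sup>2)))
                (\<lambda>x. x \<in> X)
      in \<tau> *\<^sub>R z + (1 - \<tau>) *\<^sub>R gradient_step X F L (fgm_x X F L \<mu> x0 k))"

definition fgm_y ::
  "'a::real_inner set \<Rightarrow> ('a \<Rightarrow> real) \<Rightarrow> real \<Rightarrow> real \<Rightarrow> 'a \<Rightarrow> nat \<Rightarrow> 'a" where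
  "fgm_y X F L \<mu> x0 k = gradient_step X F L (fgm_x X F L \<mu> x0 k)"

text \<open>The point obtained from iterations \<open>0,\<dots>,k\<close> of the method, i.e. from \<open>k + 1\<close>
  iterations, followed by one projected gradient step of step size \<open>\<gamma>\<close>.\<close>

definition fgm_output ::
  "'a::euclidean_space set \<Rightarrow> ('a \<Rightarrow> real) \<Rightarrow> real \<Rightarrow> real \<Rightarrow> real \<Rightarrow> 'a \<Rightarrow> nat \<Rightarrow> 'a" where
  "fgm_output X F L \<mu> \<gamma> x0 k =
     (let v = fgm_y X F L \<mu> x0 k in closest_point X (v - \<gamma> *\<^sub>R gradient F v))"

text \<open>The method stops at the first iteration whose output meets the tolerance, and returns
  that output together with the number of iterations; \<^const>\<open>None\<close> means that it never stops.\<close>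

definition fgm ::
  "'a::euclidean_space set \<Rightarrow> ('a \<Rightarrow> real) \<Rightarrow> real \<Rightarrow> real \<Rightarrow> real \<Rightarrow> real \<Rightarrow> 'a \<Rightarrow> ('a \<times> nat) option" where
  "fgm X F L \<mu> \<gamma> tol x0 =
     (if \<exists>k. approx_solution X F tol (fgm_output X F L \<mu> \<gamma> x0 k)
      then let k = (LEAST k. approx_solution X F tol (fgm_output X F L \<mu> \<gamma> x0 k))
           in Some (fgm_output X F L \<mu> \<gamma> x0 k, k + 1)
      else None)"


subsection \<open>Inexact proximal point method\<close>

definition prox_objective :: "('a::real_inner \<Rightarrow> real) \<Rightarrow> real \<Rightarrow> 'a \<Rightarrow> 'a \<Rightarrow> real" where
  "prox_objective \<psi> \<rho> c x = \<psi> x + \<rho> * (norm (x - c))\<^sup>2"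

text \<open>Here \<open>prox t F\<close> is the solver for the \<open>t\<close>-th proximal subproblem; it returns a point and the
  number of iterations it used. If it fails then so does the whole method. The result is the returned
  point and the total number of iterations of the solver.\<close>

inductive ippm_run ::
  "(nat \<Rightarrow> ('a::real_inner \<Rightarrow> real) \<Rightarrow> ('a \<times> nat) option) \<Rightarrow> ('a \<Rightarrow> real) \<Rightarrow> real \<Rightarrow> real \<Rightarrow>
   nat \<Rightarrow> 'a \<Rightarrow> 'a \<Rightarrow> nat \<Rightarrow> bool"
  for prox :: "nat \<Rightarrow> ('a \<Rightarrow> real) \<Rightarrow> ('a \<times> nat) option" and \<psi> \<rho> \<epsilon> where
  return: "prox t (prox_objective \<psi> \<rho> u) = Some (v, n) \<Longrightarrow>
     2 * \<rho> * norm (v - u) \<le> \<epsilon> / 2 \<Longrightarrow>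
     ippm_run prox \<psi> \<rho> \<epsilon> t u v n"
| continue: "prox t (prox_objective \<psi> \<rho> u) = Some (v, n) \<Longrightarrow>
     \<not> 2 * \<rho> * norm (v - u) \<le> \<epsilon> / 2 \<Longrightarrow>
     ippm_run prox \<psi> \<rho> \<epsilon> (t + 1) v w m \<Longrightarrow>
     ippm_run prox \<psi> \<rho> \<epsilon> t u w (n + m)"


subsection \<open>Inexact power augmented Lagrangian method\<close>

definition rho :: "real \<Rightarrow> real \<Rightarrow> real \<Rightarrow> real \<Rightarrow> real \<Rightarrow> 'b::real_normed_vector \<Rightarrow> real" where
  "rho Lf LA Amax \<nu> \<beta> y = Lf + LA * (norm y + \<beta> * Amax powr \<nu>)"

definition H_beta ::
  "real \<Rightarrow> real \<Rightarrow> real \<Rightarrow> real \<Rightarrow> real \<Rightarrow> real \<Rightarrow> real \<Rightarrow> 'b::real_normed_vector \<Rightarrow> real" where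
  "H_beta D Lf LA Amax JAmax \<nu> \<beta> y =
     (Lf + LA * norm y + \<beta> * (2 powr (1 - \<nu>) * JAmax powr (1 + \<nu>) + Amax powr \<nu> * LA))
       * max 1 (D powr (1 - \<nu>))"

definition H_F ::
  "real \<Rightarrow> real \<Rightarrow> real \<Rightarrow> real \<Rightarrow> real \<Rightarrow> real \<Rightarrow> real \<Rightarrow> 'b::real_normed_vector \<Rightarrow> real" where
  "H_F D Lf LA Amax JAmax \<nu> \<beta> y =
     H_beta D Lf LA Amax JAmax \<nu> \<beta> y + 2 * rho Lf LA Amax \<nu> \<beta> y * max 1 (D powr (1 - \<nu>))"

text \<open>\<open>subproblem_run \<dots> \<delta> \<gamma> s \<beta> y \<epsilon> x w n\<close>: the proximal point method for
  \<open>psi f A \<nu> \<beta> y\<close> started at \<open>x\<close>, whose \<open>t\<close>-th proximal update uses the fast gradient method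
  started at \<open>s t\<close>, terminates and returns \<open>w\<close>, after \<open>n\<close> fast gradient iterations in total.\<close>

definition subproblem_run ::
  "(real^'n \<Rightarrow> real) \<Rightarrow> (real^'n \<Rightarrow> real^'m) \<Rightarrow> (real^'n) set \<Rightarrow>
   real \<Rightarrow> real \<Rightarrow> real \<Rightarrow> real \<Rightarrow> real \<Rightarrow> real \<Rightarrow> real \<Rightarrow> real \<Rightarrow> (nat \<Rightarrow> real^'n) \<Rightarrow>
   real \<Rightarrow> real^'m \<Rightarrow> real \<Rightarrow> real^'n \<Rightarrow> real^'n \<Rightarrow> nat \<Rightarrow> bool" where
  "subproblem_run f A X D Lf LA Amax JAmax \<nu> \<delta> \<gamma> s \<beta> y \<epsilon> x w n \<longleftrightarrow>
     (let \<rho> = rho Lf LA Amax \<nu> \<beta> y;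
          L = fgm_L \<nu> (H_F D Lf LA Amax JAmax \<nu> \<beta> y) \<delta>
      in ippm_run (\<lambda>t F. fgm X F L \<rho> \<gamma> (\<epsilon> / 4) (s t)) (psi f A \<nu> \<beta> y) \<rho> \<epsilon> 1 x w n)"

definition next_sigma ::
  "('a \<Rightarrow> 'b::real_normed_vector) \<Rightarrow> real \<Rightarrow> real \<Rightarrow> 'a \<Rightarrow> nat \<Rightarrow> 'a \<Rightarrow> real" where
  "next_sigma A \<nu> \<sigma>1 x1 k x' =
     \<sigma>1 * (if A x' = 0 then 1
           else min 1 (norm (A x1) powr \<nu> * (ln 2)\<^sup>2 /
                       (norm (A x') powr \<nu> * real (k + 1) * (ln (real (k + 2)))\<^sup>2)))"

text \<open>\<open>solve k \<beta> y \<epsilon> x w n\<close> states that the subproblem solver of iteration \<open>k\<close> returns \<open>w\<close>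
  after \<open>n\<close> inner iterations. If it does not return, \<open>x (k + 1)\<close> and \<open>N k\<close> are left
  unconstrained here, so that termination of the inner methods is not presupposed.\<close>

definition power_alm_iterates ::
  "(nat \<Rightarrow> real \<Rightarrow> 'b \<Rightarrow> real \<Rightarrow> 'a \<Rightarrow> 'a \<Rightarrow> nat \<Rightarrow> bool) \<Rightarrow> ('a \<Rightarrow> 'b::real_inner) \<Rightarrow>
   real \<Rightarrow> real \<Rightarrow> real \<Rightarrow> real \<Rightarrow> real \<Rightarrow> 'a \<Rightarrow> 'b \<Rightarrow>
   (nat \<Rightarrow> 'a) \<Rightarrow> (nat \<Rightarrow> 'b) \<Rightarrow> (nat \<Rightarrow> real) \<Rightarrow> (nat \<Rightarrow> real) \<Rightarrow> (nat \<Rightarrow> real) \<Rightarrow> (nat \<Rightarrow> nat) \<Rightarrow> bool" where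
  "power_alm_iterates solve A \<nu> lam \<omega> \<sigma>1 \<beta>1 x1 y1 x y \<sigma> \<beta> \<epsilon> N \<longleftrightarrow>
     x 1 = x1 \<and> y 1 = y1 \<and> \<sigma> 1 = \<sigma>1 \<and> \<beta> 1 = \<beta>1 \<and>
     (\<forall>k\<ge>1.
        \<epsilon> (k + 1) = lam / \<beta> k \<and>
        (\<forall>w n. solve k (\<beta> k) (y k) (\<epsilon> (k + 1)) (x k) w n \<longrightarrow> x (k + 1) = w \<and> N k = n) \<and>
        \<sigma> (k + 1) = next_sigma A \<nu> \<sigma>1 x1 k (x (k + 1)) \<and>
        y (k + 1) = y k + \<sigma> (k + 1) *\<^sub>R gradient (phi \<nu>) (A (x (k + 1))) \<and>
        \<beta> (k + 1) = \<omega> * \<beta> k)"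

end

theory Submission
  imports Defs
begin

text \<open>
  Write \<open>B = \<beta>\<^sub>k / \<beta>\<^sub>1\<close>. The damped dual step sizes make the increments of the
  multipliers summable, so these stay bounded. Assumption (R) then turns approximate stationarity for the
  \<open>k\<close>-th subproblem into \<open>\<parallel>A x\<parallel> powr \<nu> = O(1 / B)\<close>. It is therefore enough to run the method until
  \<open>B\<close> exceeds a constant times \<open>max (1 / eps_phi) (1 / eps_A powr \<nu>)\<close>. The same estimate shows that the
  augmented Lagrangian at the warm start of each subproblem exceeds its minimum by \<open>O(1)\<close> only.
  A proximal step that does not stop decreases it by at least \<open>\<epsilon>\<^sup>2 / (32 \<rho>)\<close>, of order
  \<open>1 / B ^ 3\<close>, whence \<open>O(B ^ 3)\<close> proximal steps.
  Each proximal subproblem is \<open>\<rho>\<close>-strongly convex with a Hoelder continuous gradient, for which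
  the fast gradient method with the \<open>(\<delta>, L)\<close>-inexact oracle of Devolder, Glineur and Nesterov converges linearly, with rate
  \<open>sqrt (\<rho> / L)\<close>, to a gap of order \<open>\<delta> (1 + sqrt (L / \<rho>))\<close>. Balancing \<open>\<delta>\<close> against the function gap
  that the final projected gradient step needs yields the exponent of the inner iterations.
\<close>

text \<open>The obstacle is \<open>\<nu> < 1\<close>: the penalty then has a merely Hoelder
  continuous gradient, so weak convexity and the final step size cannot be read off a Lipschitz
  constant. Weak convexity comes from convexity of \<open>phi \<nu>\<close> instead: freezing the
  multiplier at \<open>x\<close> gives a minorant that touches at \<open>x\<close> and has a
  \<open>\<rho>\<close>-Lipschitz gradient. The last projected step gets its step size from the
  distance it may travel. The parameters \<open>\<delta> k\<close> and \<open>\<gamma> k\<close> are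
  fixed before the run and cannot see the multipliers. Hence the inner analysis speaks only of
  \<open>B\<close> and of an a priori bound \<open>Y\<close> on the multipliers. The required
  accuracies enter only through the last index \<open>K\<close>. Both complexities are one function
  of the final \<open>B\<close>, of exponent 3 (proximal steps) plus \<open>expo_q\<close> (inner
  rate). Since \<open>B\<close> has order \<open>1 / eps_phi\<close> or
  \<open>eps_A powr (- \<nu>)\<close>, the two stated exponents differ by the factor
  \<open>\<nu>\<close>. Nothing is known about an iterate before its solver has been shown to
  return. Termination, boundedness and cost are therefore proved in one induction.\<close>

section \<open>Inequalities for real powers\<close>

lemma powr_Young:
  fixes a b :: real
  assumes "0 \<le> \<alpha>" "0 \<le> \<beta>" "\<alpha> + \<beta> = 1" "0 \<le> a" "0 \<le> b"
  shows "a powr \<alpha> * b powr \<beta> \<le> \<alpha> * a + \<beta> * b"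
proof (cases "a = 0 \<or> b = 0")
  case True
  then show ?thesis using assms by auto
next
  case False
  then show ?thesis using Youngs_inequality_0[of \<alpha> \<beta> a b] assms by simp
qed

text \<open>Young's inequality against the mean \<open>w\<close> is the tangent line of the power at
  \<open>w\<close>, multiplied by \<open>w powr (1 - \<nu>)\<close>. Averaging the two tangent
  estimates gives concavity, with endpoints equal to 0 included.\<close>

lemma powr_concave:
  fixes u v :: real
  assumes "0 \<le> u" "0 \<le> v" "0 \<le> l" "l \<le> 1" "0 < \<nu>" "\<nu> \<le> 1"
  shows "(1 - l) * u powr \<nu> + l * v powr \<nu> \<le> ((1 - l) * u + l * v) powr \<nu>"
proof -
  define w where "w = (1 - l) * u + l * v"
  have nn: "0 \<le> (1 - l) * u" "0 \<le> l * v" using assms by auto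
  show ?thesis
  proof (cases "w = 0")
    case True
    then have "(1 - l) * u = 0" "l * v = 0" using nn unfolding w_def by linarith+
    then have "(1 - l) * u powr \<nu> = 0" "l * v powr \<nu> = 0" by auto
    then have "(1 - l) * u powr \<nu> + l * v powr \<nu> = 0" by linarith
    then show ?thesis by simp
  next
    case False
    then have w: "0 < w" using nn unfolding w_def by linarith
    have "u powr \<nu> * w powr (1 - \<nu>) \<le> \<nu> * u + (1 - \<nu>) * w"
      "v powr \<nu> * w powr (1 - \<nu>) \<le> \<nu> * v + (1 - \<nu>) * w"
      using assms w by (auto intro!: powr_Young)
    then have "(1 - l) * (u powr \<nu> * w powr (1 - \<nu>)) + l * (v powr \<nu> * w powr (1 - \<nu>))
        \<le> (1 - l) * (\<nu> * u + (1 - \<nu>) * w) + l * (\<nu> * v + (1 - \<nu>) * w)"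
      using assms by (intro add_mono mult_left_mono) auto
    also have "\<dots> = w" unfolding w_def by (simp add: algebra_simps)
    also have "\<dots> = w powr \<nu> * w powr (1 - \<nu>)" using w by (simp flip: powr_add)
    finally have "((1 - l) * u powr \<nu> + l * v powr \<nu>) * w powr (1 - \<nu>) \<le> w powr \<nu> * w powr (1 - \<nu>)"
      by (simp add: algebra_simps)
    then show ?thesis using w unfolding w_def by simp
  qed
qed

text \<open>With \<open>l = t / s\<close>, both \<open>l\<close> and \<open>1 - l\<close> lie in the
  unit interval, where the power \<open>\<nu>\<close> does not decrease a number; they add up to
  1.\<close>

lemma powr_subadditive:
  fixes s t :: real
  assumes "0 \<le> t" "t \<le> s" "0 < \<nu>" "\<nu> \<le> 1"
  shows "s powr \<nu> - t powr \<nu> \<le> (s - t) powr \<nu>"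
proof (cases "s = 0")
  case False
  then have s: "0 < s" using assms by simp
  define l where "l = t / s"
  have l: "0 \<le> l" "l \<le> 1" "t = l * s" "s - t = (1 - l) * s"
    using assms s unfolding l_def by (auto simp: field_simps)
  have "l \<le> l powr \<nu>" if "0 \<le> l" "l \<le> 1" for l
    using powr_mono'[of \<nu> 1 l] that assms by simp
  from this[of l] this[of "1 - l"] have "1 \<le> l powr \<nu> + (1 - l) powr \<nu>" using l by simp
  then have "1 * s powr \<nu> \<le> (l powr \<nu> + (1 - l) powr \<nu>) * s powr \<nu>"
    by (intro mult_right_mono) auto
  then show ?thesis using l s unfolding l(4) by (simp add: powr_mult distrib_right)
qed (use assms in auto)

subsection \<open>Gradients\<close>

lemma gradient_eqI:
  assumes "GDERIV F x :> D"
  shows "gradient F x = D"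
  unfolding gradient_def
proof (rule the_equality)
  show "GDERIV F x :> D" by (rule assms)
next
  fix E assume "GDERIV F x :> E"
  then have "(\<lambda>h. inner h E) = (\<lambda>h. inner h D)"
    using assms has_derivative_unique unfolding gderiv_def by blast
  then have "inner (E - D) (E - D) = 0" by (metis inner_diff_right eq_iff_diff_eq_0)
  then show "E = D" by simp
qed

text \<open>\<open>gradient\<close> is a definite description, so a representing vector must be
  produced: the Riesz representative of the derivative, in coordinates.\<close>

lemma GDERIV_gradient:
  fixes f :: "real^'n \<Rightarrow> real"
  assumes "f differentiable (at x)"
  shows "GDERIV f x :> gradient f x"
proof -
  obtain f' where f': "(f has_derivative f') (at x)" using assms unfolding differentiable_def by blast
  interpret linear f' using f' by (rule has_derivative_linear)
  have "f' h = inner h (\<Sum>b\<in>Basis. f' b *\<^sub>R b)" for h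
  proof -
    have "f' h = f' (\<Sum>b\<in>Basis. (h \<bullet> b) *\<^sub>R b)" by (simp add: euclidean_representation)
    also have "\<dots> = inner h (\<Sum>b\<in>Basis. f' b *\<^sub>R b)"
      by (simp add: sum scale inner_sum_right mult.commute)
    finally show ?thesis .
  qed
  then have "f' = (\<lambda>h. inner h (\<Sum>b\<in>Basis. f' b *\<^sub>R b))" by blast
  then have "GDERIV f x :> (\<Sum>b\<in>Basis. f' b *\<^sub>R b)"
    using f' unfolding gderiv_def by simp
  then show ?thesis using gradient_eqI by metis
qed

lemma GDERIV_has_real_derivative_line:
  assumes "GDERIV F (x + t *\<^sub>R d) :> g"
  shows "((\<lambda>t. F (x + t *\<^sub>R d)) has_real_derivative (g \<bullet> d)) (at t)"
proof -
  have "((\<lambda>t. x + t *\<^sub>R d) has_derivative (\<lambda>s. s *\<^sub>R d)) (at t)"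
    by (auto intro!: derivative_eq_intros)
  from has_derivative_compose[OF this, of F "\<lambda>h. h \<bullet> g"] assms
  have "((\<lambda>t. F (x + t *\<^sub>R d)) has_derivative (\<lambda>s. (s *\<^sub>R d) \<bullet> g)) (at t)"
    unfolding gderiv_def by simp
  then show ?thesis
    unfolding has_field_derivative_def
    by (simp add: inner_commute mult.commute[of _ "g \<bullet> d"] fun_eq_iff mult_commute_abs)
qed

lemma Hoelder_descent:
  assumes X: "convex X" "x \<in> X" "w \<in> X" and nu: "0 < \<nu>"
    and G: "\<And>z. z \<in> X \<Longrightarrow> GDERIV F z :> g z"
    and H: "\<And>u v. u \<in> X \<Longrightarrow> v \<in> X \<Longrightarrow> norm (g u - g v) \<le> H * norm (u - v) powr \<nu>"
  shows "F w \<le> F x + g x \<bullet> (w - x) + H / (1 + \<nu>) * norm (w - x) powr (1 + \<nu>)"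
proof -
  define d where "d = w - x"
  \<comment> \<open>The excess of \<open>F\<close> over the claimed bound along the segment; the
    Hoelder condition makes its derivative nonpositive. The open-interval criterion avoids
    differentiating the power at \<open>t = 0\<close>.\<close>
  define h where "h = (\<lambda>t. F (x + t *\<^sub>R d) - t * (g x \<bullet> d) - H / (1 + \<nu>) * norm d powr (1 + \<nu>) * t powr (1 + \<nu>))"
  have in_X: "x + t *\<^sub>R d \<in> X" if "0 \<le> t" "t \<le> 1" for t
  proof -
    have "(1 - t) *\<^sub>R x + t *\<^sub>R w \<in> X" using X that by (intro convexD) auto
    then show ?thesis unfolding d_def by (simp add: algebra_simps)
  qed
  have F: "((\<lambda>t. F (x + t *\<^sub>R d)) has_real_derivative (g (x + t *\<^sub>R d) \<bullet> d)) (at t)"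
    if "0 \<le> t" "t \<le> 1" for t
    using G in_X that by (intro GDERIV_has_real_derivative_line) auto
  have "h 1 \<le> h 0"
  proof (rule DERIV_nonpos_imp_decreasing_open[of 0 1 h])
    show "continuous_on {0..1} h"
    proof -
      have "continuous_on {0..1} (\<lambda>t. F (x + t *\<^sub>R d))"
        using F by (intro continuous_at_imp_continuous_on ballI DERIV_isCont) auto
      moreover have "continuous_on {0..1} (\<lambda>t::real. t powr (1 + \<nu>))"
        using nu by (intro continuous_on_powr') (auto intro!: continuous_intros)
      ultimately show ?thesis
        unfolding h_def by (intro continuous_on_diff continuous_on_mult continuous_on_const continuous_on_id)
    qed
  next
    fix t :: real assume t: "0 < t" "t < 1"
    let ?y = "g (x + t *\<^sub>R d) \<bullet> d - g x \<bullet> d - H / (1 + \<nu>) * norm d powr (1 + \<nu>) * ((1 + \<nu>) * t powr (1 + \<nu> - 1))"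
    have "(h has_real_derivative ?y) (at t)"
      unfolding h_def using F[of t] t by (auto intro!: derivative_eq_intros)
    moreover have "?y \<le> 0"
    proof -
      have "g (x + t *\<^sub>R d) \<bullet> d - g x \<bullet> d \<le> norm (g (x + t *\<^sub>R d) - g x) * norm d"
        using norm_cauchy_schwarz[of "g (x + t *\<^sub>R d) - g x" d] by (simp add: inner_diff_left)
      also have "\<dots> \<le> (H * norm ((x + t *\<^sub>R d) - x) powr \<nu>) * norm d"
        using in_X[of t] t X by (intro mult_right_mono H) auto
      also have "\<dots> = H * norm d powr (1 + \<nu>) * t powr \<nu>"
        using t by (simp add: powr_mult powr_add)
      finally show ?thesis using nu by simp
    qed
    ultimately show "\<exists>y. (h has_real_derivative y) (at t) \<and> y \<le> 0" by blast
  qed simp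
  then show ?thesis unfolding h_def d_def by (simp add: algebra_simps)
qed

subsection \<open>The function \<open>phi\<close>\<close>

text \<open>One formula covers both cases of the gradient of \<open>phi \<nu>\<close>: at
  \<open>z = 0\<close> the scalar factor multiplies the zero vector.\<close>

definition dphi :: "real \<Rightarrow> 'a::real_inner \<Rightarrow> 'a" where
  "dphi \<nu> z = norm z powr (\<nu> - 1) *\<^sub>R z"

lemma dphi_0 [simp]: "dphi \<nu> 0 = 0"
  by (simp add: dphi_def)

lemma norm_dphi: "norm (dphi \<nu> z) = norm z powr \<nu>"
  by (cases "z = 0") (auto simp: dphi_def powr_diff)

lemma GDERIV_phi:
  assumes "0 < \<nu>"
  shows "GDERIV (phi \<nu>) (z::'a::real_inner) :> dphi \<nu> z"
proof (cases "z = 0")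
  case False
  have 1: "GDERIV (norm :: 'a \<Rightarrow> real) z :> sgn z"
    using has_derivative_norm[OF False] by (simp add: gderiv_def)
  have 2: "((\<lambda>r. 1 / (\<nu> + 1) * r powr (\<nu> + 1)) has_real_derivative norm z powr \<nu>) (at (norm z))"
    using False assms by (auto intro!: derivative_eq_intros)
  have "GDERIV (\<lambda>x. 1 / (\<nu> + 1) * norm x powr (\<nu> + 1)) z :> norm z powr \<nu> *\<^sub>R sgn z"
    using GDERIV_DERIV_compose[OF 1 2] .
  moreover have "norm z powr \<nu> *\<^sub>R sgn z = dphi \<nu> z"
    using False by (simp add: dphi_def sgn_div_norm powr_diff divide_inverse)
  moreover have "phi \<nu> = (\<lambda>x::'a. 1 / (\<nu> + 1) * norm x powr (\<nu> + 1))"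
    by (simp add: phi_def fun_eq_iff)
  ultimately show ?thesis by simp
next
  \<comment> \<open>At the origin the norm has no derivative; the difference quotient is a multiple
    of \<open>norm h powr \<nu>\<close>, which tends to 0.\<close>
  case True
  have "(\<lambda>h::'a. phi \<nu> h / norm h) \<midarrow>0\<rightarrow> 0"
  proof -
    have "((\<lambda>h::'a. 1 / (\<nu> + 1) * norm h powr \<nu>) \<longlongrightarrow> 1 / (\<nu> + 1) * norm (0::'a) powr \<nu>) (at 0)"
      using assms by (intro tendsto_intros) auto
    moreover have "phi \<nu> h / norm h = 1 / (\<nu> + 1) * norm h powr \<nu>" for h :: 'a
      by (cases "h = 0") (auto simp: phi_def powr_add)
    ultimately show ?thesis by simp
  qed
  then have "(phi \<nu> has_derivative (\<lambda>h::'a. 0)) (at 0)"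
    unfolding has_derivative_at using assms by (simp add: phi_def)
  then show ?thesis using True by (simp add: gderiv_def dphi_def)
qed

lemma gradient_phi: "0 < \<nu> \<Longrightarrow> gradient (phi \<nu>) z = dphi \<nu> z"
  by (intro gradient_eqI GDERIV_phi)

text \<open>Cauchy-Schwarz reduces the gradient inequality to the scalar one for
  \<open>norm b * norm a powr \<nu>\<close>, which is Young's inequality with exponents
  \<open>\<nu> + 1\<close> and \<open>(\<nu> + 1) / \<nu>\<close>.\<close>

lemma phi_convex:
  assumes "0 < \<nu>"
  shows "phi \<nu> b \<ge> phi \<nu> a + dphi \<nu> a \<bullet> (b - a)"
proof -
  have "(norm b powr (\<nu> + 1)) powr (1 / (\<nu> + 1)) * (norm a powr (\<nu> + 1)) powr (\<nu> / (\<nu> + 1))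
      \<le> 1 / (\<nu> + 1) * norm b powr (\<nu> + 1) + \<nu> / (\<nu> + 1) * norm a powr (\<nu> + 1)"
    using assms by (intro powr_Young) (auto simp: field_simps)
  then have Y: "norm b * norm a powr \<nu>
      \<le> 1 / (\<nu> + 1) * norm b powr (\<nu> + 1) + \<nu> / (\<nu> + 1) * norm a powr (\<nu> + 1)"
    using assms by (simp add: powr_powr)
  have "dphi \<nu> a \<bullet> b \<le> norm b * norm a powr \<nu>"
    using norm_cauchy_schwarz[of "dphi \<nu> a" b] by (simp add: norm_dphi mult.commute)
  moreover have "dphi \<nu> a \<bullet> a = norm a powr (\<nu> + 1)"
    by (cases "a = 0") (auto simp: dphi_def dot_square_norm powr_diff powr_add power2_eq_square)
  moreover have "norm a powr (\<nu> + 1) = 1 / (\<nu> + 1) * norm a powr (\<nu> + 1) + \<nu> / (\<nu> + 1) * norm a powr (\<nu> + 1)"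
  proof -
    have "1 / (\<nu> + 1) + \<nu> / (\<nu> + 1) = 1" using assms by (simp add: field_simps)
    then show ?thesis by (metis distrib_right mult_1)
  qed
  ultimately show ?thesis using Y unfolding phi_def inner_diff_right by linarith
qed

lemma norm_diff_squared:
  fixes a b :: "'a::real_inner"
  shows "(norm (a - b))\<^sup>2 = (norm a)\<^sup>2 - 2 * (a \<bullet> b) + (norm b)\<^sup>2"
  unfolding power2_norm_eq_inner inner_diff_left inner_diff_right inner_commute[of b a] by simp

lemma square_powr:
  fixes x :: real
  assumes "0 \<le> x"
  shows "(x\<^sup>2) powr \<nu> = (x powr \<nu>)\<^sup>2"
  using assms by (simp add: power2_eq_square powr_mult)

text \<open>The constant is attained at \<open>b = - a\<close>; it is the factor
  \<open>2 powr (1 - \<nu>)\<close> of \<open>H_beta\<close>.\<close>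

lemma dphi_Hoelder:
  fixes a b :: "'a::real_inner"
  assumes nu: "0 < \<nu>" "\<nu> \<le> 1"
  shows "norm (dphi \<nu> a - dphi \<nu> b) \<le> 2 powr (1 - \<nu>) * norm (a - b) powr \<nu>"
proof -
  have main: "norm (dphi \<nu> a - dphi \<nu> b) \<le> 2 powr (1 - \<nu>) * norm (a - b) powr \<nu>"
    if st: "norm b \<le> norm a" and b0: "b \<noteq> 0" for a b :: 'a
  proof -
    define s t where "s = norm a" and "t = norm b"
    have s: "0 < t" "t \<le> s" "0 < s" using st b0 unfolding s_def t_def by (auto simp: order.strict_trans2)
    then have a0: "a \<noteq> 0" unfolding s_def by auto
    define c where "c = (a \<bullet> b) / (s * t)"
    have ab: "a \<bullet> b = s * t * c" using s unfolding c_def by simp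
    have "\<bar>a \<bullet> b\<bar> \<le> s * t" unfolding s_def t_def by (rule Cauchy_Schwarz_ineq2)
    then have c: "-1 \<le> c" "c \<le> 1" using s unfolding c_def by (auto simp: field_simps abs_le_iff)
    \<comment> \<open>For fixed norms the squared left-hand side is affine in the cosine \<open>c\<close> and the squared right-hand
      side is concave in it, so the claim reduces to the endpoints \<open>c = 1\<close> and \<open>c = - 1\<close>.\<close>
    define l where "l = (1 - c) / 2"
    have l: "0 \<le> l" "l \<le> 1" "c = 1 - 2 * l" using c unfolding l_def by (auto simp: field_simps)
    have n1: "(norm (a - b))\<^sup>2 = (1 - l) * (s - t)\<^sup>2 + l * (s + t)\<^sup>2"
      unfolding norm_diff_squared ab l(3) s_def[symmetric] t_def[symmetric]
      by (simp add: power2_eq_square algebra_simps)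
    have dab: "dphi \<nu> a \<bullet> dphi \<nu> b = s powr \<nu> * t powr \<nu> * c"
      using s by (simp add: dphi_def ab powr_diff flip: s_def t_def)
    have n2: "(norm (dphi \<nu> a - dphi \<nu> b))\<^sup>2 = (1 - l) * (s powr \<nu> - t powr \<nu>)\<^sup>2 + l * (s powr \<nu> + t powr \<nu>)\<^sup>2"
      unfolding norm_diff_squared dab l(3) norm_dphi s_def[symmetric] t_def[symmetric]
      by (simp add: power2_eq_square algebra_simps)
    define C where "C = (2::real) powr (1 - \<nu>)"
    have C: "1 \<le> C" unfolding C_def using nu by (simp add: ge_one_powr_ge_zero)
    \<comment> \<open>Endpoint \<open>c = 1\<close> (parallel vectors): subadditivity.\<close>
    have "s powr \<nu> - t powr \<nu> \<le> (s - t) powr \<nu>" using s nu by (intro powr_subadditive) auto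
    also have "\<dots> \<le> C * (s - t) powr \<nu>" using C by (simp add: mult_le_cancel_right1)
    finally have "(s powr \<nu> - t powr \<nu>)\<^sup>2 \<le> (C * (s - t) powr \<nu>)\<^sup>2"
      using s nu by (intro power_mono) (auto intro!: powr_mono2)
    then have e1: "(s powr \<nu> - t powr \<nu>)\<^sup>2 \<le> C\<^sup>2 * ((s - t)\<^sup>2) powr \<nu>"
      using s by (simp add: power_mult_distrib square_powr)
    \<comment> \<open>Endpoint \<open>c = - 1\<close> (opposite vectors): concavity at the midpoint,
      which is where the constant \<open>C\<close> arises.\<close>
    have "(1 - 1/2) * s powr \<nu> + 1/2 * t powr \<nu> \<le> ((1 - 1/2) * s + 1/2 * t) powr \<nu>"
      using s nu by (intro powr_concave) auto
    also have "\<dots> = (s + t) powr \<nu> / 2 powr \<nu>"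
      using s powr_divide[of "s + t" 2 \<nu>] by (simp add: add_divide_distrib)
    finally have "s powr \<nu> + t powr \<nu> \<le> C * (s + t) powr \<nu>"
      unfolding C_def by (simp add: powr_diff field_simps)
    then have "(s powr \<nu> + t powr \<nu>)\<^sup>2 \<le> (C * (s + t) powr \<nu>)\<^sup>2"
      by (intro power_mono) auto
    then have e2: "(s powr \<nu> + t powr \<nu>)\<^sup>2 \<le> C\<^sup>2 * ((s + t)\<^sup>2) powr \<nu>"
      using s by (simp add: power_mult_distrib square_powr)
    have "(norm (dphi \<nu> a - dphi \<nu> b))\<^sup>2 \<le> (1 - l) * (C\<^sup>2 * ((s - t)\<^sup>2) powr \<nu>) + l * (C\<^sup>2 * ((s + t)\<^sup>2) powr \<nu>)"
      unfolding n2 using l e1 e2 by (intro add_mono mult_left_mono) auto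
    also have "\<dots> = C\<^sup>2 * ((1 - l) * ((s - t)\<^sup>2) powr \<nu> + l * ((s + t)\<^sup>2) powr \<nu>)"
      by (simp add: algebra_simps)
    also have "\<dots> \<le> C\<^sup>2 * ((1 - l) * (s - t)\<^sup>2 + l * (s + t)\<^sup>2) powr \<nu>"
      using l nu by (intro mult_left_mono powr_concave) auto
    also have "\<dots> = (C * norm (a - b) powr \<nu>)\<^sup>2"
      unfolding n1[symmetric]
      by (simp add: power_mult_distrib square_powr)
    finally show ?thesis unfolding C_def by (rule power2_le_imp_le) simp
  qed
  have C: "1 \<le> (2::real) powr (1 - \<nu>)" using nu by (simp add: ge_one_powr_ge_zero)
  consider "a = 0" | "b = 0" | "a \<noteq> 0" "b \<noteq> 0" by blast
  then show ?thesis
  proof cases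
    case 1
    then show ?thesis using C by (simp add: norm_dphi mult_le_cancel_right1)
  next
    case 2
    then show ?thesis using C by (simp add: norm_dphi mult_le_cancel_right1)
  next
    case 3
    then show ?thesis
      using main[of a b] main[of b a] by (cases "norm b \<le> norm a") (auto simp: norm_minus_commute)
  qed
qed

subsection \<open>The fast gradient method with an inexact oracle\<close>

lemma fgm_L_pos:
  assumes "0 < \<nu>" "\<nu> \<le> 1" "0 < H" "0 < \<delta>"
  shows "0 < fgm_L \<nu> H \<delta>"
  using assms by (auto simp: fgm_L_def)

text \<open>Weighted Young with weights \<open>(1 + \<nu>) / 2\<close> and
  \<open>(1 - \<nu>) / 2\<close> on \<open>a\<close> and \<open>b\<close>. The value of
  \<open>fgm_L\<close> is the one for which the weighted geometric mean is exactly the Hoelder term.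
  This turns Hoelder smoothness into the upper bound of an inexact oracle.\<close>

lemma Hoelder_le_quadratic:
  assumes nu: "0 < \<nu>" "\<nu> \<le> 1" and "0 < H" "0 < \<delta>" "0 \<le> r"
  shows "H / (1 + \<nu>) * r powr (1 + \<nu>) \<le> fgm_L \<nu> H \<delta> / 2 * r\<^sup>2 + \<delta>"
proof (cases "\<nu> = 1")
  case True
  then show ?thesis using assms by (simp add: fgm_L_def)
next
  case False
  with nu have nu1: "\<nu> < 1" by simp
  define c where "c = H / (2 * \<delta>) * ((1 - \<nu>) / (1 + \<nu>))"
  have c: "0 < c" using assms nu1 unfolding c_def by simp
  define L where "L = fgm_L \<nu> H \<delta>"
  have L: "L = H * c powr ((1 - \<nu>) / (1 + \<nu>))" using False by (simp add: L_def fgm_L_def c_def)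
  have L0: "0 < L" using L c assms by simp
  define a b where "a = L * r\<^sup>2 / (1 + \<nu>)" and "b = 2 * \<delta> / (1 - \<nu>)"
  have "a powr ((1 + \<nu>) / 2) * b powr ((1 - \<nu>) / 2) \<le> (1 + \<nu>) / 2 * a + (1 - \<nu>) / 2 * b"
    using assms nu1 L0 unfolding a_def b_def by (intro powr_Young) (auto simp: field_simps)
  also have "\<dots> = L / 2 * r\<^sup>2 + \<delta>"
  proof -
    have "(1 + \<nu>) / 2 * a = L / 2 * r\<^sup>2" "(1 - \<nu>) / 2 * b = \<delta>"
      using nu nu1 unfolding a_def b_def by (auto simp: field_simps)
    then show ?thesis by simp
  qed
  also have "a powr ((1 + \<nu>) / 2) * b powr ((1 - \<nu>) / 2) = H / (1 + \<nu>) * r powr (1 + \<nu>)"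
  proof -
    have "L powr ((1 + \<nu>) / 2) = H powr ((1 + \<nu>) / 2) * c powr ((1 - \<nu>) / 2)"
      using c assms unfolding L by (simp add: powr_mult powr_powr)
    moreover have "(r\<^sup>2) powr ((1 + \<nu>) / 2) = r powr (1 + \<nu>)"
      using \<open>0 \<le> r\<close> by (simp add: power2_eq_square powr_mult flip: powr_add)
    ultimately have "a powr ((1 + \<nu>) / 2)
        = H powr ((1 + \<nu>) / 2) * c powr ((1 - \<nu>) / 2) * r powr (1 + \<nu>) / (1 + \<nu>) powr ((1 + \<nu>) / 2)"
      using assms L0 unfolding a_def by (simp add: powr_mult powr_divide)
    moreover have "c powr ((1 - \<nu>) / 2) * b powr ((1 - \<nu>) / 2) = (H / (1 + \<nu>)) powr ((1 - \<nu>) / 2)"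
    proof -
      have "c * b = H / (1 + \<nu>)" using assms nu1 unfolding c_def b_def by (simp add: divide_simps)
      then show ?thesis using c assms nu1 unfolding b_def by (simp flip: powr_mult)
    qed
    ultimately have "a powr ((1 + \<nu>) / 2) * b powr ((1 - \<nu>) / 2)
      = H powr ((1 + \<nu>) / 2) / (1 + \<nu>) powr ((1 + \<nu>) / 2) * (H / (1 + \<nu>)) powr ((1 - \<nu>) / 2) * r powr (1 + \<nu>)"
      by (simp add: algebra_simps)
    also have "H powr ((1 + \<nu>) / 2) / (1 + \<nu>) powr ((1 + \<nu>) / 2) * (H / (1 + \<nu>)) powr ((1 - \<nu>) / 2)
        = (H / (1 + \<nu>)) powr ((1 + \<nu>) / 2 + (1 - \<nu>) / 2)"
      using assms by (simp add: powr_add powr_divide)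
    also have "(1 + \<nu>) / 2 + (1 - \<nu>) / 2 = 1" by (simp add: field_simps)
    finally show ?thesis using assms by simp
  qed
  finally show ?thesis unfolding L_def .
qed

section \<open>Minimisers over compact convex sets\<close>

lemma arg_min_on_compact:
  fixes X :: "'a::topological_space set" and h :: "'a \<Rightarrow> real"
  assumes "compact X" "X \<noteq> {}" "continuous_on X h"
  shows "arg_min h (\<lambda>x. x \<in> X) \<in> X" "\<And>x. x \<in> X \<Longrightarrow> h (arg_min h (\<lambda>x. x \<in> X)) \<le> h x"
proof -
  obtain z where z: "z \<in> X" "\<forall>x\<in>X. h z \<le> h x"
    using continuous_attains_inf[OF assms] by blast
  have "arg_min h (\<lambda>x. x \<in> X) \<in> X \<and> (\<forall>x\<in>X. h (arg_min h (\<lambda>x. x \<in> X)) \<le> h x)"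
    by (rule arg_minI[where x=z]) (use z in \<open>auto simp: not_less\<close>)
  then show "arg_min h (\<lambda>x. x \<in> X) \<in> X" "\<And>x. x \<in> X \<Longrightarrow> h (arg_min h (\<lambda>x. x \<in> X)) \<le> h x" by auto
qed

text \<open>An affine function plus \<open>c / 2\<close> times the squared norm. The encoding by an
  identity on lines lets curvatures add up under sums and needs no derivatives.\<close>

definition isotropic_quadratic :: "real \<Rightarrow> ('a::real_inner \<Rightarrow> real) \<Rightarrow> bool" where
  "isotropic_quadratic c h \<longleftrightarrow>
     (\<forall>x y t. h ((1 - t) *\<^sub>R x + t *\<^sub>R y) = (1 - t) * h x + t * h y - c / 2 * (t * (1 - t)) * (norm (x - y))\<^sup>2)"

lemma isotropic_quadratic_norm: "isotropic_quadratic c (\<lambda>x. c / 2 * (norm (x - p))\<^sup>2)"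
proof -
  have "(norm (((1 - t) *\<^sub>R x + t *\<^sub>R y) - p))\<^sup>2
      = (1 - t) * (norm (x - p))\<^sup>2 + t * (norm (y - p))\<^sup>2 - (t * (1 - t)) * (norm (x - y))\<^sup>2" for x y t
    unfolding power2_norm_eq_inner
    by (simp add: inner_commute algebra_simps)
  note eq = this
  show ?thesis
    unfolding isotropic_quadratic_def eq by (simp add: algebra_simps add_divide_distrib diff_divide_distrib)
qed

lemma isotropic_quadratic_linear: "isotropic_quadratic 0 (\<lambda>x. g \<bullet> (x - p))"
  unfolding isotropic_quadratic_def by (simp add: inner_simps algebra_simps)

lemma isotropic_quadratic_add:
  assumes "isotropic_quadratic c h" "isotropic_quadratic d k"
  shows "isotropic_quadratic (c + d) (\<lambda>x. h x + k x)"
  unfolding isotropic_quadratic_def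
proof (intro allI)
  fix x y t
  show "h ((1 - t) *\<^sub>R x + t *\<^sub>R y) + k ((1 - t) *\<^sub>R x + t *\<^sub>R y) =
    (1 - t) * (h x + k x) + t * (h y + k y) - (c + d) / 2 * (t * (1 - t)) * (norm (x - y))\<^sup>2"
    unfolding assms[unfolded isotropic_quadratic_def, rule_format]
    by (simp add: algebra_simps add_divide_distrib)
qed

lemma isotropic_quadratic_cmult:
  assumes "isotropic_quadratic c h"
  shows "isotropic_quadratic (s * c) (\<lambda>x. s * h x)"
  unfolding isotropic_quadratic_def
proof (intro allI)
  fix x y t
  show "s * h ((1 - t) *\<^sub>R x + t *\<^sub>R y) =
    (1 - t) * (s * h x) + t * (s * h y) - s * c / 2 * (t * (1 - t)) * (norm (x - y))\<^sup>2"
    unfolding assms[unfolded isotropic_quadratic_def, rule_format]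
    by (simp add: algebra_simps)
qed

lemma isotropic_quadratic_sum:
  "(\<And>i. i \<in> I \<Longrightarrow> isotropic_quadratic (c i) (h i)) \<Longrightarrow> isotropic_quadratic (\<Sum>i\<in>I. c i) (\<lambda>x. \<Sum>i\<in>I. h i x)"
proof (induction I rule: infinite_finite_induct)
  case (insert i I)
  then show ?case using isotropic_quadratic_add[of "c i" "h i" "\<Sum>i\<in>I. c i" "\<lambda>x. \<Sum>i\<in>I. h i x"] by simp
qed (simp_all add: isotropic_quadratic_def)

text \<open>Comparing \<open>z\<close> with a point a fraction \<open>t\<close> of the way to
  \<open>x\<close> and dividing by \<open>t\<close> gives the claim with \<open>1 - t\<close> in
  front of the quadratic term; then \<open>t\<close> tends to 0.\<close>

lemma isotropic_quadratic_minimum: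
  assumes h: "isotropic_quadratic c h" and X: "convex X" "z \<in> X" "x \<in> X"
    and min: "\<And>u. u \<in> X \<Longrightarrow> h z \<le> h u"
  shows "h z + c / 2 * (norm (x - z))\<^sup>2 \<le> h x"
proof -
  define d where "d = c / 2 * (norm (x - z))\<^sup>2"
  have "h z + d * (1 - t) \<le> h x" if t: "0 < t" "t < 1" for t
  proof -
    have "(1 - t) *\<^sub>R z + t *\<^sub>R x \<in> X" using X t by (intro convexD) auto
    from min[OF this] have "h z \<le> (1 - t) * h z + t * h x - t * (1 - t) * d"
      unfolding h[unfolded isotropic_quadratic_def, rule_format] d_def
      by (simp add: norm_minus_commute mult.assoc mult.left_commute)
    then have "t * (h z + d * (1 - t)) \<le> t * h x" by (simp add: algebra_simps)
    then show ?thesis using t by simp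
  qed
  then have "eventually (\<lambda>t. h z + d * (1 - t) \<le> h x) (at_right 0)"
    by (auto simp: eventually_at_right_field intro!: exI[of _ 1])
  moreover have "((\<lambda>t. h z + d * (1 - t)) \<longlongrightarrow> h z + d * (1 - 0)) (at_right 0)"
    by (intro tendsto_intros)
  ultimately have "h z + d * (1 - 0) \<le> h x"
    by (intro tendsto_upperbound) auto
  then show ?thesis unfolding d_def by simp
qed

lemma gradient_step_min:
  fixes X :: "'a::real_inner set"
  assumes "compact X" "X \<noteq> {}"
  shows "gradient_step X F L v \<in> X"
    "\<And>x. x \<in> X \<Longrightarrow> gradient F v \<bullet> (gradient_step X F L v - v) + L / 2 * (norm (gradient_step X F L v - v))\<^sup>2
       \<le> gradient F v \<bullet> (x - v) + L / 2 * (norm (x - v))\<^sup>2"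
proof -
  have c: "continuous_on X (\<lambda>x. gradient F v \<bullet> (x - v) + L / 2 * (norm (x - v))\<^sup>2)"
    by (intro continuous_intros)
  note arg_min_on_compact[OF assms c]
  then show "gradient_step X F L v \<in> X"
    "\<And>x. x \<in> X \<Longrightarrow> gradient F v \<bullet> (gradient_step X F L v - v) + L / 2 * (norm (gradient_step X F L v - v))\<^sup>2
       \<le> gradient F v \<bullet> (x - v) + L / 2 * (norm (x - v))\<^sup>2"
    unfolding gradient_step_def by auto
qed

text \<open>Legitimises the \<open>THE\<close> in \<open>fgm_alpha\<close>. Clearing the denominator
  leaves a quadratic whose roots have the negative product \<open>- c * S / L\<close>, so exactly
  one root is positive.\<close>

lemma fgm_weight_equation:
  fixes L S \<mu> :: real
  assumes "0 < L" "0 < S" "0 \<le> \<mu>"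
  shows "\<exists>!a. 0 < a \<and> L + \<mu> * S = L * a\<^sup>2 / (S + a)"
proof -
  define c where "c = L + \<mu> * S"
  have c: "0 < c" using assms unfolding c_def by (simp add: add_pos_nonneg)
  have eq: "L + \<mu> * S = L * a\<^sup>2 / (S + a) \<longleftrightarrow> c * S = a * (L * a - c)" if "0 < a" for a
    using assms that unfolding c_def[symmetric] by (auto simp: field_simps power2_eq_square)
  define r where "r = sqrt (c\<^sup>2 + 4 * L * c * S)"
  have r: "r\<^sup>2 = c\<^sup>2 + 4 * L * c * S" using assms c unfolding r_def by simp
  have "0 \<le> r" using assms c unfolding r_def by simp
  define a where "a = (c + r) / (2 * L)"
  have a: "0 < a" using assms c \<open>0 \<le> r\<close> unfolding a_def by simp
  have "2 * L * a = c + r" using assms unfolding a_def by simp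
  then have "(2 * L * a - c)\<^sup>2 = c\<^sup>2 + 4 * L * c * S" using r by simp
  then have "4 * L * (a * (L * a - c)) = 4 * L * (c * S)" by (simp add: power2_eq_square algebra_simps)
  then have ex: "c * S = a * (L * a - c)" using assms by simp
  have un: "b = a" if b: "0 < b" "c * S = b * (L * b - c)" for b
  proof (rule ccontr)
    assume "b \<noteq> a"
    have "(b - a) * (L * (a + b) - c) = 0" using b ex by (simp add: algebra_simps)
    then have "L * (a + b) = c" using \<open>b \<noteq> a\<close> by simp
    then have "L * a - c = - (L * b)" by (simp add: algebra_simps)
    then have "c * S = - (a * (L * b))" using ex by simp
    moreover have "0 < c * S" "0 < a * (L * b)" using c a b(1) assms by simp_all
    ultimately show False by linarith
  qed
  show ?thesis using a ex un eq by metis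
qed

section \<open>The estimate sequence of the fast gradient method\<close>

declare fgm_alpha.simps(2) [simp del] fgm_x.simps(2) [simp del]

text \<open>Values and gradients of \<open>F\<close> are exact; the error \<open>\<delta>\<close>
  sits only in the upper model, which is the form that Hoelder smoothness provides.\<close>

locale fgm_inexact_oracle =
  fixes X :: "'a::euclidean_space set" and F :: "'a \<Rightarrow> real" and L \<mu> \<delta> :: real and x0 :: 'a
  assumes X: "convex X" "compact X" and x0: "x0 \<in> X"
    and pos: "0 < L" "0 < \<mu>" "0 \<le> \<delta>"
    and lower: "\<And>x w. x \<in> X \<Longrightarrow> w \<in> X \<Longrightarrow>
      F x + gradient F x \<bullet> (w - x) + \<mu> / 2 * (norm (w - x))\<^sup>2 \<le> F w"
    and upper: "\<And>x w. x \<in> X \<Longrightarrow> w \<in> X \<Longrightarrow>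
      F w \<le> F x + gradient F x \<bullet> (w - x) + L / 2 * (norm (w - x))\<^sup>2 + \<delta>"
begin

abbreviation "weight \<equiv> fgm_alpha L \<mu>"
abbreviation "iterate \<equiv> fgm_x X F L \<mu> x0"
abbreviation "descent \<equiv> fgm_y X F L \<mu> x0"

definition "S k = (\<Sum>i\<le>k. weight i)"

text \<open>The objective that defines \<open>z\<close> in the algorithm. The constants
  \<open>weight i * F (iterate i)\<close> are left out here and reappear beside it in the
  estimates.\<close>

definition "model k x = L / 2 * (norm (x - x0))\<^sup>2 +
  (\<Sum>i\<le>k. weight i * (gradient F (iterate i) \<bullet> (x - iterate i) + \<mu> / 2 * (norm (x - iterate i))\<^sup>2))"

definition "center k = arg_min (model k) (\<lambda>x. x \<in> X)"

lemma X_nonempty: "X \<noteq> {}" using x0 by auto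

lemma weight_pos: "0 < weight k" and S_pos: "0 < S k"
proof (induction k)
  case 0
  { case 1 then show ?case by simp next case 2 then show ?case by (simp add: S_def) }
next
  case (Suc k)
  have "0 < weight (Suc k)"
    using theI'[OF fgm_weight_equation[of L "S k" \<mu>]] Suc pos by (simp add: S_def fgm_alpha.simps(2))
  { case 1 then show ?case by fact next case 2 then show ?case using \<open>0 < weight (Suc k)\<close> Suc by (simp add: S_def) }
qed

lemma S_Suc: "S (Suc k) = S k + weight (Suc k)"
  by (simp add: S_def)

lemma weight_Suc: "(L + \<mu> * S k) * S (Suc k) = L * (weight (Suc k))\<^sup>2"
proof -
  have "L + \<mu> * S k = L * (weight (Suc k))\<^sup>2 / (S k + weight (Suc k))"
    using theI'[OF fgm_weight_equation[of L "S k" \<mu>]] S_pos pos by (simp add: S_def fgm_alpha.simps(2))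
  then show ?thesis using S_pos[of "Suc k"] by (simp add: S_Suc divide_simps)
qed

lemma center_min: "center k \<in> X" "\<And>x. x \<in> X \<Longrightarrow> model k (center k) \<le> model k x"
proof -
  have "continuous_on X (model k)" unfolding model_def by (intro continuous_intros)
  from arg_min_on_compact[OF X(2) X_nonempty this]
  show "center k \<in> X" "\<And>x. x \<in> X \<Longrightarrow> model k (center k) \<le> model k x"
    unfolding center_def by auto
qed

lemma center_strong_min:
  assumes "x \<in> X"
  shows "model k (center k) + (L + \<mu> * S k) / 2 * (norm (x - center k))\<^sup>2 \<le> model k x"
proof -
  have "isotropic_quadratic (L + (\<Sum>i\<le>k. weight i * (0 + \<mu>))) (model k)"
    unfolding model_def
    by (intro isotropic_quadratic_add isotropic_quadratic_sum isotropic_quadratic_cmult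
        isotropic_quadratic_norm isotropic_quadratic_linear)
  moreover have "L + (\<Sum>i\<le>k. weight i * (0 + \<mu>)) = L + \<mu> * S k"
    by (simp add: S_def sum_distrib_left mult.commute)
  ultimately show ?thesis
    using isotropic_quadratic_minimum[of "L + \<mu> * S k" "model k", OF _ X(1) center_min(1) assms center_min(2)]
    by simp
qed

lemma descent_eq: "descent k = gradient_step X F L (iterate k)"
  by (simp add: fgm_y_def)

lemma iterate_Suc:
  "iterate (Suc k) = (weight (Suc k) / S (Suc k)) *\<^sub>R center k + (1 - weight (Suc k) / S (Suc k)) *\<^sub>R descent k"
  unfolding descent_eq center_def model_def S_def
  by (simp add: Let_def fgm_x.simps(2))

lemma descent_in: "descent k \<in> X"
  unfolding descent_eq using gradient_step_min(1)[OF X(2) X_nonempty] .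

lemma step_ratio: "0 \<le> weight (Suc k) / S (Suc k)" "weight (Suc k) / S (Suc k) \<le> 1"
  using weight_pos[of "Suc k"] S_pos[of "Suc k"] S_pos[of k] by (auto simp: S_Suc)

lemma iterate_in: "iterate k \<in> X"
proof (cases k)
  case (Suc j)
  then show ?thesis
    unfolding Suc iterate_Suc using X(1) center_min(1) descent_in step_ratio by (intro convexD) auto
qed (use x0 in simp)

lemma descent_le:
  assumes "x \<in> X"
  shows "F (descent k) \<le> F (iterate k) + gradient F (iterate k) \<bullet> (x - iterate k) + L / 2 * (norm (x - iterate k))\<^sup>2 + \<delta>"
  using upper[OF iterate_in descent_in, of k k] gradient_step_min(2)[OF X(2) X_nonempty assms, of F "iterate k" L]
  unfolding descent_eq by linarith

text \<open>\<open>x\<close> stays arbitrary in the induction because the hypothesis is applied at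
  \<open>center k\<close>, the minimiser of the model. Each step adds the oracle error with weight
  \<open>S (Suc k)\<close>.\<close>

lemma estimate_sequence:
  assumes "x \<in> X"
  shows "S k * F (descent k) \<le> model k x + (\<Sum>i\<le>k. weight i * F (iterate i)) + \<delta> * (\<Sum>i\<le>k. S i)"
  using assms
proof (induction k arbitrary: x)
  case 0
  have "0 \<le> \<mu> / 2 * (norm (x - x0))\<^sup>2" using pos by simp
  with descent_le[OF 0, of 0] show ?case by (simp add: S_def model_def)
next
  case (Suc k)
  define a where "a = weight (Suc k)"
  define u where "u = iterate (Suc k)"
  define \<tau> where "\<tau> = a / S (Suc k)"
  define l where "l = (\<lambda>x. F u + gradient F u \<bullet> (x - u))"
  have a0: "0 < a" and S0: "0 < S (Suc k)" unfolding a_def using weight_pos S_pos by auto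
  have \<tau>: "0 \<le> \<tau>" "\<tau> \<le> 1" "S (Suc k) * \<tau> = a" "S (Suc k) * (1 - \<tau>) = S k"
    using step_ratio[of k] S0 unfolding \<tau>_def a_def by (auto simp: right_diff_distrib S_Suc)
  have u: "u \<in> X" unfolding u_def by (rule iterate_in)
  have u_eq: "u = \<tau> *\<^sub>R center k + (1 - \<tau>) *\<^sub>R descent k"
    unfolding u_def \<tau>_def a_def by (rule iterate_Suc)
  \<comment> \<open>The comparison point for the gradient step: \<open>iterate (Suc k)\<close> with
    \<open>center k\<close> replaced by \<open>x\<close>.\<close>
  define p where "p = \<tau> *\<^sub>R x + (1 - \<tau>) *\<^sub>R descent k"
  have p: "p \<in> X" unfolding p_def using X(1) Suc.prems descent_in \<tau> by (intro convexD) auto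
  have pu: "p - u = \<tau> *\<^sub>R (x - center k)" unfolding p_def u_eq by (simp add: algebra_simps)
  have lp: "S k * l (descent k) + a * l x = S (Suc k) * l p"
  proof -
    have "l p = \<tau> * l x + (1 - \<tau>) * l (descent k)"
      unfolding l_def p_def by (simp add: inner_simps algebra_simps)
    then have "S (Suc k) * l p = (S (Suc k) * \<tau>) * l x + (S (Suc k) * (1 - \<tau>)) * l (descent k)"
      by (simp only: distrib_left mult.assoc)
    then show ?thesis unfolding \<tau> by simp
  qed
  \<comment> \<open>The weight recursion is designed for this identity: the curvature of the model
    matches the quadratic term of the gradient step.\<close>
  have Lc: "(L + \<mu> * S k) / 2 * (norm (x - center k))\<^sup>2 = S (Suc k) * (L / 2 * (norm (p - u))\<^sup>2)"
  proof -
    have "(L + \<mu> * S k) * S (Suc k) = (L * \<tau>\<^sup>2 * S (Suc k)) * S (Suc k)"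
      unfolding weight_Suc a_def[symmetric] \<tau>(3)[symmetric] by (simp add: power2_eq_square)
    then have "L + \<mu> * S k = L * \<tau>\<^sup>2 * S (Suc k)" using S0 by simp
    then show ?thesis unfolding pu by (simp add: power_mult_distrib)
  qed
  have low: "l (descent k) \<le> F (descent k)"
  proof -
    have "0 \<le> \<mu> / 2 * (norm (descent k - u))\<^sup>2" using pos by simp
    then show ?thesis using lower[OF u descent_in, of k] unfolding l_def by linarith
  qed
  have mu: "0 \<le> a * (\<mu> / 2 * (norm (x - u))\<^sup>2)" using a0 pos by simp
  have model_Suc: "model (Suc k) x = model k x + a * (gradient F u \<bullet> (x - u)) + a * (\<mu> / 2 * (norm (x - u))\<^sup>2)"
    unfolding model_def a_def u_def by (simp add: algebra_simps)
  have "S (Suc k) * F (descent (Suc k)) \<le> S (Suc k) * (l p + L / 2 * (norm (p - u))\<^sup>2 + \<delta>)"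
    using descent_le[OF p, of "Suc k"] S0 unfolding l_def u_def by (intro mult_left_mono) auto
  also have "\<dots> = S k * l (descent k) + a * l x + (L + \<mu> * S k) / 2 * (norm (x - center k))\<^sup>2 + \<delta> * S (Suc k)"
    unfolding Lc lp by (simp add: algebra_simps)
  also have "\<dots> \<le> S k * F (descent k) + a * l x + (L + \<mu> * S k) / 2 * (norm (x - center k))\<^sup>2 + \<delta> * S (Suc k)"
    using low S_pos[of k] by (auto intro!: mult_left_mono)
  \<comment> \<open>The growth of the model away from its minimiser pays for the quadratic
    term.\<close>
  also have "\<dots> \<le> model k x + (\<Sum>i\<le>k. weight i * F (iterate i)) + \<delta> * (\<Sum>i\<le>k. S i) + a * l x + \<delta> * S (Suc k)"
    using Suc.IH[OF center_min(1)[of k]] center_strong_min[OF Suc.prems, of k] by linarith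
  also have "\<dots> \<le> model (Suc k) x + (\<Sum>i\<le>Suc k. weight i * F (iterate i)) + \<delta> * (\<Sum>i\<le>Suc k. S i)"
    using mu unfolding model_Suc l_def by (simp add: algebra_simps flip: a_def u_def)
  finally show ?case .
qed

lemma model_le:
  assumes "x \<in> X"
  shows "model k x + (\<Sum>i\<le>k. weight i * F (iterate i)) \<le> L / 2 * (norm (x - x0))\<^sup>2 + S k * F x"
proof -
  have "model k x + (\<Sum>i\<le>k. weight i * F (iterate i)) = L / 2 * (norm (x - x0))\<^sup>2 +
     (\<Sum>i\<le>k. weight i * (F (iterate i) + gradient F (iterate i) \<bullet> (x - iterate i) + \<mu> / 2 * (norm (x - iterate i))\<^sup>2))"
    unfolding model_def add.assoc sum.distrib[symmetric] distrib_left[symmetric]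
    by (simp add: add_ac)
  also have "\<dots> \<le> L / 2 * (norm (x - x0))\<^sup>2 + (\<Sum>i\<le>k. weight i * F x)"
    using lower[OF iterate_in assms] weight_pos by (intro add_left_mono sum_mono mult_left_mono) (auto intro: less_imp_le)
  finally show ?thesis by (simp add: S_def sum_distrib_right)
qed

definition "q = sqrt (\<mu> / L)"

lemma q: "0 < q" "L * q\<^sup>2 = \<mu>"
  using pos by (auto simp: q_def)

text \<open>The weight recursion bounds \<open>L\<close> times the squared new weight below by
  \<open>\<mu> * S k * S k\<close>, so the new weight is at least \<open>q * S k\<close>.\<close>

lemma S_growth: "(1 + q) * S k \<le> S (Suc k)"
proof -
  have "(q * S k)\<^sup>2 \<le> (weight (Suc k))\<^sup>2"
  proof -
    have "L * (q * S k)\<^sup>2 = (L * q\<^sup>2) * S k * S k" by (simp add: power2_eq_square)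
    also have "\<dots> = \<mu> * S k * S k" by (simp only: q(2))
    also have "\<dots> \<le> (L + \<mu> * S k) * S (Suc k)"
    proof (rule mult_mono)
      show "S k \<le> S (Suc k)" using weight_pos[of "Suc k"] by (simp only: S_Suc)
      show "0 \<le> L + \<mu> * S k" using S_pos[of k] pos by (intro add_nonneg_nonneg mult_nonneg_nonneg) linarith+
    qed (use S_pos[of k] pos in linarith)+
    also have "\<dots> = L * (weight (Suc k))\<^sup>2" by (rule weight_Suc)
    finally show ?thesis using pos(1) by (rule mult_left_le_imp_le)
  qed
  then have "q * S k \<le> weight (Suc k)" using weight_pos[of "Suc k"] by (rule power2_le_imp_le[OF _ less_imp_le])
  then show ?thesis by (simp add: S_Suc distrib_right)
qed

lemma S_lower: "(1 + q) ^ k \<le> S k"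
proof (induction k)
  case (Suc k)
  have "(1 + q) ^ Suc k \<le> (1 + q) * S k" using Suc q(1) by (simp add: mult_left_mono)
  then show ?case using S_growth[of k] by linarith
qed (simp add: S_def)

text \<open>Since \<open>S\<close> grows geometrically, the sum is dominated by its last term. Hence
  the oracle errors do not accumulate beyond \<open>\<delta> * (1 + 1 / q)\<close>, whatever the
  number of iterations.\<close>

lemma sum_S_le: "(\<Sum>i\<le>k. S i) \<le> (1 + 1 / q) * S k"
proof (induction k)
  case 0
  then show ?case using q(1) by (simp add: S_def)
next
  case (Suc k)
  have "(1 + 1 / q) * S k = 1 / q * ((1 + q) * S k)" using q(1) by (simp add: field_simps)
  also have "\<dots> \<le> 1 / q * S (Suc k)" using S_growth q(1) by (intro mult_left_mono) auto
  finally show ?case using Suc by (simp add: algebra_simps)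
qed

theorem fgm_gap:
  assumes "x \<in> X"
  shows "F (descent k) \<le> F x + L / 2 * (norm (x - x0))\<^sup>2 / (1 + q) ^ k + \<delta> * (1 + 1 / q)"
proof -
  have "S k * F (descent k) \<le> L / 2 * (norm (x - x0))\<^sup>2 + S k * F x + \<delta> * (\<Sum>i\<le>k. S i)"
    using estimate_sequence[OF assms, of k] model_le[OF assms, of k] by linarith
  also have "\<dots> \<le> L / 2 * (norm (x - x0))\<^sup>2 + S k * F x + \<delta> * ((1 + 1 / q) * S k)"
    using sum_S_le pos by (intro add_left_mono mult_left_mono) auto
  finally have "F (descent k) \<le> F x + L / 2 * (norm (x - x0))\<^sup>2 / S k + \<delta> * (1 + 1 / q)"
    using S_pos[of k] by (simp add: field_simps)
  also have "\<dots> \<le> F x + L / 2 * (norm (x - x0))\<^sup>2 / (1 + q) ^ k + \<delta> * (1 + 1 / q)"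
  proof -
    have "0 < (1 + q) ^ k" using q(1) by (intro zero_less_power) auto
    then show ?thesis using S_lower[of k] S_pos[of k] pos by (intro add_mono divide_left_mono) auto
  qed
  finally show ?thesis .
qed

end

subsection \<open>Approximate solutions\<close>

lemma zero_in_normal_cone: "x \<in> X \<Longrightarrow> 0 \<in> normal_cone X x"
  by (simp add: normal_cone_def)

text \<open>Closedness makes the distance to the cone attained, so that proofs can work with an
  actual nearest normal vector.\<close>

lemma closed_normal_cone: "closed (normal_cone X x)"
proof (cases "x \<in> X")
  case True
  then have "normal_cone X x = (\<Inter>z\<in>X. {v. (z - x) \<bullet> v \<le> 0})"
    by (auto simp: normal_cone_def inner_commute)
  then show ?thesis by (auto intro!: closed_INT closed_halfspace_le)
qed (simp add: normal_cone_def)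

lemma approx_solution_variational:
  fixes F :: "'a::euclidean_space \<Rightarrow> real"
  assumes "approx_solution X F e x" "z \<in> X"
  shows "- e * norm (z - x) \<le> gradient F x \<bullet> (z - x)"
proof -
  have x: "x \<in> X" "infdist (- gradient F x) (normal_cone X x) \<le> e"
    using assms by (auto simp: approx_solution_def)
  have "normal_cone X x \<noteq> {}" using zero_in_normal_cone[OF x(1)] by auto
  from infdist_attains_inf[OF closed_normal_cone this]
  obtain n where n: "n \<in> normal_cone X x" "infdist (- gradient F x) (normal_cone X x) = dist (- gradient F x) n"
    by blast
  define r where "r = - gradient F x - n"
  have r: "norm r \<le> e" using n x unfolding r_def by (simp add: dist_norm)
  have "r \<bullet> (z - x) \<le> e * norm (z - x)"
    using norm_cauchy_schwarz[of r "z - x"] mult_right_mono[OF r norm_ge_zero[of "z - x"]] by linarith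
  moreover have "n \<bullet> (z - x) \<le> 0" using n(1) assms(2) by (simp add: normal_cone_def)
  moreover have "gradient F x \<bullet> (z - x) = - (r \<bullet> (z - x)) - n \<bullet> (z - x)"
    by (simp add: r_def inner_simps)
  ultimately show ?thesis by simp
qed

text \<open>The step size gives \<open>1 / \<gamma> = 2 * c\<close>. A step of length
  \<open>r > rad\<close> would decrease the linear model by \<open>2 * c * r\<^sup>2\<close> while
  the Hoelder error is at most \<open>c * r\<^sup>2\<close>, beating the gap. So
  \<open>r \<le> rad\<close>, and the residual is one \<open>H * rad powr \<nu>\<close> from the
  change of gradient and two from \<open>r / \<gamma>\<close>.\<close>

lemma projected_gradient_step:
  fixes X :: "'a::euclidean_space set"
  assumes X: "convex X" "compact X" and v: "v \<in> X" and nu: "0 < \<nu>" "\<nu> \<le> 1" and H: "0 < H"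
    and G: "\<And>z. z \<in> X \<Longrightarrow> GDERIV F z :> g z"
    and Hoelder: "\<And>u v. u \<in> X \<Longrightarrow> v \<in> X \<Longrightarrow> norm (g u - g v) \<le> H * norm (u - v) powr \<nu>"
    and rad: "0 < rad" and \<gamma>: "\<gamma> = rad powr (1 - \<nu>) / (2 * H)"
    and gap: "\<And>x. x \<in> X \<Longrightarrow> F v \<le> F x + H * rad powr (1 + \<nu>)"
  shows "approx_solution X F (3 * H * rad powr \<nu>) (closest_point X (v - \<gamma> *\<^sub>R gradient F v))"
proof -
  define w where "w = closest_point X (v - \<gamma> *\<^sub>R g v)"
  have grad: "gradient F z = g z" if "z \<in> X" for z using gradient_eqI G that by blast
  have cl: "closed X" "X \<noteq> {}" using X v compact_imp_closed by auto
  have w: "w \<in> X" unfolding w_def using cl by (rule closest_point_in_set)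
  have \<gamma>0: "0 < \<gamma>" using \<gamma> rad H by simp
  define r where "r = norm (w - v)"
  define c where "c = H * rad powr (\<nu> - 1)"
  have c: "0 < c" using H rad unfolding c_def by simp
  have c\<gamma>: "1 / \<gamma> = 2 * c" using rad H unfolding \<gamma> c_def by (simp add: powr_diff)
  have obtuse: "(v - \<gamma> *\<^sub>R g v - w) \<bullet> (z - w) \<le> 0" if "z \<in> X" for z
    unfolding w_def by (rule closest_point_dot[OF X(1) cl(1) that])
  have r_le: "r \<le> rad"
  proof (rule ccontr)
    assume "\<not> r \<le> rad"
    then have r: "rad < r" by simp
    have "r\<^sup>2 + \<gamma> * (g v \<bullet> (w - v)) = (v - \<gamma> *\<^sub>R g v - w) \<bullet> (v - w)"
      unfolding r_def power2_norm_eq_inner by (simp add: inner_simps algebra_simps)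
    then have "\<gamma> * (g v \<bullet> (w - v)) \<le> - (r\<^sup>2)" using obtuse[OF v] by linarith
    then have "g v \<bullet> (w - v) \<le> - (r\<^sup>2) / \<gamma>" using \<gamma>0 by (simp add: field_simps)
    also have "\<dots> = - (2 * c * r\<^sup>2)" using c\<gamma> by (simp add: divide_inverse)
    finally have lin: "g v \<bullet> (w - v) \<le> - (2 * c * r\<^sup>2)" .
    have "H / (1 + \<nu>) * r powr (1 + \<nu>) \<le> H * r powr (1 + \<nu>)"
      using H nu by (intro mult_right_mono) (auto simp: field_simps)
    also have "\<dots> = H * (r powr (\<nu> - 1) * r\<^sup>2)"
      using r rad by (simp add: powr_diff powr_add power2_eq_square)
    also have "\<dots> \<le> c * r\<^sup>2"
    proof -
      have "r powr (\<nu> - 1) \<le> rad powr (\<nu> - 1)" using r rad nu by (intro powr_mono2') auto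
      then show ?thesis unfolding c_def using H by (simp add: mult_left_mono mult_right_mono)
    qed
    finally have "H / (1 + \<nu>) * r powr (1 + \<nu>) \<le> c * r\<^sup>2" .
    moreover have "F w \<le> F v + g v \<bullet> (w - v) + H / (1 + \<nu>) * r powr (1 + \<nu>)"
      unfolding r_def by (rule Hoelder_descent[OF X(1) v w nu(1)]) (use G Hoelder in auto)
    ultimately have "F w \<le> F v - c * r\<^sup>2" using lin by linarith
    then have "c * r\<^sup>2 \<le> H * rad powr (1 + \<nu>)" using gap[OF w] by linarith
    also have "\<dots> = c * rad\<^sup>2" using rad unfolding c_def by (simp add: powr_diff powr_add power2_eq_square)
    finally have "r\<^sup>2 \<le> rad\<^sup>2" using c by simp
    then have "r \<le> rad" using rad by (auto intro: power2_le_imp_le)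
    then show False using r by simp
  qed
  define p where "p = (1 / \<gamma>) *\<^sub>R (v - \<gamma> *\<^sub>R g v - w)"
  have p: "p \<in> normal_cone X w"
    using w obtuse \<gamma>0 unfolding normal_cone_def p_def by (auto simp: divide_nonpos_pos)
  have "dist (- g w) p = norm ((g v - g w) + (1 / \<gamma>) *\<^sub>R (w - v))"
    unfolding dist_norm p_def using \<gamma>0 by (simp add: algebra_simps)
  also have "\<dots> \<le> norm (g v - g w) + r / \<gamma>"
    using \<gamma>0 norm_triangle_ineq[of "g v - g w" "(1 / \<gamma>) *\<^sub>R (w - v)"] by (simp add: r_def)
  also have "\<dots> \<le> H * r powr \<nu> + 2 * c * r"
  proof -
    have "r / \<gamma> = 2 * c * r" using c\<gamma> by (simp add: divide_inverse)
    then show ?thesis using Hoelder[OF v w] by (simp add: r_def norm_minus_commute)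
  qed
  also have "\<dots> \<le> H * rad powr \<nu> + 2 * c * rad"
    using r_le H c nu rad by (intro add_mono mult_left_mono powr_mono2) (auto simp: r_def)
  also have "\<dots> = 3 * H * rad powr \<nu>"
    using rad unfolding c_def by (simp add: powr_diff)
  finally have "infdist (- g w) (normal_cone X w) \<le> 3 * H * rad powr \<nu>"
    using infdist_le2[OF p] by blast
  then show ?thesis unfolding approx_solution_def using w grad[OF w] grad[OF v] by (simp add: w_def)
qed

text \<open>\<open>L\<close> comes from the true constant \<open>H\<close>, as the algorithm
  prescribes, while \<open>\<gamma>\<close> is fixed in advance and uses the common bound
  \<open>Hb\<close>. As \<open>fgm\<close> returns the first good index, exhibiting one good
  \<open>k\<close> bounds the count.\<close>

lemma fgm_terminates:
  fixes X :: "'a::euclidean_space set"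
  assumes X: "convex X" "compact X" and x0: "x0 \<in> X" and D: "\<And>x w. x \<in> X \<Longrightarrow> w \<in> X \<Longrightarrow> norm (x - w) \<le> D"
    and nu: "0 < \<nu>" "\<nu> \<le> 1" and H: "0 < H" "H \<le> Hb" and params: "0 < \<mu>" "0 < \<delta>" "0 < rad"
    and G: "\<And>z. z \<in> X \<Longrightarrow> GDERIV F z :> g z"
    and Hoelder: "\<And>u v. u \<in> X \<Longrightarrow> v \<in> X \<Longrightarrow> norm (g u - g v) \<le> H * norm (u - v) powr \<nu>"
    and strong: "\<And>x w. x \<in> X \<Longrightarrow> w \<in> X \<Longrightarrow> F x + g x \<bullet> (w - x) + \<mu> / 2 * (norm (w - x))\<^sup>2 \<le> F w"
    and L: "L = fgm_L \<nu> H \<delta>" and \<gamma>: "\<gamma> = rad powr (1 - \<nu>) / (2 * Hb)"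
    and tol: "3 * Hb * rad powr \<nu> \<le> tol"
    and k: "L / 2 * D\<^sup>2 / (1 + sqrt (\<mu> / L)) ^ k + \<delta> * (1 + 1 / sqrt (\<mu> / L)) \<le> Hb * rad powr (1 + \<nu>)"
  shows "\<exists>v n. fgm X F L \<mu> \<gamma> tol x0 = Some (v, n) \<and> n \<le> k + 1 \<and> approx_solution X F tol v"
proof -
  have grad: "gradient F z = g z" if "z \<in> X" for z using gradient_eqI G that by blast
  have L0: "0 < L" unfolding L using nu H(1) params(2) by (rule fgm_L_pos)
  have Hb: "0 < Hb" using H by simp
  have Hoelder_b: "norm (g u - g v) \<le> Hb * norm (u - v) powr \<nu>" if "u \<in> X" "v \<in> X" for u v
    using Hoelder[OF that] mult_right_mono[OF H(2), of "norm (u - v) powr \<nu>"] by simp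
  interpret fgm_inexact_oracle X F L \<mu> \<delta> x0
  proof
    fix x w assume xw: "x \<in> X" "w \<in> X"
    show "F x + gradient F x \<bullet> (w - x) + \<mu> / 2 * (norm (w - x))\<^sup>2 \<le> F w"
      using strong[OF xw] grad[OF xw(1)] by simp
    show "F w \<le> F x + gradient F x \<bullet> (w - x) + L / 2 * (norm (w - x))\<^sup>2 + \<delta>"
    proof -
      have "F w \<le> F x + g x \<bullet> (w - x) + H / (1 + \<nu>) * norm (w - x) powr (1 + \<nu>)"
        by (rule Hoelder_descent[OF X(1) xw nu(1)]) (use G Hoelder in auto)
      then show ?thesis
        using Hoelder_le_quadratic[OF nu H(1) params(2) norm_ge_zero[of "w - x"]]
        unfolding L grad[OF xw(1)] by linarith
    qed
  qed (use X x0 params L0 in auto)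
  have gap: "F (descent k) \<le> F x + Hb * rad powr (1 + \<nu>)" if x: "x \<in> X" for x
  proof -
    have "L / 2 * (norm (x - x0))\<^sup>2 / (1 + sqrt (\<mu> / L)) ^ k \<le> L / 2 * D\<^sup>2 / (1 + sqrt (\<mu> / L)) ^ k"
      using L0 params D[OF x x0] by (intro divide_right_mono mult_left_mono power_mono zero_le_power add_nonneg_nonneg) auto
    then show ?thesis using fgm_gap[OF x, of k] k unfolding q_def by linarith
  qed
  let ?P = "\<lambda>k. approx_solution X F tol (fgm_output X F L \<mu> \<gamma> x0 k)"
  have "approx_solution X F (3 * Hb * rad powr \<nu>) (closest_point X (descent k - \<gamma> *\<^sub>R gradient F (descent k)))"
    by (rule projected_gradient_step[OF X descent_in nu Hb G Hoelder_b params(3) \<gamma> gap])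
  then have Pk: "?P k" using tol by (simp add: approx_solution_def fgm_output_def Let_def)
  then have "fgm X F L \<mu> \<gamma> tol x0 = Some (fgm_output X F L \<mu> \<gamma> x0 (Least ?P), Least ?P + 1)"
    unfolding fgm_def Let_def by auto
  then show ?thesis using LeastI[of ?P, OF Pk] Least_le[of ?P, OF Pk] by auto
qed

subsection \<open>The inexact proximal point method\<close>

lemma GDERIV_prox_objective:
  assumes "GDERIV \<psi> z :> g"
  shows "GDERIV (prox_objective \<psi> \<rho> c) z :> g + (2 * \<rho>) *\<^sub>R (z - c)"
proof -
  have "((\<lambda>x. \<rho> * ((x - c) \<bullet> (x - c))) has_derivative (\<lambda>h. \<rho> * ((z - c) \<bullet> h + h \<bullet> (z - c)))) (at z)"
    by (auto intro!: derivative_eq_intros)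
  moreover have "(\<lambda>h. \<rho> * ((z - c) \<bullet> h + h \<bullet> (z - c))) = (\<lambda>h. h \<bullet> ((2 * \<rho>) *\<^sub>R (z - c)))"
    by (rule ext, subst inner_commute) simp
  ultimately have "GDERIV (\<lambda>x. \<rho> * (norm (x - c))\<^sup>2) z :> (2 * \<rho>) *\<^sub>R (z - c)"
    unfolding gderiv_def power2_norm_eq_inner by simp
  from GDERIV_add[OF assms this] show ?thesis
    by (simp add: prox_objective_def[abs_def])
qed

lemma norm_square_expand:
  fixes w x c :: "'a::real_inner"
  shows "(norm (w - c))\<^sup>2 = (norm (x - c))\<^sup>2 + 2 * ((x - c) \<bullet> (w - x)) + (norm (w - x))\<^sup>2"
  unfolding power2_norm_eq_inner by (simp add: inner_simps inner_commute)

text \<open>The proximal term has curvature \<open>2 * \<rho>\<close>, one \<open>\<rho>\<close> of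
  which is spent on the weak convexity of \<open>\<psi>\<close>.\<close>

lemma prox_objective_strongly_convex:
  fixes x w :: "'a::real_inner"
  assumes "\<psi> x + g \<bullet> (w - x) - \<rho> / 2 * (norm (w - x))\<^sup>2 \<le> \<psi> w"
  shows "prox_objective \<psi> \<rho> c x + (g + (2 * \<rho>) *\<^sub>R (x - c)) \<bullet> (w - x) + \<rho> / 2 * (norm (w - x))\<^sup>2 \<le> prox_objective \<psi> \<rho> c w"
  unfolding prox_objective_def norm_square_expand[of w c x] using assms
  by (simp add: inner_add_left algebra_simps)

text \<open>Strong convexity at \<open>v\<close> and the variational inequality leave a decrease of
  \<open>3 / 2 * \<rho> * d\<^sup>2 - \<epsilon> / 4 * d\<close>. The failed stopping test says
  \<open>\<rho> * d > \<epsilon> / 4\<close>, so one \<open>\<rho> * d\<^sup>2\<close> absorbs the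
  error and the remaining half is at least
  \<open>\<epsilon>\<^sup>2 / (32 * \<rho>)\<close>.\<close>

lemma prox_step_decrease:
  fixes X :: "'a::euclidean_space set"
  assumes G: "GDERIV \<psi> v :> g" and \<rho>: "0 < \<rho>" and u: "u \<in> X"
    and weak: "\<psi> v + g \<bullet> (u - v) - \<rho> / 2 * (norm (u - v))\<^sup>2 \<le> \<psi> u"
    and sol: "approx_solution X (prox_objective \<psi> \<rho> u) (\<epsilon> / 4) v"
    and far: "\<not> 2 * \<rho> * norm (v - u) \<le> \<epsilon> / 2" and \<epsilon>: "0 < \<epsilon>"
  shows "\<psi> v + \<epsilon>\<^sup>2 / (32 * \<rho>) < \<psi> u"
proof -
  define d where "d = norm (u - v)"
  have grad: "gradient (prox_objective \<psi> \<rho> u) v = g + (2 * \<rho>) *\<^sub>R (v - u)"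
    by (intro gradient_eqI GDERIV_prox_objective G)
  have d: "\<epsilon> / 4 < \<rho> * d" using far by (simp add: d_def norm_minus_commute)
  have "prox_objective \<psi> \<rho> u v + (g + (2 * \<rho>) *\<^sub>R (v - u)) \<bullet> (u - v) + \<rho> / 2 * d\<^sup>2 \<le> prox_objective \<psi> \<rho> u u"
    unfolding d_def by (rule prox_objective_strongly_convex[OF weak])
  moreover have "- (\<epsilon> / 4) * d \<le> (g + (2 * \<rho>) *\<^sub>R (v - u)) \<bullet> (u - v)"
    using approx_solution_variational[OF sol u] unfolding grad d_def .
  ultimately have 1: "\<psi> v + \<rho> * d\<^sup>2 + \<rho> / 2 * d\<^sup>2 - \<epsilon> / 4 * d \<le> \<psi> u"
    by (simp add: prox_objective_def d_def norm_minus_commute)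
  have "d \<noteq> 0" using d \<epsilon> by auto
  then have d0: "0 < d" unfolding d_def by simp
  have "\<epsilon> / 4 * d < \<rho> * d * d" using d d0 by (intro mult_strict_right_mono)
  then have 2: "\<epsilon> / 4 * d < \<rho> * d\<^sup>2" by (simp add: power2_eq_square)
  have "(\<epsilon> / 4)\<^sup>2 \<le> (\<rho> * d)\<^sup>2" using d \<epsilon> by (intro power_mono) auto
  then have "\<epsilon>\<^sup>2 / (32 * \<rho>) \<le> \<rho> / 2 * d\<^sup>2"
    using \<rho> by (simp add: field_simps power2_eq_square)
  with 1 2 show ?thesis by linarith
qed

text \<open>The gradients of \<open>\<psi>\<close> and of the proximal objective differ by
  \<open>2 * \<rho> * norm (v - u)\<close>, at most half the tolerance; the subproblem residual uses
  another quarter.\<close>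

lemma prox_stop:
  fixes X :: "'a::euclidean_space set"
  assumes G: "GDERIV \<psi> v :> g" and \<rho>: "0 < \<rho>"
    and sol: "approx_solution X (prox_objective \<psi> \<rho> u) (\<epsilon> / 4) v"
    and near: "2 * \<rho> * norm (v - u) \<le> \<epsilon> / 2"
  shows "approx_solution X \<psi> \<epsilon> v"
proof -
  have grad: "gradient (prox_objective \<psi> \<rho> u) v = g + (2 * \<rho>) *\<^sub>R (v - u)" "gradient \<psi> v = g"
    by (intro gradient_eqI GDERIV_prox_objective G)+
  have "dist (- g) (- (g + (2 * \<rho>) *\<^sub>R (v - u))) = 2 * \<rho> * norm (v - u)"
    using \<rho> by (simp add: dist_norm)
  moreover have "infdist (- (g + (2 * \<rho>) *\<^sub>R (v - u))) (normal_cone X v) \<le> \<epsilon> / 4"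
    using sol unfolding approx_solution_def grad by simp
  moreover have "0 \<le> \<epsilon>" using near mult_nonneg_nonneg[of "2 * \<rho>" "norm (v - u)"] \<rho> norm_ge_zero[of "v - u"] by linarith
  ultimately have "infdist (- g) (normal_cone X v) \<le> \<epsilon>"
    using infdist_triangle[of "- g" "normal_cone X v" "- (g + (2 * \<rho>) *\<^sub>R (v - u))"] near by linarith
  then show ?thesis using sol by (simp add: approx_solution_def grad)
qed

text \<open>\<open>M\<close> counts the decreases that still fit above the lower bound
  \<open>m\<close>. At \<open>M = 0\<close> the strictness of the decrease forces the stopping test
  to succeed.\<close>

lemma ippm_terminates:
  fixes X :: "'a::euclidean_space set" and M :: nat
  assumes G: "\<And>z. z \<in> X \<Longrightarrow> GDERIV \<psi> z :> g z" and \<rho>: "0 < \<rho>" and \<epsilon>: "0 < \<epsilon>"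
    and weak: "\<And>x w. x \<in> X \<Longrightarrow> w \<in> X \<Longrightarrow> \<psi> x + g x \<bullet> (w - x) - \<rho> / 2 * (norm (w - x))\<^sup>2 \<le> \<psi> w"
    and prox: "\<And>t u. u \<in> X \<Longrightarrow> \<exists>v n. prox t (prox_objective \<psi> \<rho> u) = Some (v, n) \<and> n \<le> n0
        \<and> approx_solution X (prox_objective \<psi> \<rho> u) (\<epsilon> / 4) v"
    and lower: "\<And>z. z \<in> X \<Longrightarrow> m \<le> \<psi> z"
    and u: "u \<in> X" "\<psi> u - m \<le> M * (\<epsilon>\<^sup>2 / (32 * \<rho>))"
  shows "\<exists>w n. ippm_run prox \<psi> \<rho> \<epsilon> t u w n \<and> n \<le> (M + 1) * n0 \<and> approx_solution X \<psi> \<epsilon> w"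
  using u
proof (induction M arbitrary: u t)
  case (0 u t)
  obtain v n where vn: "prox t (prox_objective \<psi> \<rho> u) = Some (v, n)" "n \<le> n0"
    "approx_solution X (prox_objective \<psi> \<rho> u) (\<epsilon> / 4) v" using prox[OF 0(1)] by blast
  have v: "v \<in> X" using vn(3) by (simp add: approx_solution_def)
  have "2 * \<rho> * norm (v - u) \<le> \<epsilon> / 2"
  proof (rule ccontr)
    assume "\<not> ?thesis"
    from prox_step_decrease[OF G[OF v] \<rho> 0(1) weak[OF v 0(1)] vn(3) this \<epsilon>]
    have "\<psi> v + \<epsilon>\<^sup>2 / (32 * \<rho>) < \<psi> u" .
    moreover have "0 \<le> \<epsilon>\<^sup>2 / (32 * \<rho>)" using \<rho> by simp
    ultimately show False using lower[OF v] 0(2) by simp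
  qed
  from ippm_run.return[of prox t \<psi> \<rho> u v n \<epsilon>, OF vn(1) this] prox_stop[OF G[OF v] \<rho> vn(3) this] vn(2)
  show ?case by auto
next
  case (Suc M u t)
  obtain v n where vn: "prox t (prox_objective \<psi> \<rho> u) = Some (v, n)" "n \<le> n0"
    "approx_solution X (prox_objective \<psi> \<rho> u) (\<epsilon> / 4) v" using prox[OF Suc.prems(1)] by blast
  have v: "v \<in> X" using vn(3) by (simp add: approx_solution_def)
  show ?case
  proof (cases "2 * \<rho> * norm (v - u) \<le> \<epsilon> / 2")
    case True
    have "n \<le> (Suc M + 1) * n0" using vn(2) by (simp add: trans_le_add1)
    then show ?thesis
      using ippm_run.return[of prox t \<psi> \<rho> u v n \<epsilon>, OF vn(1) True] prox_stop[OF G[OF v] \<rho> vn(3) True] by blast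
  next
    case False
    have "\<psi> v + \<epsilon>\<^sup>2 / (32 * \<rho>) < \<psi> u"
      by (rule prox_step_decrease[OF G[OF v] \<rho> Suc.prems(1) weak[OF v Suc.prems(1)] vn(3) False \<epsilon>])
    moreover have "real (Suc M) * (\<epsilon>\<^sup>2 / (32 * \<rho>)) = real M * (\<epsilon>\<^sup>2 / (32 * \<rho>)) + \<epsilon>\<^sup>2 / (32 * \<rho>)"
      by (simp add: distrib_right add_divide_distrib)
    ultimately have "\<psi> v - m \<le> M * (\<epsilon>\<^sup>2 / (32 * \<rho>))" using Suc.prems(2) by linarith
    from Suc.IH[OF v this, of "t + 1"] obtain w k where
      w: "ippm_run prox \<psi> \<rho> \<epsilon> (t + 1) v w k" "k \<le> (M + 1) * n0" "approx_solution X \<psi> \<epsilon> w" by blast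
    have "n + k \<le> (Suc M + 1) * n0" using vn(2) w(2) by simp
    then show ?thesis using ippm_run.continue[of prox t \<psi> \<rho> u v n \<epsilon>, OF vn(1) False w(1)] w(3) by blast
  qed
qed

subsection \<open>The augmented Lagrangian\<close>

lemma norm_transpose_mult_le:
  fixes M :: "real^'n^'m"
  shows "norm (transpose M *v u) \<le> onorm ((*v) M) * norm u"
proof -
  let ?w = "transpose M *v u"
  have "norm ?w * norm ?w = ?w \<bullet> ?w" by (simp add: dot_square_norm power2_eq_square)
  also have "\<dots> = u \<bullet> (M *v ?w)" by (metis dot_lmul_matrix transpose_matrix_vector)
  also have "\<dots> \<le> norm u * norm (M *v ?w)" by (rule norm_cauchy_schwarz)
  also have "\<dots> \<le> norm u * (onorm ((*v) M) * norm ?w)"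
    by (intro mult_left_mono onorm matrix_vector_mul_bounded_linear) auto
  finally have "norm ?w * norm ?w \<le> (onorm ((*v) M) * norm u) * norm ?w" by (simp add: ac_simps)
  moreover have "0 \<le> onorm ((*v) M)" by (intro onorm_pos_le matrix_vector_mul_bounded_linear)
  ultimately show ?thesis
    using mult_right_le_imp_le[of "norm ?w" "norm ?w" "onorm ((*v) M) * norm u"]
    by (cases "?w = 0") auto
qed

locale power_alm =
  fixes f :: "real^'n \<Rightarrow> real" and A :: "real^'n \<Rightarrow> real^'m" and X :: "(real^'n) set"
    and D Lf LA Amax JAmax gfmax \<nu> :: real
  assumes f_diff: "\<And>x. f differentiable (at x)"
    and A_diff: "\<And>x. A differentiable (at x)"
    and P: "assumption_P f A X D Lf LA Amax JAmax gfmax"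
    and R: "assumption_R A X"
    and nu: "0 < \<nu>" "\<nu> \<le> 1"
begin

abbreviation "J x \<equiv> jacobian A (at x)"

lemma X: "X \<noteq> {}" "convex X" "compact X"
  and const_pos: "0 < D" "0 < Lf" "0 < LA" "0 < Amax" "0 < JAmax" "0 < gfmax"
  and gradf_Lipschitz: "\<And>x x'. x \<in> X \<Longrightarrow> x' \<in> X \<Longrightarrow> norm (gradient f x' - gradient f x) \<le> Lf * norm (x' - x)"
  and J_Lipschitz: "\<And>x x'. x \<in> X \<Longrightarrow> x' \<in> X \<Longrightarrow> onorm ((*v) (J x' - J x)) \<le> LA * norm (x' - x)"
  and gradf_le: "\<And>x. x \<in> X \<Longrightarrow> norm (gradient f x) \<le> gfmax"
  and A_le: "\<And>x. x \<in> X \<Longrightarrow> norm (A x) \<le> Amax"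
  and J_le: "\<And>x. x \<in> X \<Longrightarrow> onorm ((*v) (J x)) \<le> JAmax"
  and diameter_X: "diameter X = D"
  using P unfolding assumption_P_def by blast+

lemma norm_diff_le_D: "x \<in> X \<Longrightarrow> w \<in> X \<Longrightarrow> norm (x - w) \<le> D"
  using diameter_bounded_bound[OF compact_imp_bounded[OF X(3)]] diameter_X by (simp add: dist_norm)

lemma has_derivative_A: "(A has_derivative (\<lambda>h. J x *v h)) (at x)"
  using A_diff jacobian_works by blast

lemma GDERIV_compose_A:
  assumes "GDERIV h (A x) :> u"
  shows "GDERIV (\<lambda>x. h (A x)) x :> transpose (J x) *v u"
proof -
  have "((\<lambda>x. h (A x)) has_derivative (\<lambda>z. (J x *v z) \<bullet> u)) (at x)"
    using has_derivative_compose[OF has_derivative_A, of h "\<lambda>z. z \<bullet> u"] assms unfolding gderiv_def by simp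
  moreover have "(J x *v z) \<bullet> u = z \<bullet> (transpose (J x) *v u)" for z
    by (metis dot_lmul_matrix inner_commute transpose_matrix_vector)
  ultimately show ?thesis unfolding gderiv_def by simp
qed

lemma GDERIV_inner_left: "GDERIV (\<lambda>z. z \<bullet> u) z :> u"
  unfolding gderiv_def by (auto intro!: derivative_eq_intros)

text \<open>Stationarity for \<open>psi\<close> at \<open>x\<close> is Lagrangian stationarity with
  this multiplier, which later serves as the witness in \<open>stationary_point\<close>.\<close>

definition "multiplier \<beta> y x = y + \<beta> *\<^sub>R dphi \<nu> (A x)"

definition "dpsi \<beta> y x = gradient f x + transpose (J x) *v multiplier \<beta> y x"

lemma GDERIV_psi: "GDERIV (psi f A \<nu> \<beta> y) x :> dpsi \<beta> y x"
proof -
  have "GDERIV (\<lambda>z. z \<bullet> y + \<beta> * phi \<nu> z) (A x) :> multiplier \<beta> y x"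
  proof -
    have "GDERIV (\<lambda>z. \<beta> * phi \<nu> z) (A x) :> \<beta> *\<^sub>R dphi \<nu> (A x)"
      using GDERIV_phi[OF nu(1), of "A x"] unfolding gderiv_def
      by (auto intro!: derivative_eq_intros)
    from GDERIV_add[OF GDERIV_inner_left this] show ?thesis unfolding multiplier_def .
  qed
  from GDERIV_add[OF GDERIV_gradient[OF f_diff] GDERIV_compose_A[OF this]]
  have "GDERIV (\<lambda>x. f x + (A x \<bullet> y + \<beta> * phi \<nu> (A x))) x :> dpsi \<beta> y x" unfolding dpsi_def .
  moreover have "psi f A \<nu> \<beta> y = (\<lambda>x. f x + (A x \<bullet> y + \<beta> * phi \<nu> (A x)))"
    by (simp add: psi_def phi_def fun_eq_iff)
  ultimately show ?thesis by simp
qed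

lemma gradient_psi: "gradient (psi f A \<nu> \<beta> y) x = dpsi \<beta> y x"
  by (intro gradient_eqI GDERIV_psi)

lemma norm_dphi_A_le: "x \<in> X \<Longrightarrow> norm (dphi \<nu> (A x)) \<le> Amax powr \<nu>"
  using A_le nu by (simp add: norm_dphi powr_mono2)

lemma norm_multiplier_le: "x \<in> X \<Longrightarrow> 0 \<le> \<beta> \<Longrightarrow> norm (multiplier \<beta> y x) \<le> norm y + \<beta> * Amax powr \<nu>"
  unfolding multiplier_def
  using norm_triangle_ineq[of y "\<beta> *\<^sub>R dphi \<nu> (A x)"] mult_left_mono[OF norm_dphi_A_le, of x \<beta>] by simp

lemma A_Lipschitz:
  assumes "x \<in> X" "w \<in> X"
  shows "norm (A x - A w) \<le> JAmax * norm (x - w)"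
  by (rule differentiable_bound[OF X(2) has_derivative_at_withinI[OF has_derivative_A] J_le assms])

lemma transpose_J_diff:
  assumes "x \<in> X" "w \<in> X"
  shows "norm (transpose (J x) *v u - transpose (J w) *v v) \<le> JAmax * norm (u - v) + LA * norm (x - w) * norm v"
proof -
  have "transpose (J x) *v u - transpose (J w) *v v = transpose (J x) *v (u - v) + transpose (J x - J w) *v v"
  proof -
    have "transpose (J x - J w) = transpose (J x) - transpose (J w)"
      by (simp add: transpose_def vec_eq_iff)
    then show ?thesis
      by (simp only: matrix_vector_mult_diff_distrib matrix_vector_mult_diff_rdistrib diff_add_cancel add_diff_eq)
  qed
  moreover have "norm (transpose (J x) *v (u - v)) \<le> JAmax * norm (u - v)"
    by (rule order_trans[OF norm_transpose_mult_le mult_right_mono[OF J_le[OF assms(1)] norm_ge_zero]])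
  moreover have "norm (transpose (J x - J w) *v v) \<le> LA * norm (x - w) * norm v"
    by (rule order_trans[OF norm_transpose_mult_le mult_right_mono[OF J_Lipschitz[OF assms(2,1)] norm_ge_zero]])
  ultimately show ?thesis using norm_triangle_ineq[of "transpose (J x) *v (u - v)" "transpose (J x - J w) *v v"] by simp
qed

abbreviation "HM \<equiv> max 1 (D powr (1 - \<nu>))"

text \<open>Bounded diameter turns Lipschitz terms into Hoelder terms, as
  \<open>r = r powr (1 - \<nu>) * r powr \<nu>\<close>.\<close>

lemma norm_le_Hoelder:
  assumes "x \<in> X" "w \<in> X"
  shows "norm (x - w) \<le> HM * norm (x - w) powr \<nu>"
proof (cases "x = w")
  case False
  define r where "r = norm (x - w)"
  have r: "0 < r" "r \<le> D" using False norm_diff_le_D assms unfolding r_def by auto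
  have "r = r powr (1 - \<nu>) * r powr \<nu>" using r by (simp flip: powr_add)
  also have "\<dots> \<le> HM * r powr \<nu>" using r nu by (intro mult_right_mono max.coboundedI2 powr_mono2) auto
  finally show ?thesis unfolding r_def .
qed simp

abbreviation "\<rho> \<beta> y \<equiv> rho Lf LA Amax \<nu> \<beta> (y::real^'m)"
abbreviation "H\<beta> \<beta> y \<equiv> H_beta D Lf LA Amax JAmax \<nu> \<beta> (y::real^'m)"
abbreviation "HF \<beta> y \<equiv> H_F D Lf LA Amax JAmax \<nu> \<beta> (y::real^'m)"

lemma dpsi_Hoelder:
  assumes x: "x \<in> X" "w \<in> X" and \<beta>: "0 \<le> \<beta>"
  shows "norm (dpsi \<beta> y x - dpsi \<beta> y w) \<le> H\<beta> \<beta> y * norm (x - w) powr \<nu>"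
proof -
  define r where "r = norm (x - w)"
  have r: "r \<le> HM * r powr \<nu>" unfolding r_def by (rule norm_le_Hoelder[OF x])
  define C where "C = 2 powr (1 - \<nu>) * JAmax powr (1 + \<nu>)"
  have "norm (dphi \<nu> (A x) - dphi \<nu> (A w)) \<le> 2 powr (1 - \<nu>) * norm (A x - A w) powr \<nu>"
    by (rule dphi_Hoelder[OF nu])
  also have "\<dots> \<le> 2 powr (1 - \<nu>) * (JAmax * r) powr \<nu>"
    using A_Lipschitz[OF x] nu unfolding r_def by (intro mult_left_mono powr_mono2) auto
  finally have "JAmax * norm (dphi \<nu> (A x) - dphi \<nu> (A w)) \<le> JAmax * (2 powr (1 - \<nu>) * (JAmax * r) powr \<nu>)"
    using const_pos by (intro mult_left_mono) auto
  also have "\<dots> = C * r powr \<nu>"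
    using const_pos unfolding C_def r_def by (simp add: powr_mult powr_add)
  finally have 1: "JAmax * norm (dphi \<nu> (A x) - dphi \<nu> (A w)) \<le> C * r powr \<nu>" .
  have "dpsi \<beta> y x - dpsi \<beta> y w = (gradient f x - gradient f w)
      + (transpose (J x) *v y - transpose (J w) *v y)
      + \<beta> *\<^sub>R (transpose (J x) *v dphi \<nu> (A x) - transpose (J w) *v dphi \<nu> (A w))"
    unfolding dpsi_def multiplier_def
    by (simp add: matrix_vector_right_distrib matrix_vector_mult_scaleR scaleR_diff_right)
  moreover have "norm (gradient f x - gradient f w) \<le> Lf * r"
    using gradf_Lipschitz[OF x(2,1)] unfolding r_def .
  moreover have "norm (transpose (J x) *v y - transpose (J w) *v y) \<le> LA * r * norm y"
    using transpose_J_diff[OF x, of y y] unfolding r_def by simp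
  moreover have "LA * r * norm (dphi \<nu> (A w)) \<le> LA * r * Amax powr \<nu>"
    using norm_dphi_A_le[OF x(2)] const_pos unfolding r_def by (intro mult_left_mono) auto
  then have "norm (transpose (J x) *v dphi \<nu> (A x) - transpose (J w) *v dphi \<nu> (A w))
      \<le> C * r powr \<nu> + LA * r * Amax powr \<nu>"
    using transpose_J_diff[OF x, of "dphi \<nu> (A x)" "dphi \<nu> (A w)"] 1 unfolding r_def by linarith
  then have "norm (\<beta> *\<^sub>R (transpose (J x) *v dphi \<nu> (A x) - transpose (J w) *v dphi \<nu> (A w)))
      \<le> \<beta> * (C * r powr \<nu> + LA * r * Amax powr \<nu>)"
    using \<beta> by (simp add: mult_left_mono)
  ultimately have "norm (dpsi \<beta> y x - dpsi \<beta> y w)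
      \<le> Lf * r + LA * r * norm y + \<beta> * (C * r powr \<nu> + LA * r * Amax powr \<nu>)"
    by (intro norm_triangle_le add_mono order_refl | simp add: norm_triangle_le)+
  also have "\<dots> = (Lf + LA * norm y + \<beta> * (Amax powr \<nu> * LA)) * r + \<beta> * C * r powr \<nu>"
    by (simp add: algebra_simps)
  also have "\<dots> \<le> (Lf + LA * norm y + \<beta> * (Amax powr \<nu> * LA)) * (HM * r powr \<nu>) + \<beta> * C * (HM * r powr \<nu>)"
  proof (intro add_mono mult_left_mono r)
    show "r powr \<nu> \<le> HM * r powr \<nu>" by (simp add: mult_le_cancel_right1)
    show "0 \<le> Lf + LA * norm y + \<beta> * (Amax powr \<nu> * LA)" using const_pos \<beta> by simp
    show "0 \<le> \<beta> * C" using \<beta> unfolding C_def by simp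
  qed
  also have "\<dots> = H\<beta> \<beta> y * r powr \<nu>" unfolding H_beta_def C_def by (simp add: algebra_simps)
  finally show ?thesis unfolding r_def .
qed

lemma rho_pos: "0 \<le> \<beta> \<Longrightarrow> 0 < \<rho> \<beta> y"
  using const_pos unfolding rho_def by (intro add_pos_nonneg mult_nonneg_nonneg add_nonneg_nonneg) auto

lemma prox_gradient_Hoelder:
  assumes x: "x \<in> X" "w \<in> X" and \<beta>: "0 \<le> \<beta>"
  shows "norm ((dpsi \<beta> y x + (2 * \<rho> \<beta> y) *\<^sub>R (x - c)) - (dpsi \<beta> y w + (2 * \<rho> \<beta> y) *\<^sub>R (w - c)))
    \<le> HF \<beta> y * norm (x - w) powr \<nu>"
proof -
  have "(dpsi \<beta> y x + (2 * \<rho> \<beta> y) *\<^sub>R (x - c)) - (dpsi \<beta> y w + (2 * \<rho> \<beta> y) *\<^sub>R (w - c))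
      = (dpsi \<beta> y x - dpsi \<beta> y w) + (2 * \<rho> \<beta> y) *\<^sub>R (x - w)"
    by (simp add: algebra_simps)
  also have "norm \<dots> \<le> norm (dpsi \<beta> y x - dpsi \<beta> y w) + 2 * \<rho> \<beta> y * norm (x - w)"
    using norm_triangle_ineq[of "dpsi \<beta> y x - dpsi \<beta> y w" "(2 * \<rho> \<beta> y) *\<^sub>R (x - w)"] rho_pos[OF \<beta>, of y] by simp
  also have "\<dots> \<le> H\<beta> \<beta> y * norm (x - w) powr \<nu> + 2 * \<rho> \<beta> y * (HM * norm (x - w) powr \<nu>)"
    using dpsi_Hoelder[OF x \<beta>, of y] norm_le_Hoelder[OF x] rho_pos[OF \<beta>, of y]
    by (intro add_mono mult_left_mono) auto
  finally show ?thesis unfolding H_F_def by (simp add: algebra_simps)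
qed

text \<open>By convexity of \<open>phi \<nu>\<close>, freezing the multiplier \<open>u\<close> at
  \<open>x\<close> turns \<open>psi\<close>, up to a constant, into the minorant
  \<open>f z + A z \<bullet> u\<close>, with equal value and gradient at \<open>x\<close>. Its
  gradient is Lipschitz with constant \<open>Lf + LA * norm u\<close>, which explains the form of
  \<open>\<rho>\<close>.\<close>

lemma psi_weakly_convex:
  assumes x: "x \<in> X" "w \<in> X" and \<beta>: "0 \<le> \<beta>"
  shows "psi f A \<nu> \<beta> y x + dpsi \<beta> y x \<bullet> (w - x) - \<rho> \<beta> y / 2 * (norm (w - x))\<^sup>2 \<le> psi f A \<nu> \<beta> y w"
proof -
  define u where "u = multiplier \<beta> y x"
  \<comment> \<open>Negated, so that the descent lemma with exponent 1 yields a lower bound.\<close>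
  define h where "h = (\<lambda>z. - (f z + A z \<bullet> u))"
  define dh where "dh = (\<lambda>z. - (gradient f z + transpose (J z) *v u))"
  have G: "GDERIV h z :> dh z" for z
    unfolding h_def dh_def
    by (intro GDERIV_minus GDERIV_add GDERIV_gradient f_diff GDERIV_compose_A GDERIV_inner_left)
  have Lip: "norm (dh a - dh b) \<le> \<rho> \<beta> y * norm (a - b) powr 1" if "a \<in> X" "b \<in> X" for a b
  proof -
    have "dh a - dh b = - ((gradient f a - gradient f b) + (transpose (J a) *v u - transpose (J b) *v u))"
      unfolding dh_def by simp
    then have "norm (dh a - dh b) \<le> norm (gradient f a - gradient f b) + norm (transpose (J a) *v u - transpose (J b) *v u)"
      using norm_triangle_ineq by (metis norm_minus_cancel)
    also have "\<dots> \<le> Lf * norm (a - b) + LA * norm (a - b) * norm u"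
      using gradf_Lipschitz[OF that(2,1)] transpose_J_diff[OF that, of u u] by simp
    also have "\<dots> \<le> Lf * norm (a - b) + LA * norm (a - b) * (norm y + \<beta> * Amax powr \<nu>)"
      using norm_multiplier_le[OF x(1) \<beta>] const_pos unfolding u_def by (intro add_left_mono mult_left_mono) auto
    also have "\<dots> = \<rho> \<beta> y * norm (a - b)" unfolding rho_def by (simp add: algebra_simps)
    finally show ?thesis by simp
  qed
  have "h w \<le> h x + dh x \<bullet> (w - x) + \<rho> \<beta> y / (1 + 1) * norm (w - x) powr (1 + 1)"
    by (rule Hoelder_descent[OF X(2) x _ G Lip]) auto
  then have "f x + A x \<bullet> u + (gradient f x + transpose (J x) *v u) \<bullet> (w - x) - \<rho> \<beta> y / 2 * (norm (w - x))\<^sup>2 \<le> f w + A w \<bullet> u"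
    unfolding h_def dh_def by (simp add: inner_minus_left inner_diff_left inner_add_left)
  moreover have "dpsi \<beta> y x = gradient f x + transpose (J x) *v u" unfolding dpsi_def u_def ..
  moreover have "\<beta> * phi \<nu> (A x) + \<beta> * (dphi \<nu> (A x) \<bullet> (A w - A x)) \<le> \<beta> * phi \<nu> (A w)"
    using mult_left_mono[OF phi_convex[OF nu(1), of "A x" "A w"] \<beta>] by (simp add: distrib_left)
  moreover have "A w \<bullet> u - A x \<bullet> u = A w \<bullet> y - A x \<bullet> y + \<beta> * (dphi \<nu> (A x) \<bullet> (A w - A x))"
    unfolding u_def multiplier_def by (simp add: inner_add_right inner_diff_right inner_commute right_diff_distrib)
  moreover have "psi f A \<nu> \<beta> y z = f z + A z \<bullet> y + \<beta> * phi \<nu> (A z)" for z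
    by (simp add: psi_def phi_def)
  ultimately show ?thesis by simp
qed

text \<open>The penalty contributes \<open>s\<close> times \<open>transpose (J x) *v A x\<close> to
  the gradient. Dividing by \<open>s\<close> keeps the normal vector in the cone, so (R) bounds
  \<open>R * norm (A x) * s\<close> by the norm of the remaining terms.\<close>

lemma regularity_bound:
  assumes R: "\<And>x. x \<in> X \<Longrightarrow> R * norm (A x) \<le> infdist (- (transpose (J x) *v A x)) (normal_cone X x)"
    and sol: "approx_solution X (psi f A \<nu> \<beta> y) e x" and \<beta>: "0 < \<beta>"
  shows "R * \<beta> * norm (A x) powr \<nu> \<le> e + gfmax + JAmax * norm y"
proof -
  have x: "x \<in> X" and inf: "infdist (- dpsi \<beta> y x) (normal_cone X x) \<le> e"
    using sol by (auto simp: approx_solution_def gradient_psi)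
  have e: "0 \<le> e" using inf infdist_nonneg order_trans by blast
  show ?thesis
  proof (cases "A x = 0")
    case True
    then show ?thesis using e const_pos by simp
  next
    case False
    define s where "s = \<beta> * norm (A x) powr (\<nu> - 1)"
    have s: "0 < s" using False \<beta> unfolding s_def by simp
    have "normal_cone X x \<noteq> {}" using zero_in_normal_cone[OF x] by auto
    from infdist_attains_inf[OF closed_normal_cone this]
    obtain n where n: "n \<in> normal_cone X x" "infdist (- dpsi \<beta> y x) (normal_cone X x) = dist (- dpsi \<beta> y x) n"
      by blast
    define r where "r = - dpsi \<beta> y x - n"
    have r: "norm r \<le> e" using n inf unfolding r_def by (simp add: dist_norm)
    define q where "q = r + gradient f x + transpose (J x) *v y"
    have dp: "dpsi \<beta> y x = gradient f x + transpose (J x) *v y + s *\<^sub>R (transpose (J x) *v A x)"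
      unfolding dpsi_def multiplier_def dphi_def s_def
      by (simp add: matrix_vector_right_distrib matrix_vector_mult_scaleR)
    have n_s: "(1 / s) *\<^sub>R n \<in> normal_cone X x"
      using n(1) s x unfolding normal_cone_def by (auto simp: divide_nonpos_pos)
    have "s *\<^sub>R (- (transpose (J x) *v A x) - (1 / s) *\<^sub>R n) = q"
      using s unfolding q_def r_def dp by (simp add: scaleR_diff_right)
    then have eq: "- (transpose (J x) *v A x) - (1 / s) *\<^sub>R n = (1 / s) *\<^sub>R q" using s by auto
    have "R * norm (A x) \<le> dist (- (transpose (J x) *v A x)) ((1 / s) *\<^sub>R n)"
      using R[OF x] infdist_le[OF n_s] order_trans by blast
    also have "\<dots> = norm q / s" unfolding dist_norm eq using s by simp
    finally have "R * norm (A x) * s \<le> norm q" using s by (simp add: field_simps)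
    also have "\<dots> \<le> e + gfmax + JAmax * norm y"
    proof -
      have "norm (transpose (J x) *v y) \<le> JAmax * norm y"
        using norm_transpose_mult_le[of "J x" y] mult_right_mono[OF J_le[OF x], of "norm y"] by simp
      then show ?thesis unfolding q_def
        using r gradf_le[OF x] norm_triangle_ineq[of "r + gradient f x" "transpose (J x) *v y"]
          norm_triangle_ineq[of r "gradient f x"] by linarith
    qed
    also have "R * norm (A x) * s = R * \<beta> * norm (A x) powr \<nu>"
      using False unfolding s_def by (simp add: powr_diff)
    finally show ?thesis .
  qed
qed

lemma stationary_if_approx_solution:
  assumes "approx_solution X (psi f A \<nu> \<beta> y) e x" "e \<le> eps_phi" "norm (A x) \<le> eps_A"
  shows "stationary_point f A X eps_phi eps_A x"
  unfolding stationary_point_def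
proof (intro conjI exI)
  have "- dpsi \<beta> y x = - gradient f x - transpose (J x) *v multiplier \<beta> y x" unfolding dpsi_def by simp
  then show "infdist (- gradient f x - transpose (J x) *v multiplier \<beta> y x) (normal_cone X x) \<le> eps_phi"
    using assms unfolding approx_solution_def gradient_psi by simp
qed (use assms in \<open>auto simp: approx_solution_def\<close>)

end

subsection \<open>Complexity of one subproblem\<close>

text \<open>Rests on \<open>ln (1 + q) \<ge> 1 / (1 + 1 / q)\<close>, which is
  \<open>ln x \<le> x - 1\<close> at the inverse of \<open>1 + q\<close>.\<close>

lemma power_exceeds:
  fixes q a :: real
  assumes "0 < q" "1 \<le> a"
  shows "\<exists>k::nat. a \<le> (1 + q) ^ k \<and> real k \<le> (1 + 1 / q) * ln a + 1"
proof -
  define r where "r = (1 + 1 / q) * ln a"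
  have r: "0 \<le> r" using assms unfolding r_def by simp
  define k where "k = nat \<lceil>r\<rceil>"
  have k: "r \<le> real k" "real k \<le> r + 1" using r unfolding k_def by linarith+
  have "1 / (1 + 1 / q) \<le> ln (1 + q)"
  proof -
    have "ln (inverse (1 + q)) \<le> inverse (1 + q) - 1" using assms by (intro ln_le_minus_one) auto
    then have "1 - inverse (1 + q) \<le> ln (1 + q)" using assms by (simp add: ln_inverse)
    moreover have "1 - inverse (1 + q) = 1 / (1 + 1 / q)" using assms by (simp add: field_simps)
    ultimately show ?thesis by simp
  qed
  then have "r * (1 / (1 + 1 / q)) \<le> real k * ln (1 + q)"
    using k r assms by (intro mult_mono) auto
  moreover have "r * (1 / (1 + 1 / q)) = ln a"
  proof -
    have "1 + 1 / q \<noteq> 0" using assms by (simp add: add_pos_pos less_imp_neq[symmetric])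
    then show ?thesis unfolding r_def by simp
  qed
  ultimately have "ln a \<le> ln ((1 + q) ^ k)" using assms by (simp add: ln_realpow)
  then have "a \<le> (1 + q) ^ k" using assms by (subst (asm) ln_le_cancel_iff) auto
  then show ?thesis using k unfolding r_def by blast
qed

lemma fgm_L_le:
  assumes "0 < \<nu>" "\<nu> \<le> 1" "0 < H" "H \<le> Hb" "0 < \<delta>"
  shows "fgm_L \<nu> H \<delta> \<le> Hb * (Hb / (2 * \<delta>)) powr ((1 - \<nu>) / (1 + \<nu>))"
proof (cases "\<nu> = 1")
  case True
  then show ?thesis using assms by (simp add: fgm_L_def)
next
  case False
  have "(1 - \<nu>) / (1 + \<nu>) \<le> 1" "0 \<le> (1 - \<nu>) / (1 + \<nu>)" using assms by auto
  then have "H / (2 * \<delta>) * ((1 - \<nu>) / (1 + \<nu>)) \<le> Hb / (2 * \<delta>) * 1"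
    using assms by (intro mult_mono divide_right_mono) auto
  then have "(H / (2 * \<delta>) * ((1 - \<nu>) / (1 + \<nu>))) powr ((1 - \<nu>) / (1 + \<nu>))
      \<le> (Hb / (2 * \<delta>)) powr ((1 - \<nu>) / (1 + \<nu>))"
    using assms by (intro powr_mono2) auto
  then show ?thesis using False assms unfolding fgm_L_def by (simp add: mult_mono)
qed

locale alm_subproblems = power_alm f A X D Lf LA Amax JAmax gfmax \<nu>
  for f :: "real^'n \<Rightarrow> real" and A :: "real^'n \<Rightarrow> real^'m" and X D Lf LA Amax JAmax gfmax \<nu> +
  fixes lam \<beta>1 Y :: real
  assumes lam: "0 < lam" and \<beta>1: "0 < \<beta>1" and Y: "0 \<le> Y"
begin

text \<open>
  \<open>Hc * B\<close> bounds the Hoelder constant of every subproblem with penalty \<open>\<beta>1 * B\<close>, and \<open>rho_lo * B\<close> and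
  \<open>rho_up * B\<close> enclose the proximal parameter. The final projected gradient step meets the tolerance if it has
  length at most \<open>step_radius B\<close>, which is the case as soon as the function gap is below
  \<open>gap_c * B powr (- expo_e)\<close>. With \<open>\<delta> = delta_c * B powr (- expo_d)\<close>, \<open>sqrt (L / \<rho>)\<close> is of order \<open>B powr expo_q\<close>, and
  \<open>expo_d\<close> solves \<open>expo_d - expo_q = expo_e\<close>, so that the accumulated oracle error
  \<open>\<delta> * (1 + sqrt (L / \<rho>))\<close> is of the order of the admissible gap.
\<close>

definition "Hc = (Lf + LA * Y + \<beta>1 * (2 powr (1 - \<nu>) * JAmax powr (1 + \<nu>) + Amax powr \<nu> * LA)) * HM
  + 2 * (Lf + LA * (Y + \<beta>1 * Amax powr \<nu>)) * HM"
definition "rho_lo = LA * (\<beta>1 * Amax powr \<nu>)"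
definition "rho_up = Lf + LA * (Y + \<beta>1 * Amax powr \<nu>)"

text \<open>Half the exponent in \<open>fgm_L\<close>, because the rate involves
  \<open>sqrt L\<close>.\<close>

definition "expo_a = (1 - \<nu>) / (2 * (1 + \<nu>))"
definition "expo_e = 2 + 2 / \<nu>"
definition "expo_d = (expo_e + expo_a) / (1 - expo_a)"
definition "expo_q = expo_a * (1 + expo_d)"

definition "gap_c = Hc * (lam / (12 * Hc * \<beta>1)) powr ((1 + \<nu>) / \<nu>)"
definition "kappa = sqrt (Hc / rho_lo) * (Hc / 2) powr expo_a"
text \<open>As \<open>delta_c \<le> 1\<close> and \<open>expo_a < 1 / 2\<close>, both
  \<open>delta_c\<close> and \<open>delta_c powr (1 - expo_a)\<close> are at most
  \<open>sqrt delta_c\<close>. So \<open>sqrt delta_c * (1 + kappa) \<le> gap_c / 2\<close>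
  suffices, whence the square.\<close>

definition "delta_c = min 1 ((gap_c / (2 * (1 + kappa)))\<^sup>2)"
definition "cond_c = kappa * delta_c powr (- expo_a)"

definition "step_radius B = (lam / (12 * Hc * \<beta>1 * B\<^sup>2)) powr (1 / \<nu>)"
definition "delta B = delta_c * B powr (- expo_d)"
definition "gamma B = step_radius B powr (1 - \<nu>) / (2 * (Hc * B))"

lemma Hc_pos: "0 < Hc"
proof -
  have "0 < 2 * (Lf + LA * (Y + \<beta>1 * Amax powr \<nu>)) * HM"
    using const_pos \<beta>1 Y by (intro mult_pos_pos add_pos_nonneg mult_nonneg_nonneg add_nonneg_nonneg) auto
  moreover have "0 \<le> (Lf + LA * Y + \<beta>1 * (2 powr (1 - \<nu>) * JAmax powr (1 + \<nu>) + Amax powr \<nu> * LA)) * HM"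
    using const_pos \<beta>1 Y by (intro mult_nonneg_nonneg add_nonneg_nonneg) auto
  ultimately show ?thesis unfolding Hc_def by linarith
qed

lemma rho_lo_pos: "0 < rho_lo" and rho_up_pos: "0 < rho_up"
  using const_pos \<beta>1 Y unfolding rho_lo_def rho_up_def by (auto intro!: add_pos_nonneg)

lemma gap_c_pos: "0 < gap_c"
  using Hc_pos lam \<beta>1 unfolding gap_c_def by simp

lemma kappa_pos: "0 < kappa"
  using Hc_pos rho_lo_pos unfolding kappa_def by simp

lemma delta_c: "0 < delta_c" "delta_c \<le> 1"
  using gap_c_pos kappa_pos unfolding delta_c_def by auto

lemma cond_c_pos: "0 < cond_c"
  using kappa_pos delta_c unfolding cond_c_def by simp

lemma expo_a: "0 \<le> expo_a" "expo_a < 1 / 2" "2 * expo_a = (1 - \<nu>) / (1 + \<nu>)"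
  using nu unfolding expo_a_def by (auto simp: field_simps)

lemma expo_pos: "0 < expo_e" "0 < expo_d" "0 \<le> expo_q"
proof -
  show e: "0 < expo_e" using nu unfolding expo_e_def by (simp add: add_pos_pos)
  show d: "0 < expo_d" unfolding expo_d_def using e expo_a by (intro divide_pos_pos) auto
  show "0 \<le> expo_q" unfolding expo_q_def using d expo_a by (intro mult_nonneg_nonneg) auto
qed

lemma expo_d_minus_q: "expo_d - expo_q = expo_e"
proof -
  have "expo_d * (1 - expo_a) = expo_e + expo_a" unfolding expo_d_def using expo_a by simp
  then show ?thesis unfolding expo_q_def by (simp add: algebra_simps)
qed

lemma expo_q_eq: "expo_q = (1 - \<nu>) / (1 + 3 * \<nu>) * (3 + 2 / \<nu>)"
proof -
  have 1: "1 - expo_a = (1 + 3 * \<nu>) / (2 * (1 + \<nu>))" using nu unfolding expo_a_def by (simp add: field_simps)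
  have 2: "1 + expo_d = (expo_e + 1) / (1 - expo_a)"
    unfolding expo_d_def using expo_a by (simp add: field_simps)
  have "expo_a / (1 - expo_a) = (1 - \<nu>) / (1 + 3 * \<nu>)"
    unfolding 1 unfolding expo_a_def using nu by simp
  moreover have "expo_q = expo_a / (1 - expo_a) * (expo_e + 1)" unfolding expo_q_def 2 by simp
  ultimately show ?thesis unfolding expo_e_def by simp
qed

lemma step_radius_pos: "1 \<le> B \<Longrightarrow> 0 < step_radius B"
  using lam Hc_pos \<beta>1 unfolding step_radius_def by simp

lemma delta_pos: "1 \<le> B \<Longrightarrow> 0 < delta B"
  using delta_c unfolding delta_def by simp

lemma gamma_pos: "1 \<le> B \<Longrightarrow> 0 < gamma B"
  using step_radius_pos[of B] Hc_pos unfolding gamma_def by simp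

text \<open>The radius solves this equation for the proximal tolerance; here the 12 and the
  \<open>B\<^sup>2\<close> in \<open>step_radius\<close> originate.\<close>

lemma tolerance_eq:
  assumes "1 \<le> B"
  shows "3 * (Hc * B) * step_radius B powr \<nu> = lam / (\<beta>1 * B) / 4"
proof -
  have "step_radius B powr \<nu> = lam / (12 * Hc * \<beta>1 * B\<^sup>2)"
    using nu lam Hc_pos \<beta>1 unfolding step_radius_def by (simp add: powr_powr)
  then show ?thesis using Hc_pos assms \<beta>1 by (simp add: power2_eq_square field_simps)
qed

lemma gap_le:
  assumes B: "1 \<le> B"
  shows "gap_c * B powr (- expo_e) \<le> Hc * B * step_radius B powr (1 + \<nu>)"
proof -
  have "step_radius B powr (1 + \<nu>) = (lam / (12 * Hc * \<beta>1) / B\<^sup>2) powr ((1 + \<nu>) / \<nu>)"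
    unfolding step_radius_def by (simp add: powr_powr)
  also have "\<dots> = (lam / (12 * Hc * \<beta>1)) powr ((1 + \<nu>) / \<nu>) / (B\<^sup>2) powr ((1 + \<nu>) / \<nu>)"
    using lam Hc_pos \<beta>1 by (intro powr_divide)
  also have "(B\<^sup>2) powr ((1 + \<nu>) / \<nu>) = B powr expo_e"
  proof -
    have "(B\<^sup>2) powr ((1 + \<nu>) / \<nu>) = B powr ((1 + \<nu>) / \<nu> + (1 + \<nu>) / \<nu>)"
      using B by (simp only: power2_eq_square powr_mult powr_add)
    also have "(1 + \<nu>) / \<nu> + (1 + \<nu>) / \<nu> = expo_e" using nu unfolding expo_e_def by (simp add: field_simps)
    finally show ?thesis .
  qed
  finally have "Hc * B * step_radius B powr (1 + \<nu>) = B * (gap_c * B powr (- expo_e))"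
    unfolding gap_c_def by (simp only: powr_minus divide_inverse ac_simps)
  \<comment> \<open>The surplus factor \<open>B\<close> is given away; \<open>expo_e\<close> in this
    form matches the exponent of the stated complexity.\<close>
  moreover have "1 * (gap_c * B powr (- expo_e)) \<le> B * (gap_c * B powr (- expo_e))"
    using B gap_c_pos by (intro mult_right_mono) auto
  ultimately show ?thesis by linarith
qed

lemma rho_bounds:
  assumes "1 \<le> B" "norm y \<le> Y"
  shows "rho_lo * B \<le> \<rho> (\<beta>1 * B) y" "\<rho> (\<beta>1 * B) y \<le> rho_up * B"
proof -
  have "0 \<le> Lf + LA * norm y" using const_pos by simp
  then show "rho_lo * B \<le> \<rho> (\<beta>1 * B) y" unfolding rho_def rho_lo_def by (simp add: algebra_simps)
  have "Lf * 1 \<le> Lf * B" using assms const_pos by (intro mult_left_mono) auto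
  moreover have "LA * (norm y * 1) \<le> LA * (Y * B)" using assms const_pos Y by (intro mult_left_mono mult_mono) auto
  ultimately show "\<rho> (\<beta>1 * B) y \<le> rho_up * B" unfolding rho_def rho_up_def by (simp add: algebra_simps)
qed

lemma HF_bounds:
  assumes B: "1 \<le> B" and y: "norm y \<le> Y"
  shows "0 < HF (\<beta>1 * B) y" "HF (\<beta>1 * B) y \<le> Hc * B"
proof -
  define C where "C = 2 powr (1 - \<nu>) * JAmax powr (1 + \<nu>) + Amax powr \<nu> * LA"
  have C: "0 \<le> C" using const_pos unfolding C_def by simp
  have rp: "0 < \<rho> (\<beta>1 * B) y" using B \<beta>1 by (intro rho_pos) auto
  have "0 \<le> (Lf + LA * norm y + \<beta>1 * B * C) * HM" using const_pos \<beta>1 B C by (intro mult_nonneg_nonneg) auto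
  moreover have "0 < 2 * \<rho> (\<beta>1 * B) y * HM" using rp by (intro mult_pos_pos) auto
  ultimately show "0 < HF (\<beta>1 * B) y" unfolding H_F_def H_beta_def C_def by linarith
  have "Lf + LA * norm y + \<beta>1 * B * C \<le> (Lf + LA * Y + \<beta>1 * C) * B"
  proof -
    have "Lf * 1 \<le> Lf * B" using B const_pos by (intro mult_left_mono) auto
    moreover have "LA * (norm y * 1) \<le> LA * (Y * B)" using B y const_pos Y by (intro mult_left_mono mult_mono) auto
    ultimately show ?thesis by (simp add: algebra_simps)
  qed
  then have "(Lf + LA * norm y + \<beta>1 * B * C) * HM + 2 * \<rho> (\<beta>1 * B) y * HM
      \<le> ((Lf + LA * Y + \<beta>1 * C) * B) * HM + 2 * (rho_up * B) * HM"
    using rho_bounds(2)[OF B y] by (intro add_mono mult_right_mono mult_left_mono) auto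
  then show "HF (\<beta>1 * B) y \<le> Hc * B"
    unfolding H_F_def H_beta_def C_def Hc_def rho_up_def by (simp add: algebra_simps)
qed

lemma fgm_L_bounds:
  assumes B: "1 \<le> B" and y: "norm y \<le> Y"
  defines "L \<equiv> fgm_L \<nu> (HF (\<beta>1 * B) y) (delta B)"
  shows "0 < L" "L \<le> rho_lo * cond_c\<^sup>2 * B powr (1 + 2 * expo_q)"
    "sqrt (L / \<rho> (\<beta>1 * B) y) \<le> cond_c * B powr expo_q"
proof -
  show L0: "0 < L" unfolding L_def using nu HF_bounds(1)[OF B y] delta_pos[OF B] by (rule fgm_L_pos)
  have "L \<le> Hc * B * (Hc * B / (2 * delta B)) powr (2 * expo_a)"
    unfolding L_def expo_a by (rule fgm_L_le[OF nu HF_bounds[OF B y] delta_pos[OF B]])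
  also have "Hc * B / (2 * delta B) = Hc / 2 / delta_c * B powr (1 + expo_d)"
    using B delta_c unfolding delta_def by (simp add: powr_minus powr_add field_simps)
  also have "(Hc / 2 / delta_c * B powr (1 + expo_d)) powr (2 * expo_a)
      = ((Hc / 2) powr expo_a * delta_c powr (- expo_a))\<^sup>2 * B powr (2 * expo_q)"
  proof -
    have "(Hc / 2 / delta_c * B powr (1 + expo_d)) powr (2 * expo_a)
        = (Hc / 2) powr (2 * expo_a) / delta_c powr (2 * expo_a) * B powr ((1 + expo_d) * (2 * expo_a))"
      using B Hc_pos delta_c by (simp only: powr_mult powr_divide powr_powr)
    moreover have "(1 + expo_d) * (2 * expo_a) = 2 * expo_q" unfolding expo_q_def by simp
    moreover have "x powr (2 * expo_a) = (x powr expo_a)\<^sup>2" for x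
      by (simp add: power2_eq_square flip: powr_add)
    ultimately show ?thesis by (simp only: power_mult_distrib powr_minus divide_inverse power_inverse)
  qed
  finally have L1: "L \<le> Hc * B * (((Hc / 2) powr expo_a * delta_c powr (- expo_a))\<^sup>2 * B powr (2 * expo_q))" .
  have cc: "rho_lo * cond_c\<^sup>2 = Hc * ((Hc / 2) powr expo_a * delta_c powr (- expo_a))\<^sup>2"
    unfolding cond_c_def kappa_def using Hc_pos rho_lo_pos by (simp add: power_mult_distrib)
  have "L \<le> rho_lo * cond_c\<^sup>2 * (B * B powr (2 * expo_q))"
    using L1 unfolding cc by (simp add: ac_simps)
  also have "B * B powr (2 * expo_q) = B powr (1 + 2 * expo_q)" using B by (simp add: powr_add)
  finally show L2: "L \<le> rho_lo * cond_c\<^sup>2 * B powr (1 + 2 * expo_q)" .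
  have "L / \<rho> (\<beta>1 * B) y \<le> (rho_lo * cond_c\<^sup>2 * B powr (1 + 2 * expo_q)) / (rho_lo * B)"
    using L0 L2 rho_bounds(1)[OF B y] rho_lo_pos B by (intro frac_le) auto
  also have "\<dots> = (cond_c * B powr expo_q)\<^sup>2"
  proof -
    have "B powr (1 + 2 * expo_q) = B * (B powr expo_q)\<^sup>2"
      using B by (simp add: power2_eq_square powr_add[of B 1 "2 * expo_q"] flip: powr_add)
    then show ?thesis using rho_lo_pos B by (simp add: power_mult_distrib)
  qed
  finally show "sqrt (L / \<rho> (\<beta>1 * B) y) \<le> cond_c * B powr expo_q"
    using cond_c_pos by (intro real_le_lsqrt) auto
qed

lemma delta_error:
  assumes B: "1 \<le> B" and Q: "Q \<le> cond_c * B powr expo_q"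
  shows "delta B * (1 + Q) \<le> gap_c / 2 * B powr (- expo_e)"
proof -
  have "1 \<le> B powr expo_q" using B expo_pos by (simp add: ge_one_powr_ge_zero)
  then have "1 + Q \<le> (1 + cond_c) * B powr expo_q" using Q by (simp add: distrib_right)
  then have "delta B * (1 + Q) \<le> delta B * ((1 + cond_c) * B powr expo_q)"
    using delta_pos[OF B] by (intro mult_left_mono) auto
  also have "\<dots> = delta_c * (1 + cond_c) * (B powr (- expo_d) * B powr expo_q)"
    unfolding delta_def by (simp add: ac_simps)
  also have "B powr (- expo_d) * B powr expo_q = B powr (- expo_e)"
  proof -
    have "- expo_d + expo_q = - expo_e" using expo_d_minus_q by linarith
    then show ?thesis by (simp flip: powr_add)
  qed
  also have "delta_c * (1 + cond_c) * B powr (- expo_e) \<le> gap_c / 2 * B powr (- expo_e)"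
  proof (rule mult_right_mono)
    have "delta_c powr (1 - expo_a) \<le> delta_c powr (1 / 2)"
      using delta_c expo_a by (intro powr_mono') auto
    moreover have "delta_c powr 1 \<le> delta_c powr (1 / 2)"
      using delta_c by (intro powr_mono') auto
    ultimately have "delta_c + kappa * delta_c powr (1 - expo_a) \<le> sqrt delta_c + kappa * sqrt delta_c"
      using delta_c kappa_pos by (intro add_mono mult_left_mono) (auto simp: powr_half_sqrt)
    moreover have "delta_c * (1 + cond_c) = delta_c + kappa * delta_c powr (1 - expo_a)"
      unfolding cond_c_def using delta_c by (simp add: distrib_left powr_diff powr_minus divide_inverse)
    moreover have "sqrt delta_c \<le> gap_c / (2 * (1 + kappa))"
      using gap_c_pos kappa_pos by (intro real_le_lsqrt) (auto simp: delta_c_def)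
    then have "sqrt delta_c * (1 + kappa) \<le> gap_c / (2 * (1 + kappa)) * (1 + kappa)"
      using kappa_pos by (intro mult_right_mono) auto
    moreover have "gap_c / (2 * (1 + kappa)) * (1 + kappa) = gap_c / 2" using kappa_pos by (simp add: field_simps)
    moreover have "sqrt delta_c * (1 + kappa) = sqrt delta_c + kappa * sqrt delta_c"
      by (simp add: algebra_simps)
    ultimately show "delta_c * (1 + cond_c) \<le> gap_c / 2" by linarith
  qed simp
  finally show ?thesis .
qed

definition "log_c0 = ln (max 1 (rho_lo * cond_c\<^sup>2 * D\<^sup>2 / gap_c))"
definition "log_c1 = 1 + 2 * expo_q + expo_e"
definition "fgm_c = (1 + cond_c) * (log_c0 + log_c1) + 2"

text \<open>The admissible gap is split in halves, one for the oracle error and one for the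
  geometric term. The required contraction is polynomial in \<open>B\<close>, so its logarithm costs
  only \<open>1 + ln B\<close>.\<close>

lemma fgm_iterations:
  assumes B: "1 \<le> B" and y: "norm y \<le> Y"
  defines "L \<equiv> fgm_L \<nu> (HF (\<beta>1 * B) y) (delta B)" and "q \<equiv> sqrt (\<rho> (\<beta>1 * B) y / fgm_L \<nu> (HF (\<beta>1 * B) y) (delta B))"
  shows "\<exists>k::nat. L / 2 * D\<^sup>2 / (1 + q) ^ k + delta B * (1 + 1 / q) \<le> Hc * B * step_radius B powr (1 + \<nu>)
    \<and> real (k + 1) \<le> fgm_c * (B powr expo_q * (1 + ln B))"
proof -
  have rp: "0 < \<rho> (\<beta>1 * B) y" using B \<beta>1 by (intro rho_pos) auto
  note Lb = fgm_L_bounds[OF B y, folded L_def]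
  have q0: "0 < q" using rp Lb(1) unfolding q_def L_def by simp
  have q1: "1 / q = sqrt (L / \<rho> (\<beta>1 * B) y)" unfolding q_def L_def by (simp add: real_sqrt_divide)
  have q2: "1 / q \<le> cond_c * B powr expo_q" using Lb(3) unfolding q1 .
  define e where "e = gap_c * B powr (- expo_e)"
  have e: "0 < e" using gap_c_pos B unfolding e_def by simp
  \<comment> \<open>Bounds \<open>L * D\<^sup>2 / e\<close>, the power of \<open>1 + q\<close> to be
    reached; the maximum with 1 keeps its logarithm nonnegative.\<close>
  define a where "a = max 1 (rho_lo * cond_c\<^sup>2 * D\<^sup>2 / gap_c) * B powr log_c1"
  have Bl: "1 \<le> B powr log_c1" using B expo_pos unfolding log_c1_def by (intro ge_one_powr_ge_zero) auto
  then have a: "1 \<le> a" unfolding a_def using mult_mono[of 1 "max 1 (rho_lo * cond_c\<^sup>2 * D\<^sup>2 / gap_c)" 1 "B powr log_c1"] by simp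
  have "L * D\<^sup>2 / e \<le> (rho_lo * cond_c\<^sup>2 * B powr (1 + 2 * expo_q)) * D\<^sup>2 / e"
    using Lb(2) e by (intro divide_right_mono mult_right_mono) auto
  also have "\<dots> = rho_lo * cond_c\<^sup>2 * D\<^sup>2 / gap_c * B powr log_c1"
    unfolding e_def log_c1_def powr_add[of B "1 + 2 * expo_q"] powr_minus by (simp add: field_simps)
  also have "\<dots> \<le> a" unfolding a_def by (intro mult_right_mono) auto
  finally have La: "L * D\<^sup>2 / e \<le> a" .
  have lna: "ln a = log_c0 + log_c1 * ln B"
    unfolding a_def log_c0_def using B by (simp add: ln_mult ln_powr)
  have l0: "0 \<le> log_c0" unfolding log_c0_def by simp
  have l1: "0 \<le> log_c1" using expo_pos unfolding log_c1_def by simp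
  obtain k where k: "a \<le> (1 + q) ^ k" "real k \<le> (1 + 1 / q) * ln a + 1"
    using power_exceeds[OF q0 a] by blast
  have "L * D\<^sup>2 / e \<le> (1 + q) ^ k" using La k(1) by linarith
  then have "L * D\<^sup>2 \<le> (1 + q) ^ k * e" using e by (subst (asm) pos_divide_le_eq)
  moreover have "0 < (1 + q) ^ k" using q0 by simp
  ultimately have "L / 2 * D\<^sup>2 / (1 + q) ^ k \<le> e / 2" by (simp add: field_simps)
  moreover have "delta B * (1 + 1 / q) \<le> e / 2"
    using delta_error[OF B q2] unfolding e_def by simp
  ultimately have 1: "L / 2 * D\<^sup>2 / (1 + q) ^ k + delta B * (1 + 1 / q) \<le> Hc * B * step_radius B powr (1 + \<nu>)"
    using gap_le[OF B] unfolding e_def by linarith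
  have Bq: "1 \<le> B powr expo_q" using B expo_pos by (intro ge_one_powr_ge_zero)
  have lnB: "0 \<le> ln B" using B by simp
  have "(1 + 1 / q) * ln a \<le> ((1 + cond_c) * B powr expo_q) * ((log_c0 + log_c1) * (1 + ln B))"
  proof (rule mult_mono)
    show "1 + 1 / q \<le> (1 + cond_c) * B powr expo_q" using q2 Bq by (simp add: distrib_right)
    show "ln a \<le> (log_c0 + log_c1) * (1 + ln B)" unfolding lna using l0 l1 lnB by (simp add: algebra_simps)
    show "0 \<le> ln a" using a by simp
    show "0 \<le> (1 + cond_c) * B powr expo_q" using cond_c_pos by simp
  qed
  moreover have "2 * 1 \<le> 2 * (B powr expo_q * (1 + ln B))"
    using Bq lnB mult_mono[of 1 "B powr expo_q" 1 "1 + ln B"] by simp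
  ultimately have "real (k + 1) \<le> fgm_c * (B powr expo_q * (1 + ln B))"
    using k(2) unfolding fgm_c_def by (simp add: algebra_simps)
  with 1 show ?thesis by blast
qed

lemma fgm_c_nonneg: "0 \<le> fgm_c"
  using cond_c_pos expo_pos unfolding fgm_c_def log_c0_def log_c1_def
  by (intro add_nonneg_nonneg mult_nonneg_nonneg) auto

text \<open>The gap \<open>\<Delta>\<close> over the guaranteed decrease per proximal step, with
  \<open>B ^ 3\<close> factored out. The 2 covers rounding up and the final step that stops.\<close>

definition "ippm_c \<Delta> = 32 * \<Delta> * rho_up * \<beta>1\<^sup>2 / lam\<^sup>2 + 2"

theorem subproblem_complexity:
  assumes B: "1 \<le> B" and y: "norm y \<le> Y" and s: "\<And>t. s t \<in> X" and x: "x \<in> X"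
    and \<Delta>: "0 \<le> \<Delta>"
    and lower: "\<And>z. z \<in> X \<Longrightarrow> m \<le> psi f A \<nu> (\<beta>1 * B) y z" and init: "psi f A \<nu> (\<beta>1 * B) y x - m \<le> \<Delta>"
  shows "\<exists>w n. subproblem_run f A X D Lf LA Amax JAmax \<nu> (delta B) (gamma B) s (\<beta>1 * B) y (lam / (\<beta>1 * B)) x w n
    \<and> approx_solution X (psi f A \<nu> (\<beta>1 * B) y) (lam / (\<beta>1 * B)) w
    \<and> real n \<le> ippm_c \<Delta> * fgm_c * (B powr (3 + expo_q) * (1 + ln B))"
proof -
  define \<beta> where "\<beta> = \<beta>1 * B"
  define \<epsilon> where "\<epsilon> = lam / \<beta>"
  have \<beta>: "0 \<le> \<beta>" "0 < \<beta>" using \<beta>1 B unfolding \<beta>_def by auto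
  have \<epsilon>: "0 < \<epsilon>" using lam \<beta> unfolding \<epsilon>_def by simp
  have rp: "0 < \<rho> \<beta> y" using \<beta>(1) by (rule rho_pos)
  define L where "L = fgm_L \<nu> (HF \<beta> y) (delta B)"
  obtain k where k: "L / 2 * D\<^sup>2 / (1 + sqrt (\<rho> \<beta> y / L)) ^ k + delta B * (1 + 1 / sqrt (\<rho> \<beta> y / L)) \<le> Hc * B * step_radius B powr (1 + \<nu>)"
    "real (k + 1) \<le> fgm_c * (B powr expo_q * (1 + ln B))"
    using fgm_iterations[OF B y] unfolding L_def \<beta>_def by blast
  have prox: "\<exists>v n. fgm X (prox_objective (psi f A \<nu> \<beta> y) (\<rho> \<beta> y) u) L (\<rho> \<beta> y) (gamma B) (\<epsilon> / 4) (s t) = Some (v, n) \<and> n \<le> k + 1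
      \<and> approx_solution X (prox_objective (psi f A \<nu> \<beta> y) (\<rho> \<beta> y) u) (\<epsilon> / 4) v" for t u
  proof (rule fgm_terminates[where g = "\<lambda>z. dpsi \<beta> y z + (2 * \<rho> \<beta> y) *\<^sub>R (z - u)" and D = D and \<nu> = \<nu>
        and H = "HF \<beta> y" and Hb = "Hc * B" and \<delta> = "delta B" and rad = "step_radius B"])
    show "0 < HF \<beta> y" "HF \<beta> y \<le> Hc * B" using HF_bounds[OF B y] unfolding \<beta>_def .
    show "3 * (Hc * B) * step_radius B powr \<nu> \<le> \<epsilon> / 4"
      using tolerance_eq[OF B] unfolding \<epsilon>_def \<beta>_def by simp
    show "GDERIV (prox_objective (psi f A \<nu> \<beta> y) (\<rho> \<beta> y) u) z :> dpsi \<beta> y z + (2 * \<rho> \<beta> y) *\<^sub>R (z - u)" for z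
      by (intro GDERIV_prox_objective GDERIV_psi)
    show "norm (dpsi \<beta> y a + (2 * \<rho> \<beta> y) *\<^sub>R (a - u) - (dpsi \<beta> y b + (2 * \<rho> \<beta> y) *\<^sub>R (b - u)))
        \<le> HF \<beta> y * norm (a - b) powr \<nu>" if "a \<in> X" "b \<in> X" for a b
      by (rule prox_gradient_Hoelder[OF that \<beta>(1)])
    show "prox_objective (psi f A \<nu> \<beta> y) (\<rho> \<beta> y) u a + (dpsi \<beta> y a + (2 * \<rho> \<beta> y) *\<^sub>R (a - u)) \<bullet> (b - a) + \<rho> \<beta> y / 2 * (norm (b - a))\<^sup>2
        \<le> prox_objective (psi f A \<nu> \<beta> y) (\<rho> \<beta> y) u b" if "a \<in> X" "b \<in> X" for a b
      by (rule prox_objective_strongly_convex[OF psi_weakly_convex[OF that \<beta>(1)]])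
  qed (use X nu s norm_diff_le_D rp delta_pos[OF B] step_radius_pos[OF B] k in \<open>auto simp: L_def gamma_def\<close>)
  define M where "M = nat \<lceil>\<Delta> / (\<epsilon>\<^sup>2 / (32 * \<rho> \<beta> y))\<rceil>"
  have quot: "0 \<le> \<Delta> / (\<epsilon>\<^sup>2 / (32 * \<rho> \<beta> y))" using \<Delta> rp by simp
  have M: "\<Delta> / (\<epsilon>\<^sup>2 / (32 * \<rho> \<beta> y)) \<le> real M" "real M \<le> \<Delta> / (\<epsilon>\<^sup>2 / (32 * \<rho> \<beta> y)) + 1"
    using quot unfolding M_def by linarith+
  have "\<Delta> \<le> M * (\<epsilon>\<^sup>2 / (32 * \<rho> \<beta> y))"
    using M(1) \<epsilon> rp by (subst (asm) pos_divide_le_eq) auto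
  then have start: "psi f A \<nu> \<beta> y x - m \<le> M * (\<epsilon>\<^sup>2 / (32 * \<rho> \<beta> y))" using init unfolding \<beta>_def by linarith
  obtain w n where w: "ippm_run (\<lambda>t F. fgm X F L (\<rho> \<beta> y) (gamma B) (\<epsilon> / 4) (s t)) (psi f A \<nu> \<beta> y) (\<rho> \<beta> y) \<epsilon> 1 x w n"
    "n \<le> (M + 1) * (k + 1)" "approx_solution X (psi f A \<nu> \<beta> y) \<epsilon> w"
    using ippm_terminates[of X "psi f A \<nu> \<beta> y" "dpsi \<beta> y" "\<rho> \<beta> y" \<epsilon>
        "\<lambda>t F. fgm X F L (\<rho> \<beta> y) (gamma B) (\<epsilon> / 4) (s t)" "k + 1" m x M 1,
        OF GDERIV_psi rp \<epsilon> psi_weakly_convex[OF _ _ \<beta>(1)] prox lower[folded \<beta>_def] x start] by blast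
  have B3: "1 \<le> B ^ 3" using B by (rule one_le_power)
  have "\<Delta> / (\<epsilon>\<^sup>2 / (32 * \<rho> \<beta> y)) = 32 * \<Delta> * \<rho> \<beta> y * \<beta>\<^sup>2 / lam\<^sup>2"
    using lam \<beta> unfolding \<epsilon>_def by (simp add: field_simps)
  also have "\<dots> \<le> 32 * \<Delta> * (rho_up * B) * \<beta>\<^sup>2 / lam\<^sup>2"
    using rho_bounds(2)[OF B y] \<Delta> unfolding \<beta>_def by (intro divide_right_mono mult_right_mono mult_left_mono) auto
  also have "\<dots> = 32 * \<Delta> * rho_up * \<beta>1\<^sup>2 / lam\<^sup>2 * B ^ 3"
    unfolding \<beta>_def by (simp add: power2_eq_square power3_eq_cube)
  finally have "real (M + 1) \<le> ippm_c \<Delta> * B ^ 3"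
    using M(2) B3 unfolding ippm_c_def by (simp add: distrib_right)
  then have "real (M + 1) * real (k + 1) \<le> (ippm_c \<Delta> * B ^ 3) * (fgm_c * (B powr expo_q * (1 + ln B)))"
    using k(2) by (intro mult_mono) auto
  moreover have "real n \<le> real (M + 1) * real (k + 1)" using w(2) by (simp only: of_nat_le_iff flip: of_nat_mult)
  moreover have "B powr (3 + expo_q) = B ^ 3 * B powr expo_q"
    using B by (simp add: powr_add)
  ultimately have n: "real n \<le> ippm_c \<Delta> * fgm_c * (B powr (3 + expo_q) * (1 + ln B))"
    by (simp add: ac_simps)
  have "subproblem_run f A X D Lf LA Amax JAmax \<nu> (delta B) (gamma B) s \<beta> y \<epsilon> x w n"
    using w(1) unfolding subproblem_run_def Let_def L_def .
  then show ?thesis using w(3) n unfolding \<beta>_def \<epsilon>_def by blast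
qed

end

subsection \<open>The outer iteration\<close>

text \<open>The increment of \<open>ln\<close> from \<open>k + 1\<close> to \<open>k + 2\<close> is
  at least \<open>1 / (k + 2)\<close>; the factor 2 compensates for \<open>k + 1\<close> in place of
  \<open>k + 2\<close>.\<close>

lemma inverse_log_telescope:
  assumes "1 \<le> (k::nat)"
  shows "1 / (real (k + 1) * (ln (real (k + 2)))\<^sup>2) \<le> 2 * (1 / ln (real (k + 1)) - 1 / ln (real (k + 2)))"
proof -
  define a b where "a = ln (real (k + 1))" and "b = ln (real (k + 2))"
  have a: "0 < a" "a \<le> b" using assms unfolding a_def b_def by auto
  have "ln (real (k + 1) / real (k + 2)) \<le> real (k + 1) / real (k + 2) - 1" by (intro ln_le_minus_one) auto
  then have "a - b \<le> - (1 / real (k + 2))" unfolding a_def b_def by (simp add: ln_div field_simps)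
  then have ab: "1 / real (k + 2) \<le> b - a" by simp
  have "1 / real (k + 1) \<le> 2 * (1 / real (k + 2))" by (simp add: field_simps)
  then have "1 / real (k + 1) / b\<^sup>2 \<le> 2 * (b - a) / b\<^sup>2" using ab by (intro divide_right_mono) auto
  also have "\<dots> \<le> 2 * (b - a) / (a * b)"
    using a by (intro divide_left_mono) (auto simp: power2_eq_square mult_right_mono)
  also have "\<dots> = 2 * (1 / a - 1 / b)" using a by (simp add: field_simps)
  finally show ?thesis unfolding a_def b_def by simp
qed

text \<open>One logarithm stems from the inner linear rate, the other from the number of outer
  iterations.\<close>

definition complexity_bound :: "real \<Rightarrow> real \<Rightarrow> real \<Rightarrow> real" where
  "complexity_bound C p b = C * (b powr p * (1 + ln b)\<^sup>2)"

lemma complexity_bound_mono: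
  assumes "0 \<le> C" "0 \<le> p" "1 \<le> a" "a \<le> b"
  shows "complexity_bound C p a \<le> complexity_bound C p b"
  unfolding complexity_bound_def using assms
  by (intro mult_left_mono mult_mono power_mono powr_mono2) auto

lemma complexity_bound_soft_O:
  assumes "0 \<le> C" "0 < c" "0 < r" "0 < p"
  shows "(\<lambda>e. complexity_bound C p (max 1 (c * e powr (- r)))) \<in> soft_O (at_right 0) (\<lambda>e. e powr (- (r * p)))"
proof -
  define K where "K = C * c powr p * (1 + r)\<^sup>2 / (r * p)\<^sup>2"
  \<comment> \<open>Below \<open>e0\<close> the maximum with 1 is resolved and
    \<open>1 + \<bar>ln c\<bar>\<close> is at most \<open>- ln e\<close>, so all logarithms are
    multiples of \<open>ln e\<close>.\<close>
  define e0 where "e0 = min (exp (- (1 + \<bar>ln c\<bar>))) (c powr (1 / r))"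
  have e0: "0 < e0" using assms unfolding e0_def by simp
  have "(\<lambda>e. complexity_bound C p (max 1 (c * e powr (- r))))
      \<in> O[at_right 0](\<lambda>e. e powr (- (r * p)) * ln (e powr (- (r * p))) ^ 2)"
  proof (rule bigoI[of _ K])
    have "\<forall>\<^sub>F e in at_right 0. 0 < e \<and> e < e0"
      using e0 by (auto simp: eventually_at_right_field)
    then show "\<forall>\<^sub>F e in at_right 0. norm (complexity_bound C p (max 1 (c * e powr (- r))))
        \<le> K * norm (e powr (- (r * p)) * ln (e powr (- (r * p))) ^ 2)"
    proof eventually_elim
      case (elim e)
      have "e powr r \<le> (c powr (1 / r)) powr r" using elim assms unfolding e0_def by (intro powr_mono2) auto
      then have "e powr r \<le> c" using assms by (simp add: powr_powr)
      then have ge1: "1 \<le> c * e powr (- r)" using elim by (simp add: powr_minus field_simps)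
      have "ln e \<le> ln (exp (- (1 + \<bar>ln c\<bar>)))" using elim unfolding e0_def by (subst ln_le_cancel_iff) auto
      then have l: "1 + \<bar>ln c\<bar> \<le> - ln e" by simp
      have lnc: "ln (c * e powr (- r)) = ln c - r * ln e" using elim assms by (simp add: ln_mult ln_powr)
      have "0 \<le> ln (c * e powr (- r))" using ge1 by simp
      then have "0 \<le> 1 + ln c - r * ln e" unfolding lnc by simp
      moreover have "1 + ln c - r * ln e \<le> (1 + r) * (- ln e)" using l by (simp add: algebra_simps)
      ultimately have "(1 + ln c - r * ln e)\<^sup>2 \<le> ((1 + r) * (- ln e))\<^sup>2" by (intro power_mono)
      then have sq: "(1 + ln (c * e powr (- r)))\<^sup>2 \<le> (1 + r)\<^sup>2 * (ln e)\<^sup>2"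
        unfolding lnc by (simp add: power_mult_distrib add_diff_eq)
      have pw: "(c * e powr (- r)) powr p = c powr p * e powr (- (r * p))"
        using elim assms by (simp add: powr_mult powr_powr)
      have "complexity_bound C p (max 1 (c * e powr (- r)))
          = C * (c powr p * e powr (- (r * p)) * (1 + ln (c * e powr (- r)))\<^sup>2)"
        using ge1 by (simp add: complexity_bound_def pw max_absorb2)
      also have "\<dots> \<le> C * (c powr p * e powr (- (r * p)) * ((1 + r)\<^sup>2 * (ln e)\<^sup>2))"
        using sq assms by (intro mult_left_mono) auto
      also have "\<dots> = K * (e powr (- (r * p)) * (r * p * ln e)\<^sup>2)"
        using assms unfolding K_def by (simp add: power_mult_distrib)
      also have "(r * p * ln e)\<^sup>2 = ln (e powr (- (r * p))) ^ 2"
        using elim by (simp add: ln_powr)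
      finally have "complexity_bound C p (max 1 (c * e powr (- r)))
          \<le> K * (e powr (- (r * p)) * ln (e powr (- (r * p))) ^ 2)" .
      moreover have "0 \<le> complexity_bound C p (max 1 (c * e powr (- r)))"
        unfolding complexity_bound_def using assms by simp
      ultimately show ?case by (simp add: abs_mult)
    qed
  qed
  then show ?thesis unfolding soft_O_def by blast
qed

text \<open>The least sufficient power overshoots \<open>b\<close> by a factor of at most
  \<open>\<omega>\<close>; the 1 covers the case that the initial power already suffices.\<close>

lemma geometric_stopping_index:
  fixes \<omega> b :: real
  assumes "1 < \<omega>"
  shows "\<exists>K\<ge>1. b \<le> \<omega> ^ (K - 1) \<and> \<omega> ^ (K - 1) \<le> max 1 (\<omega> * b)"
proof -
  obtain n0 where "b < \<omega> ^ n0" using real_arch_pow[OF assms] by blast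
  then have ex: "b \<le> \<omega> ^ n0" by simp
  define n where "n = (LEAST n. b \<le> \<omega> ^ n)"
  have n: "b \<le> \<omega> ^ n" unfolding n_def using LeastI[of "\<lambda>n. b \<le> \<omega> ^ n", OF ex] .
  have "\<omega> ^ n \<le> max 1 (\<omega> * b)"
  proof (cases n)
    case (Suc j)
    then have "\<not> b \<le> \<omega> ^ j" using not_less_Least[of j "\<lambda>n. b \<le> \<omega> ^ n"] unfolding n_def by simp
    then have "\<omega> * \<omega> ^ j \<le> \<omega> * b" using assms by (intro mult_left_mono) auto
    then show ?thesis using Suc by simp
  qed simp
  then show ?thesis using n by (intro exI[of _ "Suc n"]) auto
qed

text \<open>Every summand is replaced by the last bound. The number of summands is logarithmic in
  the last power, which the soft-O absorbs.\<close>

lemma sum_geometric_le_complexity_bound: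
  fixes \<omega> C p :: real
  assumes \<omega>: "1 < \<omega>" and C: "0 \<le> C" "0 \<le> p" and K: "1 \<le> K"
    and N: "\<And>k. k \<in> {1..K} \<Longrightarrow> real (N k) \<le> C * ((\<omega> ^ (k - 1)) powr p * (1 + ln (\<omega> ^ (k - 1))))"
  shows "real (\<Sum>k = 1..K. N k) \<le> complexity_bound (C * (1 + 1 / ln \<omega>)) p (\<omega> ^ (K - 1))"
proof -
  define B where "B = \<omega> ^ (K - 1)"
  have B: "1 \<le> B" unfolding B_def using \<omega> by simp
  have l: "0 < ln \<omega>" using \<omega> by simp
  have lnB: "0 \<le> ln B" using B by simp
  have "real (N k) \<le> C * (B powr p * (1 + ln B))" if k: "k \<in> {1..K}" for k
  proof -
    have b: "1 \<le> \<omega> ^ (k - 1)" "\<omega> ^ (k - 1) \<le> B"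
      unfolding B_def using \<omega> k by (auto intro!: power_increasing)
    have "(\<omega> ^ (k - 1)) powr p * (1 + ln (\<omega> ^ (k - 1))) \<le> B powr p * (1 + ln B)"
    proof (intro mult_mono powr_mono2 add_left_mono)
      show "ln (\<omega> ^ (k - 1)) \<le> ln B" using b by (subst ln_le_cancel_iff) auto
      have "0 \<le> ln (\<omega> ^ (k - 1))" using b by simp
      then show "0 \<le> 1 + ln (\<omega> ^ (k - 1))" by linarith
    qed (use b C in auto)
    then show ?thesis using N[OF k] C by (meson mult_left_mono order_trans)
  qed
  then have "real (\<Sum>k = 1..K. N k) \<le> (\<Sum>k = 1..K. C * (B powr p * (1 + ln B)))"
    unfolding of_nat_sum by (rule sum_mono)
  also have "\<dots> = real K * (C * (B powr p * (1 + ln B)))" by simp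
  also have "\<dots> \<le> (1 + 1 / ln \<omega>) * (1 + ln B) * (C * (B powr p * (1 + ln B)))"
  proof (rule mult_right_mono)
    have "ln B = (real K - 1) * ln \<omega>" unfolding B_def using \<omega> K by (simp add: ln_realpow of_nat_diff)
    then have "real K = 1 + ln B / ln \<omega>" using l by simp
    also have "\<dots> \<le> 1 + (ln B + (1 + ln B) / ln \<omega>)"
      using l lnB divide_right_mono[of "ln B" "1 + ln B" "ln \<omega>"] by simp
    also have "\<dots> = (1 + 1 / ln \<omega>) * (1 + ln B)" by (simp add: algebra_simps)
    finally show "real K \<le> (1 + 1 / ln \<omega>) * (1 + ln B)" .
    show "0 \<le> C * (B powr p * (1 + ln B))" using C lnB by simp
  qed
  also have "\<dots> = complexity_bound (C * (1 + 1 / ln \<omega>)) p B"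
    unfolding complexity_bound_def by (simp add: power2_eq_square)
  finally show ?thesis unfolding B_def .
qed

text \<open>The second argument of the minimum cancels \<open>norm (A x') powr \<nu>\<close>. If
  \<open>A x' = 0\<close>, the convention for the minimum is harmless because the left-hand side is
  0.\<close>

lemma next_sigma_step_le:
  assumes \<sigma>1: "0 \<le> \<sigma>1" and k: "1 \<le> k"
  shows "next_sigma A \<nu> \<sigma>1 x1 k x' * norm (A x') powr \<nu>
    \<le> \<sigma>1 * norm (A x1) powr \<nu> * (ln 2)\<^sup>2 * (2 * (1 / ln (real (k + 1)) - 1 / ln (real (k + 2))))"
proof -
  define d where "d = real (k + 1) * (ln (real (k + 2)))\<^sup>2"
  define c where "c = norm (A x1) powr \<nu> * (ln 2)\<^sup>2"
  have c: "0 \<le> c" unfolding c_def by simp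
  have d: "0 < d" unfolding d_def by simp
  have "next_sigma A \<nu> \<sigma>1 x1 k x' * norm (A x') powr \<nu> \<le> \<sigma>1 * (c * (1 / d))"
  proof (cases "A x' = 0")
    case True
    then show ?thesis using \<sigma>1 c d by simp
  next
    case False
    define n where "n = norm (A x') powr \<nu>"
    have n: "0 < n" using False unfolding n_def by simp
    have "next_sigma A \<nu> \<sigma>1 x1 k x' = \<sigma>1 * min 1 (c / (n * d))"
      using False by (simp add: next_sigma_def c_def d_def n_def mult.assoc)
    then have "next_sigma A \<nu> \<sigma>1 x1 k x' * n \<le> \<sigma>1 * (c / (n * d)) * n"
      using \<sigma>1 n by (simp only:) (intro mult_right_mono mult_left_mono min.cobounded2, auto)
    then show ?thesis using n unfolding n_def by simp
  qed
  also have "\<dots> \<le> \<sigma>1 * (c * (2 * (1 / ln (real (k + 1)) - 1 / ln (real (k + 2)))))"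
    unfolding d_def using inverse_log_telescope[OF k] \<sigma>1 c by (intro mult_left_mono)
  finally show ?thesis unfolding c_def by (simp only: mult.assoc)
qed

lemma next_sigma_nonneg: "0 \<le> \<sigma>1 \<Longrightarrow> 0 \<le> next_sigma A \<nu> \<sigma>1 x1 k x'"
  unfolding next_sigma_def by simp

theorem theorem5:
  fixes f :: "real^'n \<Rightarrow> real" and A :: "real^'n \<Rightarrow> real^'m" and X :: "(real^'n) set"
    and D Lf LA Amax JAmax gfmax \<nu> lam \<omega> \<sigma>1 \<beta>1 :: real
    and x1 :: "real^'n" and y1 :: "real^'m"
  assumes f_diff: "\<And>x. f differentiable (at x)"
    and f_C1: "continuous_on UNIV (gradient f)"
    and A_diff: "\<And>x. A differentiable (at x)"
    and A_C1: "continuous_on UNIV (\<lambda>x. jacobian A (at x))"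
    and P: "assumption_P f A X D Lf LA Amax JAmax gfmax"
    and R: "assumption_R A X"
    and nu: "0 < \<nu>" "\<nu> \<le> 1"
    and params: "0 < lam" "1 < \<omega>" "0 < \<sigma>1" "0 < \<beta>1"
    and x1: "x1 \<in> X"
  shows "\<exists>(\<delta> :: nat \<Rightarrow> real) (\<gamma> :: nat \<Rightarrow> real) (T_phi :: real \<Rightarrow> real) (T_A :: real \<Rightarrow> real).
    (\<forall>k. 0 < \<delta> k) \<and> (\<forall>k. 0 < \<gamma> k) \<and>
    T_phi \<in> soft_O (at_right 0)
      (\<lambda>e. e powr (- 3 - (1 - \<nu>) / (1 + 3 * \<nu>) * (1 + 2 * (1 + \<nu>) / \<nu>))) \<and>
    T_A \<in> soft_O (at_right 0)
      (\<lambda>e. e powr (- 3 * \<nu> - (1 - \<nu>) / (1 + 3 * \<nu>) * (3 * \<nu> + 2))) \<and>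
    (\<forall>(s :: nat \<Rightarrow> nat \<Rightarrow> real^'n) x y \<sigma> \<beta> \<epsilon> (N :: nat \<Rightarrow> nat).
       let solve = (\<lambda>k. subproblem_run f A X D Lf LA Amax JAmax \<nu> (\<delta> k) (\<gamma> k) (s k)) in
       (\<forall>k t. s k t \<in> X) \<longrightarrow>
       power_alm_iterates solve A \<nu> lam \<omega> \<sigma>1 \<beta>1 x1 y1 x y \<sigma> \<beta> \<epsilon> N \<longrightarrow>
       (\<forall>eps_phi>0. \<forall>eps_A>0. \<exists>K\<ge>1.
          (\<forall>k\<in>{1..K}.
             solve k (\<beta> k) (y k) (\<epsilon> (k + 1)) (x k) (x (k + 1)) (N k) \<and>
             approx_solution X (psi f A \<nu> (\<beta> k) (y k)) (\<epsilon> (k + 1)) (x (k + 1))) \<and>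
          stationary_point f A X eps_phi eps_A (x (K + 1)) \<and>
          real (\<Sum>k = 1..K. N k) \<le> max (T_phi eps_phi) (T_A eps_A)))"
proof -
  interpret alm: power_alm f A X D Lf LA Amax JAmax gfmax \<nu>
    by unfold_locales (fact f_diff A_diff P R nu)+
  define sum_c where "sum_c = \<sigma>1 * norm (A x1) powr \<nu> * (ln 2)\<^sup>2"
  have sum_c: "0 \<le> sum_c" using params unfolding sum_c_def by simp
  \<comment> \<open>\<open>2 / ln 2\<close> is the value of the telescoping series in
    \<open>next_sigma_step_le\<close>, summed from \<open>k = 1\<close>.\<close>
  define Y where "Y = norm y1 + sum_c * (2 / ln 2)"
  have Y: "0 \<le> Y" using sum_c unfolding Y_def by simp
  interpret alm: alm_subproblems f A X D Lf LA Amax JAmax gfmax \<nu> lam \<beta>1 Y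
    by unfold_locales (use params Y in auto)
  obtain Rc where Rc: "0 < Rc"
    "\<And>x. x \<in> X \<Longrightarrow> Rc * norm (A x) \<le> infdist (- (transpose (jacobian A (at x)) *v A x)) (normal_cone X x)"
  proof -
    \<comment> \<open>(R) is applied to the whole of \<open>X\<close>, so one constant serves all
      iterates.\<close>
    have "X \<noteq> {} \<and> compact X \<and> X \<subseteq> X" using alm.X by simp
    then obtain r where "r > 0"
      "\<forall>x\<in>X. r * norm (A x) \<le> infdist (- (transpose (jacobian A (at x)) *v A x)) (normal_cone X x)"
      using R unfolding assumption_R_def by meson
    then show ?thesis using that by simp
  qed
  have "continuous_on X f"
    using f_diff by (intro continuous_at_imp_continuous_on) (auto intro: differentiable_imp_continuous_within)
  then have "bounded (f ` X)" using alm.X(3) by (intro compact_imp_bounded compact_continuous_image)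
  then obtain Fb where Fb: "\<And>x. x \<in> X \<Longrightarrow> \<bar>f x\<bar> \<le> Fb" unfolding bounded_iff by auto
  define mlow where "mlow = - Fb - Amax * Y"
  \<comment> \<open>The right-hand side of \<open>regularity_bound\<close>, uniform in
    \<open>k\<close>: penalties are at least \<open>\<beta>1\<close>, so tolerances are at most
    \<open>lam / \<beta>1\<close>.\<close>
  define Cr where "Cr = lam / \<beta>1 + gfmax + JAmax * Y"
  have Cr: "0 < Cr" using params Y alm.const_pos unfolding Cr_def by (intro add_pos_nonneg add_pos_pos) auto
  \<comment> \<open>The second term bounds the penalty at the warm starts, the first one at the initial point.\<close>
  define Cw where "Cw = max (\<beta>1 * Amax powr (\<nu> + 1)) (\<omega> * Cr / Rc * Amax)"
  have Cw: "0 \<le> Cw" using params unfolding Cw_def by (simp add: le_max_iff_disj)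
  define \<Delta> where "\<Delta> = 2 * Fb + 2 * (Amax * Y) + Cw"
  have \<Delta>: "0 \<le> \<Delta>"
    using Fb[OF x1] Cw Y alm.const_pos mult_nonneg_nonneg[of Amax Y] unfolding \<Delta>_def by linarith
  define p where "p = 3 + alm.expo_q"
  have p: "0 < p" using alm.expo_pos unfolding p_def by simp
  define C where "C = alm.ippm_c \<Delta> * alm.fgm_c"
  have C: "0 \<le> C" unfolding C_def alm.ippm_c_def
    using \<Delta> alm.fgm_c_nonneg alm.rho_up_pos by (intro mult_nonneg_nonneg add_nonneg_nonneg divide_nonneg_nonneg) auto
  define C' where "C' = C * (1 + 1 / ln \<omega>)"
  have C': "0 \<le> C'" using C params unfolding C'_def by simp
  define c_phi where "c_phi = \<omega> * (lam / \<beta>1)"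
  define c_A where "c_A = \<omega> * (Cr / (Rc * \<beta>1))"
  have c: "0 < c_phi" "0 < c_A" using params Cr Rc unfolding c_phi_def c_A_def by auto
  define T_phi where "T_phi = (\<lambda>e. complexity_bound C' p (max 1 (c_phi * e powr (- 1))))"
  define T_A where "T_A = (\<lambda>e. complexity_bound C' p (max 1 (c_A * e powr (- \<nu>))))"
  define B where "B = (\<lambda>k. \<omega> ^ (k - 1))"
  have B1: "1 \<le> B k" for k using params unfolding B_def by simp

  have e_phi: "- (1 * p) = - 3 - (1 - \<nu>) / (1 + 3 * \<nu>) * (1 + 2 * (1 + \<nu>) / \<nu>)"
  proof -
    have "1 + 2 * (1 + \<nu>) / \<nu> = 3 + 2 / \<nu>" using nu by (simp add: field_simps)
    then show ?thesis unfolding p_def alm.expo_q_eq by simp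
  qed
  have e_A: "- (\<nu> * p) = - 3 * \<nu> - (1 - \<nu>) / (1 + 3 * \<nu>) * (3 * \<nu> + 2)"
  proof -
    have "3 * \<nu> + 2 = \<nu> * (3 + 2 / \<nu>)" using nu by (simp add: field_simps)
    then show ?thesis unfolding p_def alm.expo_q_eq using nu by (simp add: distrib_left)
  qed
  have T_phi_O: "T_phi \<in> soft_O (at_right 0) (\<lambda>e. e powr (- 3 - (1 - \<nu>) / (1 + 3 * \<nu>) * (1 + 2 * (1 + \<nu>) / \<nu>)))"
    unfolding T_phi_def e_phi[symmetric] by (rule complexity_bound_soft_O) (use C' c p in auto)
  have T_A_O: "T_A \<in> soft_O (at_right 0) (\<lambda>e. e powr (- 3 * \<nu> - (1 - \<nu>) / (1 + 3 * \<nu>) * (3 * \<nu> + 2)))"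
    unfolding T_A_def e_A[symmetric] by (rule complexity_bound_soft_O) (use C' c p nu in auto)

  have run: "\<exists>K\<ge>1. (\<forall>k\<in>{1..K}. subproblem_run f A X D Lf LA Amax JAmax \<nu> (alm.delta (B k)) (alm.gamma (B k)) (s k)
             (\<beta> k) (y k) (\<epsilon> (k + 1)) (x k) (x (k + 1)) (N k) \<and>
           approx_solution X (psi f A \<nu> (\<beta> k) (y k)) (\<epsilon> (k + 1)) (x (k + 1))) \<and>
         stationary_point f A X eps_phi eps_A (x (K + 1)) \<and>
         real (\<Sum>k = 1..K. N k) \<le> max (T_phi eps_phi) (T_A eps_A)"
    if s: "\<forall>k t. s k t \<in> X"
      and it: "power_alm_iterates (\<lambda>k. subproblem_run f A X D Lf LA Amax JAmax \<nu> (alm.delta (B k)) (alm.gamma (B k)) (s k))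
        A \<nu> lam \<omega> \<sigma>1 \<beta>1 x1 y1 x y \<sigma> \<beta> \<epsilon> N"
      and eps: "0 < eps_phi" "0 < eps_A"
    for s :: "nat \<Rightarrow> nat \<Rightarrow> real^'n" and x y \<sigma> \<beta> \<epsilon> N eps_phi eps_A
  proof -
    have init: "x 1 = x1" "y 1 = y1" "\<beta> 1 = \<beta>1"
      and step: "\<And>k. 1 \<le> k \<Longrightarrow> \<epsilon> (k + 1) = lam / \<beta> k"
        "\<And>k. 1 \<le> k \<Longrightarrow> \<sigma> (k + 1) = next_sigma A \<nu> \<sigma>1 x1 k (x (k + 1))"
        "\<And>k. 1 \<le> k \<Longrightarrow> y (k + 1) = y k + \<sigma> (k + 1) *\<^sub>R gradient (phi \<nu>) (A (x (k + 1)))"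
        "\<And>k. 1 \<le> k \<Longrightarrow> \<beta> (k + 1) = \<omega> * \<beta> k"
      and solve: "\<And>k w n. 1 \<le> k \<Longrightarrow> subproblem_run f A X D Lf LA Amax JAmax \<nu> (alm.delta (B k)) (alm.gamma (B k)) (s k)
        (\<beta> k) (y k) (\<epsilon> (k + 1)) (x k) w n \<Longrightarrow> x (k + 1) = w \<and> N k = n"
      using it unfolding power_alm_iterates_def by blast+
    have \<beta>: "\<beta> k = \<beta>1 * B k" if "1 \<le> k" for k
      using that
    proof (induction k rule: nat_induct_at_least)
      case (Suc k)
      then show ?case using step(4)[of k] by (cases k) (auto simp: B_def)
    qed (simp add: init(3)[simplified] B_def)
    \<comment> \<open>\<open>good k\<close> records the outcome of iteration \<open>k\<close>,
      \<open>inv k\<close> the state before it. They are proved alternately, since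
      \<open>x (k + 1)\<close> is unconstrained until the solver is known to return.\<close>
    define good where "good k \<longleftrightarrow>
      subproblem_run f A X D Lf LA Amax JAmax \<nu> (alm.delta (B k)) (alm.gamma (B k)) (s k)
        (\<beta> k) (y k) (\<epsilon> (k + 1)) (x k) (x (k + 1)) (N k) \<and>
      approx_solution X (psi f A \<nu> (\<beta> k) (y k)) (\<epsilon> (k + 1)) (x (k + 1)) \<and>
      real (N k) \<le> C * (B k powr p * (1 + ln (B k))) \<and>
      Rc * \<beta> k * norm (A (x (k + 1))) powr \<nu> \<le> Cr" for k
    \<comment> \<open>The telescoped sum vanishes at \<open>k = 1\<close>. The last conjunct pairs
      the current penalty with the warm start produced under the previous one.\<close>
    define inv where "inv k \<longleftrightarrow> x k \<in> X \<and> norm (y k) \<le> norm y1 + sum_c * (2 * (1 / ln 2 - 1 / ln (real (k + 1))))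
      \<and> \<beta> k * norm (A (x k)) powr (\<nu> + 1) \<le> Cw" for k
    have goodI: "good k" if k: "1 \<le> k" and "inv k" for k
    proof -
      have xk: "x k \<in> X" and w: "\<beta> k * norm (A (x k)) powr (\<nu> + 1) \<le> Cw" using \<open>inv k\<close> by (auto simp: inv_def)
      have "norm (y k) \<le> norm y1 + sum_c * (2 * (1 / ln 2 - 1 / ln (real (k + 1))))" using \<open>inv k\<close> by (simp add: inv_def)
      also have "\<dots> \<le> Y" unfolding Y_def using sum_c k by (intro add_left_mono mult_left_mono) auto
      finally have yk: "norm (y k) \<le> Y" .
      have \<beta>0: "0 < \<beta> k" "\<beta>1 \<le> \<beta> k" using \<beta>[OF k] params B1[of k] by auto
      have inner: "\<bar>A z \<bullet> y k\<bar> \<le> Amax * Y" if "z \<in> X" for z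
        using Cauchy_Schwarz_ineq2[of "A z" "y k"] mult_mono[OF alm.A_le[OF that] yk] alm.const_pos by simp
      have lower: "mlow \<le> psi f A \<nu> (\<beta> k) (y k) z" if "z \<in> X" for z
      proof -
        have "0 \<le> \<beta> k / (\<nu> + 1) * norm (A z) powr (\<nu> + 1)" using \<beta>0 nu by simp
        then show ?thesis using Fb[OF that] inner[OF that] unfolding mlow_def psi_def by linarith
      qed
      have "\<beta> k / (\<nu> + 1) * norm (A (x k)) powr (\<nu> + 1) \<le> \<beta> k * norm (A (x k)) powr (\<nu> + 1)"
        using \<beta>0 nu by (intro mult_right_mono) (auto simp: field_simps)
      then have start: "psi f A \<nu> (\<beta> k) (y k) (x k) - mlow \<le> \<Delta>"
        using w Fb[OF xk] inner[OF xk] unfolding mlow_def \<Delta>_def psi_def by linarith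
      obtain v n where v: "subproblem_run f A X D Lf LA Amax JAmax \<nu> (alm.delta (B k)) (alm.gamma (B k)) (s k) (\<beta> k) (y k) (\<epsilon> (k + 1)) (x k) v n"
        "approx_solution X (psi f A \<nu> (\<beta> k) (y k)) (\<epsilon> (k + 1)) v"
        "real n \<le> C * (B k powr p * (1 + ln (B k)))"
        using alm.subproblem_complexity[OF B1 yk _ xk \<Delta> lower[unfolded \<beta>[OF k]] start[unfolded \<beta>[OF k]], of "s k"] s
        unfolding step(1)[OF k] \<beta>[OF k] C_def p_def by blast
      \<comment> \<open>The run just constructed pins down the iterate and its count.\<close>
      have vn: "x (k + 1) = v" "N k = n" using solve[OF k v(1)] by auto
      have "Rc * \<beta> k * norm (A v) powr \<nu> \<le> \<epsilon> (k + 1) + gfmax + JAmax * norm (y k)"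
        by (rule alm.regularity_bound[OF Rc(2) v(2) \<beta>0(1)])
      also have "\<dots> \<le> Cr"
        unfolding Cr_def step(1)[OF k] using params \<beta>0 yk alm.const_pos
        by (intro add_mono mult_left_mono divide_left_mono) auto
      finally show ?thesis unfolding good_def using v vn by simp
    qed
    have inv_all: "inv k" if "1 \<le> k" for k
      using that
    proof (induction k rule: nat_induct_at_least)
      case base
      have "\<beta>1 * norm (A x1) powr (\<nu> + 1) \<le> \<beta>1 * Amax powr (\<nu> + 1)"
        using alm.A_le[OF x1] nu params by (intro mult_left_mono powr_mono2) auto
      then show ?case unfolding inv_def using x1 init by (simp add: Cw_def)
    next
      case (Suc k)
      note k = Suc(1)
      have g: "good k" using goodI[OF Suc] .
      define v where "v = x (k + 1)"
      have v: "v \<in> X" using g unfolding good_def approx_solution_def v_def by blast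
      have \<beta>0: "0 < \<beta> k" using \<beta>[OF k] params B1[of k] by simp
      have "0 \<le> \<sigma> (k + 1)" unfolding step(2)[OF k] using params by (simp add: next_sigma_nonneg)
      then have "norm (y (k + 1)) \<le> norm (y k) + \<sigma> (k + 1) * norm (A v) powr \<nu>"
        unfolding step(3)[OF k] gradient_phi[OF nu(1)] v_def[symmetric]
        using norm_triangle_ineq[of "y k" "\<sigma> (k + 1) *\<^sub>R dphi \<nu> (A v)"] by (simp add: norm_dphi)
      also have "\<dots> \<le> (norm y1 + sum_c * (2 * (1 / ln 2 - 1 / ln (real (k + 1)))))
          + sum_c * (2 * (1 / ln (real (k + 1)) - 1 / ln (real (k + 2))))"
        unfolding step(2)[OF k] v_def sum_c_def
        using Suc(2) params by (intro add_mono next_sigma_step_le k) (auto simp: inv_def sum_c_def)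
      also have "\<dots> = norm y1 + sum_c * (2 * (1 / ln 2 - 1 / ln (real (k + 2))))" by (simp add: algebra_simps)
      finally have y': "norm (y (k + 1)) \<le> norm y1 + sum_c * (2 * (1 / ln 2 - 1 / ln (real (k + 2))))" .
      \<comment> \<open>Of the \<open>\<nu> + 1\<close> powers of the norm, \<open>\<nu>\<close> are
        controlled by regularity under the old penalty and one by \<open>Amax\<close>;
        \<open>\<omega>\<close> is the penalty increase.\<close>
      have "\<beta> (k + 1) * norm (A v) powr (\<nu> + 1) = \<omega> / Rc * (Rc * \<beta> k * norm (A v) powr \<nu>) * norm (A v)"
        unfolding step(4)[OF k] using Rc(1) by (simp add: powr_add)
      also have "\<dots> \<le> \<omega> / Rc * Cr * Amax"
        using g alm.A_le[OF v] params Rc(1) Cr unfolding good_def v_def by (intro mult_mono mult_left_mono) auto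
      also have "\<dots> \<le> Cw" unfolding Cw_def by simp
      finally have "\<beta> (k + 1) * norm (A v) powr (\<nu> + 1) \<le> Cw" .
      then show ?case unfolding inv_def using v y' by (simp add: v_def)
    qed
    have good: "good k" if "1 \<le> k" for k using goodI inv_all that by blast

    \<comment> \<open>Beyond the first threshold the tolerance is at most \<open>eps_phi\<close>;
      beyond the second, regularity forces feasibility up to \<open>eps_A\<close>.\<close>
    define b where "b = max (lam / \<beta>1 * eps_phi powr (- 1)) (Cr / (Rc * \<beta>1) * eps_A powr (- \<nu>))"
    obtain K where K: "1 \<le> K" "b \<le> B K" "B K \<le> max 1 (\<omega> * b)"
      using geometric_stopping_index[of \<omega> b] params unfolding B_def by auto
    have \<beta>K: "0 < \<beta> K" using \<beta>[OF K(1)] params B1[of K] by simp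
    have stat: "stationary_point f A X eps_phi eps_A (x (K + 1))"
    proof (rule alm.stationary_if_approx_solution)
      show "approx_solution X (psi f A \<nu> (\<beta> K) (y K)) (\<epsilon> (K + 1)) (x (K + 1))"
        using good[OF K(1)] by (simp add: good_def)
      have "lam / \<beta>1 * eps_phi powr (- 1) \<le> B K" using K(2) unfolding b_def by simp
      then have "lam \<le> eps_phi * \<beta> K"
        unfolding \<beta>[OF K(1)] using params eps by (simp add: powr_minus field_simps)
      then show "\<epsilon> (K + 1) \<le> eps_phi" unfolding step(1)[OF K(1)] using \<beta>K by (simp add: field_simps)
      have "Cr / (Rc * \<beta>1) * eps_A powr (- \<nu>) \<le> B K" using K(2) unfolding b_def by simp
      then have "Cr \<le> Rc * \<beta> K * eps_A powr \<nu>"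
        unfolding \<beta>[OF K(1)] using params eps Rc(1) by (simp add: powr_minus field_simps)
      then have "Rc * \<beta> K * norm (A (x (K + 1))) powr \<nu> \<le> Rc * \<beta> K * eps_A powr \<nu>"
        using good[OF K(1)] unfolding good_def by linarith
      then have "norm (A (x (K + 1))) powr \<nu> \<le> eps_A powr \<nu>" using Rc(1) \<beta>K by simp
      then show "norm (A (x (K + 1))) \<le> eps_A"
        using powr_less_mono2[of \<nu> eps_A "norm (A (x (K + 1)))"] nu eps by linarith
    qed
    have "real (\<Sum>k = 1..K. N k) \<le> complexity_bound C' p (B K)"
      unfolding C'_def B_def
      by (rule sum_geometric_le_complexity_bound) (use params C p K(1) good in \<open>auto simp: good_def B_def\<close>)
    also have "\<dots> \<le> max (T_phi eps_phi) (T_A eps_A)"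
    proof -
      have "\<omega> * b = max (c_phi * eps_phi powr (- 1)) (c_A * eps_A powr (- \<nu>))"
        unfolding b_def c_phi_def c_A_def using params by (simp add: max_mult_distrib_left ac_simps)
      \<comment> \<open>Whichever threshold determines \<open>b\<close> selects the complexity that
        bounds the total.\<close>
      then have "B K \<le> max 1 (c_phi * eps_phi powr (- 1)) \<or> B K \<le> max 1 (c_A * eps_A powr (- \<nu>))"
        using K(3) by (auto simp: le_max_iff_disj)
      then have "complexity_bound C' p (B K) \<le> T_phi eps_phi \<or> complexity_bound C' p (B K) \<le> T_A eps_A"
        unfolding T_phi_def T_A_def using complexity_bound_mono[OF C' less_imp_le[OF p] B1[of K]] by blast
      then show ?thesis by (simp only: le_max_iff_disj)
    qed
    finally show ?thesis using K(1) stat good unfolding good_def by (intro exI[of _ K]) auto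
  qed
  show ?thesis
    unfolding Let_def
    by (rule exI[of _ "\<lambda>k. alm.delta (B k)"], rule exI[of _ "\<lambda>k. alm.gamma (B k)"],
        rule exI[of _ T_phi], rule exI[of _ T_A])
      (use alm.delta_pos[OF B1] alm.gamma_pos[OF B1] T_phi_O T_A_O run in blast)
qed

end
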